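(* Let $n\ge1$, $\mathrm s\in(0,n)$, and $\mathrm g_{\mathrm s}(u,x)=|x-u|^{-\mathrm s}$ for $x,u\in\mathbb R^n$. Let $V:\mathbb R^n\to[0,+\infty]$ be such that $e^{-V}\in L^1(\mathbb R^n)$ and $V$ is continuous on $\mathscr S_V=\{V<+\infty\}$. Consider the Gibbs measure on $(\mathbb R^n)^N$ $$\mathbb P_N[d\mathbf x]=\frac1{\mathrm Z_N^{(V)}}\exp\Big(-\beta\sum_{1\le i<j\le N}\mathrm g_{\mathrm s}(x_i,x_j)-\sum_{j=1}^NV(x_j)\Big)dx_1\cdots dx_N .$$ Then, for any fixed $E\in\mathscr S_V$, under $\mathbb P_N$ the point process $\Xi_N=\sum_{j=1}^N\boldsymbol\delta_{N^{1/n}(x_j-E)}$ converges in distribution, as $N\to+\infty$ and $N\beta\to\gamma$ with $\gamma\ge0$, to a homogeneous Poisson point process on $\mathbb R^n$.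
   Context: Here $\beta=\beta_N>0$ may depend on $N$, $\mathrm Z_N^{(V)}$ is the normalizing constant, $dx$ is Lebesgue measure, $|\cdot|$ is the Euclidean norm, and $e^{-V}=0$ on $\{V=+\infty\}$. The set $\mathscr S_V$ is assumed open and nonempty. A sequence $\Xi_N$ of point processes on $\mathbb R^n$ converges in distribution to $\Xi$ if $\mathbb E[e^{-\Xi_N(f)}]\to\mathbb E[e^{-\Xi(f)}]$ for every continuous compactly supported $f:\mathbb R^n\to[0,+\infty)$. A homogeneous Poisson point process is one with $\mathbb E[e^{-\Xi(f)}]=\exp\big(\theta\int(e^{-f(x)}-1)dx\big)$ for some constant intensity $\theta>0$. *)

theory Defs
  imports "HOL-Probability.Probability"
begin

section \<open>Point processes on a Euclidean space\<close>

text \<open>Configurations are locally finite integer-valued Borel measures, so points may have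
  multiplicities.\<close>

definition point_configs :: "'a::euclidean_space measure set" where
  "point_configs =
     {\<mu>. sets \<mu> = sets borel \<and>
         (\<forall>B\<in>sets borel. bounded B \<longrightarrow> (\<exists>k::nat. emeasure \<mu> B = of_nat k))}"

text \<open>The smallest sigma-algebra making all counts of points in Borel sets measurable.\<close>

definition config_algebra :: "'a::euclidean_space measure measure" where
  "config_algebra =
     (SUP B\<in>sets borel. vimage_algebra point_configs (\<lambda>\<mu>. emeasure \<mu> B) borel)"

definition point_process :: "'w measure \<Rightarrow> ('w \<Rightarrow> 'a::euclidean_space measure) \<Rightarrow> bool" where
  "point_process M \<Xi> \<longleftrightarrow> prob_space M \<and> \<Xi> \<in> measurable M config_algebra"

definition test_functions :: "('a::euclidean_space \<Rightarrow> real) set" where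
  "test_functions =
     {f. continuous_on UNIV f \<and> (\<forall>x. 0 \<le> f x) \<and> compact (closure {x. f x \<noteq> 0})}"

definition laplace_functional ::
    "'w measure \<Rightarrow> ('w \<Rightarrow> 'a::euclidean_space measure) \<Rightarrow> ('a \<Rightarrow> real) \<Rightarrow> real" where
  "laplace_functional M \<Xi> f = (\<integral>\<omega>. exp (- (\<integral>x. f x \<partial>\<Xi> \<omega>)) \<partial>M)"

definition pp_converges_in_distribution ::
    "(nat \<Rightarrow> 'v measure) \<Rightarrow> (nat \<Rightarrow> 'v \<Rightarrow> 'a::euclidean_space measure) \<Rightarrow>
     'w measure \<Rightarrow> ('w \<Rightarrow> 'a measure) \<Rightarrow> bool" where
  "pp_converges_in_distribution P \<Xi>s M \<Xi> \<longleftrightarrow>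
     (\<forall>N. point_process (P N) (\<Xi>s N)) \<and> point_process M \<Xi> \<and>
     (\<forall>f\<in>test_functions.
        (\<lambda>N. laplace_functional (P N) (\<Xi>s N) f) \<longlonglongrightarrow> laplace_functional M \<Xi> f)"

definition homogeneous_poisson_process ::
    "'w measure \<Rightarrow> ('w \<Rightarrow> 'a::euclidean_space measure) \<Rightarrow> bool" where
  "homogeneous_poisson_process M \<Xi> \<longleftrightarrow>
     point_process M \<Xi> \<and>
     (\<exists>\<theta>>0. \<forall>f\<in>test_functions.
        laplace_functional M \<Xi> f = exp (\<theta> * (\<integral>x. exp (- f x) - 1 \<partial>lborel)))"


section \<open>Riesz gases\<close>

definition exp_neg :: "ennreal \<Rightarrow> real" where
  "exp_neg t = (if t = \<infinity> then 0 else exp (- enn2real t))"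

text \<open>The case distinction is needed because \<open>0 powr (- s) = 0\<close> in the library.\<close>

definition riesz_kernel :: "real \<Rightarrow> 'a::euclidean_space \<Rightarrow> 'a \<Rightarrow> ennreal" where
  "riesz_kernel s u x = (if x = u then \<infinity> else ennreal (norm (x - u) powr (- s)))"

definition riesz_energy ::
    "real \<Rightarrow> ('a::euclidean_space \<Rightarrow> ennreal) \<Rightarrow> real \<Rightarrow> nat \<Rightarrow> (nat \<Rightarrow> 'a) \<Rightarrow> ennreal" where
  "riesz_energy s V b N x =
     ennreal b * (\<Sum>i\<in>{1..N}. \<Sum>j\<in>{i<..N}. riesz_kernel s (x i) (x j)) + (\<Sum>j\<in>{1..N}. V (x j))"

definition riesz_partition ::
    "real \<Rightarrow> ('a::euclidean_space \<Rightarrow> ennreal) \<Rightarrow> real \<Rightarrow> nat \<Rightarrow> ennreal" where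
  "riesz_partition s V b N =
     (\<integral>\<^sup>+x. ennreal (exp_neg (riesz_energy s V b N x)) \<partial>(\<Pi>\<^sub>M j\<in>{1..N}. lborel))"

definition riesz_gibbs ::
    "real \<Rightarrow> ('a::euclidean_space \<Rightarrow> ennreal) \<Rightarrow> real \<Rightarrow> nat \<Rightarrow> (nat \<Rightarrow> 'a) measure" where
  "riesz_gibbs s V b N =
     density (\<Pi>\<^sub>M j\<in>{1..N}. lborel)
       (\<lambda>x. ennreal (exp_neg (riesz_energy s V b N x)) / riesz_partition s V b N)"

text \<open>The sum of the Dirac masses at \<open>N\<^bsup>1/n\<^esup> (x\<^sub>j - E)\<close>, \<open>1 \<le> j \<le> N\<close>,
  as the image of the counting measure on the indices.\<close>

definition local_process :: "'a::euclidean_space \<Rightarrow> nat \<Rightarrow> (nat \<Rightarrow> 'a) \<Rightarrow> 'a measure" where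
  "local_process E N x =
     distr (count_space {1..N}) borel (\<lambda>j. (real N powr (1 / real DIM('a))) *\<^sub>R (x j - E))"

end

(*
  A mean-field probability measure mu with density proportional to exp (- V - gamma * K * mu) exists:
  the fixed-point map is antitone for the positive definite form of the Riesz kernel K, so a damped
  iteration converges. With respect to mu^N the Gibbs density is a product of the pair factors
  exp (- beta * K (x_i, x_j)) and of exp (gamma * (K * mu)(x_i)), and two facts show that it is
  at most exp (o(N)): K is a superposition of Gaussians, hence positive definite after truncation,
  which bounds the weight from above, and Jensen's inequality bounds the partition function from
  below. Exponential concentration under mu^N therefore survives under the Gibbs measure, and the
  interaction of a tagged point y with the other ones is gamma * (K * mu)(y) + o(1), uniformly in y.
  Integrating out the points one at a time, E prod (1 - h(x_i)) = (1 - integral of h d mu)^N + o(1)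
  when the integral of h is O(1 / N). At scale N^(-1/n) around E this is the Laplace functional of a
  Poisson process whose intensity is the density of mu at E, which is continuous there.
*)

theory Submission
  imports Defs
begin

section \<open>Gibbs measures with an approximable positive definite kernel\<close>

text \<open>The reference measure mu is chosen so that the pair energy has no first-order part
  around it: up to a constant, the exponent is minus beta / 2 times the quadratic form of the
  fluctuation of the point configuration, and positive definiteness gives this form a sign, however
  large gamma is. The obstacle is the singularity of K. Point masses have infinite self-energy, so
  the sign is used for a bounded truncation, whose diagonal costs beta / 2 times its maximum per
  point, and beta tends to 0. Moreover the field at y, the sum of beta * K (y, x_i), is an unbounded
  statistic, out of reach of exponential concentration. It is therefore split: the truncated part
  concentrates, and the remainder is small in L1 because a single point under the Gibbs measure has
  a bounded density with respect to mu. This gives an error without a rate, which is enough: each of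
  the N replacements costs this error times the integral of h, and the latter is O(1 / N). Removing
  a point changes neither coupling, so Gibbs measures are indexed by finite sets, with the field
  strength g and the pair strength b as independent parameters.\<close>

lemma tendsto_zero_if_times_n:
  fixes b :: "nat \<Rightarrow> real"
  assumes "(\<lambda>N. b N * real N) \<longlonglongrightarrow> g"
  shows "b \<longlonglongrightarrow> 0"
proof -
  have "(\<lambda>N. (b N * real N) * inverse (real N)) \<longlonglongrightarrow> g * 0"
    by (intro tendsto_mult assms lim_inverse_n)
  moreover have "\<forall>\<^sub>F N in sequentially. (b N * real N) * inverse (real N) = b N"
    using eventually_gt_at_top[of 0] by eventually_elim auto
  ultimately show ?thesis by (simp add: Lim_transform_eventually)
qed

text \<open>With \<open>m\<close> the mean of \<open>t\<close>, or a bound for it, integrating this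
  inequality gives Jensen's inequality; it yields all lower bounds for partition functions
  below.\<close>

lemma exp_ge_tangent: "exp m * (1 + t - m) \<le> exp (t::real)"
proof -
  have "exp m * (1 + (t - m)) \<le> exp m * exp (t - m)"
    using exp_ge_add_one_self[of "t - m"] by (intro mult_left_mono) auto
  then show ?thesis by (simp only: exp_add[symmetric] add_diff_eq) simp
qed

lemma exp_quadratic_bound: "\<bar>x::real\<bar> \<le> 1 \<Longrightarrow> exp x \<le> 1 + x + x\<^sup>2"
proof (cases "0 \<le> x")
  case False
  assume "\<bar>x\<bar> \<le> 1"
  have "1 - x + x\<^sup>2 / 2 \<le> exp (- x)"
    using exp_lower_Taylor_quadratic[of "- x"] False by simp
  \<comment> \<open>The quadratic on the left bounds \<open>exp (- x)\<close> from below; once its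
    product with the claimed bound is at least 1, taking the reciprocal finishes the case.\<close>
  moreover have "1 \<le> (1 - x + x\<^sup>2 / 2) * (1 + x + x\<^sup>2)"
  proof -
    have "(1 - x + x\<^sup>2 / 2) * (1 + x + x\<^sup>2) = 1 + x\<^sup>2 * (1 - x + x\<^sup>2) / 2"
      by (simp add: field_simps power2_eq_square)
    moreover have "0 \<le> x\<^sup>2 * (1 - x + x\<^sup>2) / 2" using False by (simp add: add_nonneg_nonneg)
    ultimately show ?thesis by simp
  qed
  moreover have "0 \<le> 1 + x + x\<^sup>2" using \<open>\<bar>x\<bar> \<le> 1\<close> by (simp add: abs_le_iff add_nonneg_nonneg)
  ultimately have "1 \<le> exp (- x) * (1 + x + x\<^sup>2)"
    by (meson mult_right_mono order_trans)
  then have "exp x * 1 \<le> exp x * (exp (- x) * (1 + x + x\<^sup>2))" by (intro mult_left_mono) auto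
  also have "\<dots> = 1 + x + x\<^sup>2" by (simp add: mult.assoc[symmetric] exp_minus)
  finally show ?thesis by simp
qed (simp add: exp_bound)

text \<open>Strong monotonicity of the logarithm on a bounded interval. In
  \<open>mf_damped_step\<close> it turns the uniform bound on the densities into control of an
  increment in L2.\<close>

lemma ln_diff_ge:
  fixes a b B :: real
  assumes "0 < a" "a \<le> b" "b \<le> B"
  shows "(b - a)\<^sup>2 / B \<le> (b - a) * (ln b - ln a)"
proof -
  have "ln (a / b) \<le> a / b - 1" using assms by (intro ln_le_minus_one) auto
  then have "(b - a) / b \<le> ln b - ln a" using assms by (simp add: ln_div diff_divide_distrib)
  moreover have "(b - a) / B \<le> (b - a) / b" using assms by (intro divide_left_mono) auto
  ultimately have "(b - a) / B \<le> ln b - ln a" by linarith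
  then have "(b - a) * ((b - a) / B) \<le> (b - a) * (ln b - ln a)"
    using assms by (intro mult_left_mono) auto
  then show ?thesis by (simp add: power2_eq_square)
qed

text \<open>The kernel \<open>K\<close> is singular on the diagonal, where it has the junk value \<open>0\<close>; this is
  harmless because \<open>M\<close> has no atoms, and lets energies be full double sums. The bounded kernels
  \<open>Kt T\<close> are positive definite, diagonal included, and tend to \<open>K\<close> from below.\<close>

locale approx_kernel = prob_space M for M :: "'a::euclidean_space measure" +
  fixes K :: "'a \<Rightarrow> 'a \<Rightarrow> real" and Kt :: "nat \<Rightarrow> 'a \<Rightarrow> 'a \<Rightarrow> real"
    and C :: real and L e :: "nat \<Rightarrow> real"
  assumes sets_M: "sets M = sets borel"
    and K_borel: "(\<lambda>(x, y). K x y) \<in> borel_measurable (borel \<Otimes>\<^sub>M borel)"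
    and Kt_borel: "\<And>T. (\<lambda>(x, y). Kt T x y) \<in> borel_measurable (borel \<Otimes>\<^sub>M borel)"
    and K_nonneg: "\<And>x y. 0 \<le> K x y"
    and K_sym: "\<And>x y. K x y = K y x"
    and K_diag: "\<And>x. K x x = 0"
    and Kt_nonneg: "\<And>T x y. 0 \<le> Kt T x y"
    and Kt_le: "\<And>T x y. Kt T x y \<le> L T"
    and Kt_sym: "\<And>T x y. Kt T x y = Kt T y x"
    and Kt_le_K: "\<And>T x y. x \<noteq> y \<Longrightarrow> Kt T x y \<le> K x y"
    and diffuse: "\<And>x. AE y in M. y \<noteq> x"
    and K_pot: "\<And>x. (\<integral>\<^sup>+y. K x y \<partial>M) \<le> ennreal C"
    and Kt_approx: "\<And>T x. (\<integral>\<^sup>+y. \<bar>K x y - Kt T x y\<bar> \<partial>M) \<le> ennreal (e T)"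
    and e_nonneg: "\<And>T. 0 \<le> e T"
    and e_tendsto: "e \<longlonglongrightarrow> 0"
    and C_nonneg: "0 \<le> C"
    \<comment> \<open>Positive definiteness on the signed measure \<open>R1 - R2\<close>, expanded
      so that only nonnegative integrals of positive measures occur.\<close>
    and psd: "\<And>T R1 R2. finite_measure R1 \<Longrightarrow> finite_measure R2 \<Longrightarrow>
        sets R1 = sets borel \<Longrightarrow> sets R2 = sets borel \<Longrightarrow>
        2 * (\<integral>\<^sup>+x. \<integral>\<^sup>+y. Kt T x y \<partial>R2 \<partial>R1)
          \<le> (\<integral>\<^sup>+x. \<integral>\<^sup>+y. Kt T x y \<partial>R1 \<partial>R1) + (\<integral>\<^sup>+x. \<integral>\<^sup>+y. Kt T x y \<partial>R2 \<partial>R2)"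
begin

section \<open>Potentials and self-energies of \<open>M\<close>\<close>

lemmas [measurable_cong] = sets_M

lemma space_M [simp]: "space M = UNIV"
  using sets_eq_imp_space_eq[OF sets_M] by simp

lemma prob_UNIV [simp]: "prob UNIV = 1" and emeasure_UNIV [simp]: "emeasure M UNIV = 1"
  using prob_space emeasure_space_1 by simp_all

lemma K_measurable [measurable (raw)]:
  "f \<in> borel_measurable N \<Longrightarrow> g \<in> borel_measurable N \<Longrightarrow> (\<lambda>w. K (f w) (g w)) \<in> borel_measurable N"
  using measurable_compose[OF measurable_Pair[of f N borel g borel] K_borel] by simp

lemma Kt_measurable [measurable (raw)]:
  "f \<in> borel_measurable N \<Longrightarrow> g \<in> borel_measurable N \<Longrightarrow> (\<lambda>w. Kt T (f w) (g w)) \<in> borel_measurable N"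
  using measurable_compose[OF measurable_Pair[of f N borel g borel] Kt_borel] by simp

lemma L_nonneg: "0 \<le> L T"
  using Kt_nonneg Kt_le order_trans by blast

lemma K_integrable [simp]: "integrable M (K x)"
proof (rule integrableI_bounded)
  show "(\<integral>\<^sup>+y. ennreal (norm (K x y)) \<partial>M) < \<infinity>"
    using K_pot[of x] by (simp add: K_nonneg le_less_trans[OF _ ennreal_less_top])
qed measurable

lemma Kt_integrable [simp]: "integrable M (Kt T x)"
  by (rule integrable_const_bound[where B="L T"]) (auto simp: Kt_nonneg Kt_le)

definition pot :: "'a \<Rightarrow> real" where "pot x = (\<integral>y. K x y \<partial>M)"
definition pott :: "nat \<Rightarrow> 'a \<Rightarrow> real" where "pott T x = (\<integral>y. Kt T x y \<partial>M)"
definition selfen :: real where "selfen = (\<integral>x. pot x \<partial>M)"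
definition selfent :: "nat \<Rightarrow> real" where "selfent T = (\<integral>x. pott T x \<partial>M)"

lemma pot_measurable [measurable]: "pot \<in> borel_measurable borel"
  unfolding pot_def[abs_def] by measurable

lemma pott_measurable [measurable]: "pott T \<in> borel_measurable borel"
  unfolding pott_def[abs_def] by measurable

lemma pot_nonneg: "0 \<le> pot x"
  by (simp add: pot_def K_nonneg)

lemma pott_nonneg: "0 \<le> pott T x"
  by (simp add: pott_def Kt_nonneg)

lemma nn_integral_K: "(\<integral>\<^sup>+y. K x y \<partial>M) = ennreal (pot x)"
  unfolding pot_def by (rule nn_integral_eq_integral) (auto simp: K_nonneg)

lemma nn_integral_Kt: "(\<integral>\<^sup>+y. Kt T x y \<partial>M) = ennreal (pott T x)"
  unfolding pott_def by (rule nn_integral_eq_integral) (auto simp: Kt_nonneg)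

lemma pot_le: "pot x \<le> C"
  using K_pot[of x] by (simp add: nn_integral_K C_nonneg)

lemma pott_le_pot: "pott T x \<le> pot x"
  unfolding pott_def pot_def
  \<comment> \<open>The comparison of the kernels fails at \<open>y = x\<close>, where
    \<open>K\<close> is 0; this point is a null set.\<close>
  by (rule integral_mono_AE) (use diffuse[of x] in \<open>auto intro!: Kt_le_K elim!: eventually_mono\<close>)

lemma pot_le_pott: "pot x \<le> pott T x + e T"
proof -
  have "ennreal (\<integral>y. \<bar>K x y - Kt T x y\<bar> \<partial>M) \<le> ennreal (e T)"
    using Kt_approx[of x T] by (subst (asm) nn_integral_eq_integral) auto
  then have "(\<integral>y. \<bar>K x y - Kt T x y\<bar> \<partial>M) \<le> e T"
    by (simp add: e_nonneg)
  moreover have "pot x - pott T x \<le> (\<integral>y. \<bar>K x y - Kt T x y\<bar> \<partial>M)"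
    unfolding pot_def pott_def Bochner_Integration.integral_diff[OF K_integrable Kt_integrable, symmetric]
    by (rule integral_mono) auto
  ultimately show ?thesis by simp
qed

lemma pot_integrable [simp]: "integrable M pot"
  by (rule integrable_const_bound[where B=C]) (auto simp: pot_nonneg pot_le)

lemma pott_integrable [simp]: "integrable M (pott T)"
  by (rule integrable_const_bound[where B=C]) (auto simp: pott_nonneg order_trans[OF pott_le_pot pot_le])

lemma selfent_le: "selfent T \<le> selfen"
  unfolding selfent_def selfen_def by (rule integral_mono) (auto simp: pott_le_pot)

lemma selfen_nonneg: "0 \<le> selfen"
  by (simp add: selfen_def pot_nonneg)

lemma selfen_le: "selfen \<le> C"
proof -
  have "selfen \<le> (\<integral>x. C \<partial>M)"
    unfolding selfen_def by (rule integral_mono) (auto simp: pot_le)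
  then show ?thesis by (simp add: prob_space)
qed

lemma selfent_nonneg: "0 \<le> selfent T"
  by (simp add: selfent_def pott_nonneg)

lemma nn_integral_pot: "(\<integral>\<^sup>+x. pot x \<partial>M) = ennreal selfen"
  unfolding selfen_def by (rule nn_integral_eq_integral) (auto simp: pot_nonneg)

lemma nn_integral_pott: "(\<integral>\<^sup>+x. pott T x \<partial>M) = ennreal (selfent T)"
  unfolding selfent_def by (rule nn_integral_eq_integral) (auto simp: pott_nonneg)

text \<open>Positive definiteness applied to the difference of the counting measure of the points and
  \<open>card I\<close> times \<open>M\<close>.\<close>

lemma psd_points:
  assumes "finite I"
  shows "2 * real (card I) * (\<Sum>i\<in>I. pott T (x i))
    \<le> (\<Sum>i\<in>I. \<Sum>j\<in>I. Kt T (x i) (x j)) + (real (card I))\<^sup>2 * selfent T"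
proof -
  define R1 where "R1 = distr (count_space I) borel x"
  define R2 where "R2 = density M (\<lambda>_. ennreal (real (card I)))"
  have [simp]: "sets R1 = sets borel" "sets R2 = sets borel"
    by (simp_all add: R1_def R2_def sets_M)
  note [measurable_cong] = \<open>sets R1 = sets borel\<close> \<open>sets R2 = sets borel\<close>
  have i1: "(\<integral>\<^sup>+z. f z \<partial>R1) = (\<Sum>i\<in>I. f (x i))" if [measurable]: "f \<in> borel_measurable borel" for f :: "'a \<Rightarrow> ennreal"
    unfolding R1_def using assms by (subst nn_integral_distr) (auto simp: nn_integral_count_space_finite)
  have i2: "(\<integral>\<^sup>+z. f z \<partial>R2) = ennreal (real (card I)) * (\<integral>\<^sup>+z. f z \<partial>M)"
    if [measurable]: "f \<in> borel_measurable borel" for f :: "'a \<Rightarrow> ennreal"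
    unfolding R2_def by (subst nn_integral_density) (auto simp: nn_integral_cmult)
  have "emeasure R1 (space R1) < \<infinity>"
    using i1[of "\<lambda>_. 1"] assms by (simp add: of_nat_less_top)
  then have f1: "finite_measure R1" by (auto intro!: finite_measureI)
  have "emeasure R2 (space R2) = ennreal (real (card I)) * (\<integral>\<^sup>+z. 1 \<partial>M)"
    using i2[of "\<lambda>_. 1"] by simp
  then have f2: "finite_measure R2" by (auto intro!: finite_measureI simp: emeasure_space_1)
  have "2 * (\<integral>\<^sup>+x. \<integral>\<^sup>+y. Kt T x y \<partial>R2 \<partial>R1)
          \<le> (\<integral>\<^sup>+x. \<integral>\<^sup>+y. Kt T x y \<partial>R1 \<partial>R1) + (\<integral>\<^sup>+x. \<integral>\<^sup>+y. Kt T x y \<partial>R2 \<partial>R2)"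
    by (rule psd) (use f1 f2 in auto)
  also have "(\<integral>\<^sup>+x. \<integral>\<^sup>+y. Kt T x y \<partial>R2 \<partial>R1) = ennreal (real (card I) * (\<Sum>i\<in>I. pott T (x i)))"
    by (simp add: i1 i2 nn_integral_Kt ennreal_mult[symmetric] pott_nonneg sum_nonneg sum_distrib_left)
  also have "(\<integral>\<^sup>+x. \<integral>\<^sup>+y. Kt T x y \<partial>R1 \<partial>R1) = ennreal (\<Sum>i\<in>I. \<Sum>j\<in>I. Kt T (x i) (x j))"
    by (simp add: i1 Kt_nonneg sum_nonneg)
  also have "(\<integral>\<^sup>+x. \<integral>\<^sup>+y. Kt T x y \<partial>R2 \<partial>R2) = ennreal ((real (card I))\<^sup>2 * selfent T)"
    by (simp add: i2 nn_integral_Kt nn_integral_cmult nn_integral_pott)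
      (simp add: ennreal_mult selfent_nonneg power2_eq_square mult.assoc)
  finally have "ennreal (2 * (real (card I) * (\<Sum>i\<in>I. pott T (x i)))) \<le>
      ennreal ((\<Sum>i\<in>I. \<Sum>j\<in>I. Kt T (x i) (x j)) + (real (card I))\<^sup>2 * selfent T)"
    by (simp add: ennreal_mult ennreal_plus sum_nonneg Kt_nonneg pott_nonneg selfent_nonneg)
  then show ?thesis
    by (subst (asm) ennreal_le_iff) (auto simp: sum_nonneg Kt_nonneg selfent_nonneg)
qed

section \<open>Gibbs weights relative to the product of \<open>M\<close>, and insertion of a
  point\<close>

sublocale PM: product_prob_space "\<lambda>_. M" UNIV
  by unfold_locales

text \<open>The factor \<open>b / 2\<close> compensates that the double sum meets every pair twice.
  The field \<open>g * pot\<close> is the price of taking the mean-field measure \<open>M\<close> as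
  reference in place of \<open>exp (- V)\<close>.\<close>

definition wt :: "real \<Rightarrow> real \<Rightarrow> 'i set \<Rightarrow> ('i \<Rightarrow> 'a) \<Rightarrow> real" where
  "wt g b I x = exp (g * (\<Sum>i\<in>I. pot (x i)) - b / 2 * (\<Sum>i\<in>I. \<Sum>j\<in>I. K (x i) (x j)))"

definition part :: "real \<Rightarrow> real \<Rightarrow> 'i set \<Rightarrow> real" where
  "part g b I = (\<integral>x. wt g b I x \<partial>(PiM I (\<lambda>_. M)))"

definition gibbs :: "real \<Rightarrow> real \<Rightarrow> 'i set \<Rightarrow> ('i \<Rightarrow> 'a) measure" where
  "gibbs g b I = density (PiM I (\<lambda>_. M)) (\<lambda>x. ennreal (wt g b I x / part g b I))"

lemma sets_PiM_borel: "sets (PiM I (\<lambda>_. M)) = sets (PiM I (\<lambda>_. borel))"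
  by (rule sets_PiM_cong) (auto simp: sets_M)

lemma wt_measurable [measurable]: "finite I \<Longrightarrow> wt g b I \<in> borel_measurable (PiM I (\<lambda>_. M))"
  unfolding wt_def[abs_def] by measurable

lemma wt_pos: "0 < wt g b I x"
  by (simp add: wt_def)

lemma wt_le: 
  assumes "0 \<le> g" "0 \<le> b" shows "wt g b I x \<le> exp (g * (real (card I) * C))"
proof -
  have "(\<Sum>i\<in>I. pot (x i)) \<le> real (card I) * C"
    by (rule sum_bounded_above) (simp add: pot_le)
  then have "g * (\<Sum>i\<in>I. pot (x i)) \<le> g * (real (card I) * C)"
    using assms by (rule_tac mult_left_mono) auto
  moreover have "0 \<le> b / 2 * (\<Sum>i\<in>I. \<Sum>j\<in>I. K (x i) (x j))"
    using assms by (auto intro!: mult_nonneg_nonneg sum_nonneg simp: K_nonneg)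
  ultimately show ?thesis by (simp add: wt_def)
qed

lemma prob_space_PiM: "prob_space (PiM I (\<lambda>_. M))"
  by (rule prob_space_PiM) (rule prob_space_axioms)

lemma wt_integrable: "finite I \<Longrightarrow> 0 \<le> g \<Longrightarrow> 0 \<le> b \<Longrightarrow> integrable (PiM I (\<lambda>_. M)) (wt g b I)"
proof -
  assume "finite I" "0 \<le> g" "0 \<le> b"
  interpret P: prob_space "PiM I (\<lambda>_. M)" by (rule prob_space_PiM)
  show ?thesis
    by (rule P.integrable_const_bound[where B="exp (g * (real (card I) * C))"])
      (use \<open>finite I\<close> \<open>0 \<le> g\<close> \<open>0 \<le> b\<close> in \<open>auto simp: wt_le wt_pos less_imp_le\<close>)
qed

lemma part_pos: assumes "finite I" "0 \<le> g" "0 \<le> b" shows "0 < part g b I"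
proof -
  interpret P: prob_space "PiM I (\<lambda>_. M)" by (rule prob_space_PiM)
  have "0 \<le> part g b I"
    unfolding part_def by (simp add: wt_pos less_imp_le)
  moreover have "part g b I \<noteq> 0"
  proof
    assume "part g b I = 0"
    then have "AE x in PiM I (\<lambda>_. M). wt g b I x = 0"
      unfolding part_def using assms
      by (subst (asm) integral_nonneg_eq_0_iff_AE) (auto simp: wt_integrable wt_pos less_imp_le)
    then have "AE x in PiM I (\<lambda>_. M). False"
      by (rule eventually_mono) (metis less_irrefl wt_pos)
    then show False by simp
  qed
  ultimately show ?thesis by simp
qed

lemma nn_integral_wt: "finite I \<Longrightarrow> 0 \<le> g \<Longrightarrow> 0 \<le> b \<Longrightarrow> (\<integral>\<^sup>+x. wt g b I x \<partial>(PiM I (\<lambda>_. M))) = ennreal (part g b I)"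
  unfolding part_def by (rule nn_integral_eq_integral) (auto simp: wt_integrable wt_pos less_imp_le)

lemma sets_gibbs: "sets (gibbs g b I) = sets (PiM I (\<lambda>_. M))"
  by (simp add: gibbs_def)

lemmas [measurable_cong] = sets_gibbs

lemma nn_integral_gibbs:
  fixes f :: "('i \<Rightarrow> 'a) \<Rightarrow> ennreal"
  assumes [measurable]: "finite I" "f \<in> borel_measurable (PiM I (\<lambda>_. M))"
    and gb: "0 \<le> g" "0 \<le> b"
  shows "(\<integral>\<^sup>+x. f x \<partial>gibbs g b I) = (\<integral>\<^sup>+x. wt g b I x * f x \<partial>(PiM I (\<lambda>_. M))) / ennreal (part g b I)"
proof -
  have "(\<integral>\<^sup>+x. f x \<partial>gibbs g b I) = (\<integral>\<^sup>+x. ennreal (wt g b I x / part g b I) * f x \<partial>(PiM I (\<lambda>_. M)))"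
    unfolding gibbs_def by (rule nn_integral_density) measurable
  also have "\<dots> = (\<integral>\<^sup>+x. (wt g b I x * f x) / ennreal (part g b I) \<partial>(PiM I (\<lambda>_. M)))"
    using part_pos[OF assms(1) gb]
    by (intro nn_integral_cong)
      (simp add: divide_ennreal[symmetric] wt_pos less_imp_le divide_ennreal_def mult_ac)
  also have "\<dots> = (\<integral>\<^sup>+x. wt g b I x * f x \<partial>(PiM I (\<lambda>_. M))) / ennreal (part g b I)"
    by (rule nn_integral_divide) measurable
  finally show ?thesis .
qed

lemma prob_space_gibbs:
  assumes "finite I" "0 \<le> g" "0 \<le> b" shows "prob_space (gibbs g b I)"
proof
  have "emeasure (gibbs g b I) (space (gibbs g b I)) = (\<integral>\<^sup>+x. 1 \<partial>gibbs g b I)"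
    by simp
  also have "\<dots> = 1"
    using assms part_pos[OF assms] by (subst nn_integral_gibbs) (auto simp: nn_integral_wt divide_ennreal)
  finally show "emeasure (gibbs g b I) (space (gibbs g b I)) = 1" .
qed

lemma energy_insert:
  assumes "finite I" "k \<notin> I"
  shows "(\<Sum>i\<in>insert k I. \<Sum>j\<in>insert k I. K ((x(k := y)) i) ((x(k := y)) j)) =
     (\<Sum>i\<in>I. \<Sum>j\<in>I. K (x i) (x j)) + 2 * (\<Sum>i\<in>I. K y (x i))"
proof -
  define z where "z = x(k := y)"
  have zk: "z k = y" and zI: "\<And>i. i \<in> I \<Longrightarrow> z i = x i"
    using assms by (auto simp: z_def)
  have s2: "(\<Sum>i\<in>I. \<Sum>j\<in>I. K (z i) (z j)) = (\<Sum>i\<in>I. \<Sum>j\<in>I. K (x i) (x j))"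
    by (intro sum.cong) (auto simp: zI)
  have s1: "(\<Sum>i\<in>I. K (z i) y) = (\<Sum>i\<in>I. K y (x i))" "(\<Sum>i\<in>I. K y (z i)) = (\<Sum>i\<in>I. K y (x i))"
    by (intro sum.cong; simp add: zI K_sym[of _ y])+
  have "(\<Sum>i\<in>insert k I. \<Sum>j\<in>insert k I. K (z i) (z j)) =
      (\<Sum>i\<in>I. \<Sum>j\<in>I. K (x i) (x j)) + 2 * (\<Sum>i\<in>I. K y (x i))"
    using assms by (simp add: sum.distrib zk K_diag s1 s2)
  then show ?thesis by (simp add: z_def)
qed

lemma wt_insert:
  assumes "finite I" "k \<notin> I"
  shows "wt g b (insert k I) (x(k := y)) =
    wt g b I x * (exp (g * pot y) * exp (- b * (\<Sum>i\<in>I. K y (x i))))"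
proof -
  have "(\<Sum>i\<in>I. pot ((x(k := y)) i)) = (\<Sum>i\<in>I. pot (x i))"
    using assms by (intro sum.cong) auto
  then have "(\<Sum>i\<in>insert k I. pot ((x(k := y)) i)) = pot y + (\<Sum>i\<in>I. pot (x i))"
    using assms by (simp del: fun_upd_apply) simp
  then show ?thesis
    unfolding wt_def energy_insert[OF assms] by (simp add: exp_add[symmetric] algebra_simps)
qed

text \<open>The new point is integrated last: given its position \<open>y\<close>, the other points
  carry the Gibbs measure with the same \<open>g\<close> and \<open>b\<close>, tilted by their
  interaction with \<open>y\<close>. Every estimate on a tagged point starts from this
  formula.\<close>

lemma gibbs_insert:
  fixes F :: "('i \<Rightarrow> 'a) \<Rightarrow> ennreal"
  assumes I [measurable]: "finite I" "k \<notin> I" and F [measurable]: "F \<in> borel_measurable (PiM (insert k I) (\<lambda>_. M))"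
    and gb: "0 \<le> g" "0 \<le> b"
  shows "(\<integral>\<^sup>+x. F x \<partial>gibbs g b (insert k I)) = ennreal (part g b I / part g b (insert k I)) *
    (\<integral>\<^sup>+y. exp (g * pot y) * (\<integral>\<^sup>+x. F (x(k := y)) * exp (- b * (\<Sum>i\<in>I. K y (x i))) \<partial>gibbs g b I) \<partial>M)"
proof -
  let ?P = "PiM I (\<lambda>_. M)"
  let ?c = "ennreal (part g b I)" and ?d = "ennreal (part g b (insert k I))"
  have p: "0 < part g b I" "0 < part g b (insert k I)" using I gb by (auto intro!: part_pos)
  interpret P: prob_space ?P by (rule prob_space_PiM)
  have [measurable]: "(\<lambda>(y, x). F (x(k := y))) \<in> borel_measurable (M \<Otimes>\<^sub>M ?P)"
    using F I by measurable
  have [measurable]: "(\<lambda>x. F (x(k := y))) \<in> borel_measurable ?P" for y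
    by measurable
  have "(\<integral>\<^sup>+x. F x \<partial>gibbs g b (insert k I)) =
     (\<integral>\<^sup>+x. wt g b (insert k I) x * F x \<partial>(PiM (insert k I) (\<lambda>_. M))) / ?d"
    using I gb by (intro nn_integral_gibbs) auto
  also have "(\<integral>\<^sup>+x. wt g b (insert k I) x * F x \<partial>(PiM (insert k I) (\<lambda>_. M))) =
    (\<integral>\<^sup>+y. \<integral>\<^sup>+x. wt g b (insert k I) (x(k := y)) * F (x(k := y)) \<partial>?P \<partial>M)"
    using I by (intro PM.product_nn_integral_insert_rev) auto
  also have "\<dots> = (\<integral>\<^sup>+y. ?c * (exp (g * pot y) * (\<integral>\<^sup>+x. F (x(k := y)) * exp (- b * (\<Sum>i\<in>I. K y (x i))) \<partial>gibbs g b I)) \<partial>M)"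
  proof (intro nn_integral_cong)
    fix y
    have "(\<integral>\<^sup>+x. wt g b (insert k I) (x(k := y)) * F (x(k := y)) \<partial>?P) =
      (\<integral>\<^sup>+x. exp (g * pot y) * (wt g b I x * (F (x(k := y)) * exp (- b * (\<Sum>i\<in>I. K y (x i))))) \<partial>?P)"
      using I by (intro nn_integral_cong) (simp del: fun_upd_apply add: wt_insert ennreal_mult' wt_pos less_imp_le mult_ac)
    also have "\<dots> = exp (g * pot y) * (\<integral>\<^sup>+x. wt g b I x * (F (x(k := y)) * exp (- b * (\<Sum>i\<in>I. K y (x i)))) \<partial>?P)"
      by (rule nn_integral_cmult) measurable
    also have "(\<integral>\<^sup>+x. wt g b I x * (F (x(k := y)) * exp (- b * (\<Sum>i\<in>I. K y (x i)))) \<partial>?P) = 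
        ?c * (\<integral>\<^sup>+x. F (x(k := y)) * exp (- b * (\<Sum>i\<in>I. K y (x i))) \<partial>gibbs g b I)"
      using I gb p by (subst nn_integral_gibbs)
        (auto simp: ennreal_times_divide mult.commute[of "ennreal (part g b I)"] ennreal_mult_divide_eq)
    finally show "(\<integral>\<^sup>+x. wt g b (insert k I) (x(k := y)) * F (x(k := y)) \<partial>?P) = 
      ?c * (exp (g * pot y) * (\<integral>\<^sup>+x. F (x(k := y)) * exp (- b * (\<Sum>i\<in>I. K y (x i))) \<partial>gibbs g b I))"
      by (simp add: mult_ac del: fun_upd_apply)
  qed
  also have "\<dots> = ?c * (\<integral>\<^sup>+y. exp (g * pot y) * (\<integral>\<^sup>+x. F (x(k := y)) * exp (- b * (\<Sum>i\<in>I. K y (x i))) \<partial>gibbs g b I) \<partial>M)"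
  proof (rule nn_integral_cmult)
    interpret G: prob_space "gibbs g b I" by (rule prob_space_gibbs) (use I gb in auto)
    show "(\<lambda>y. exp (g * pot y) * (\<integral>\<^sup>+x. F (x(k := y)) * exp (- b * (\<Sum>i\<in>I. K y (x i))) \<partial>gibbs g b I)) \<in> borel_measurable M"
      by measurable
  qed
  finally show ?thesis using p
    by (simp add: divide_ennreal[symmetric] less_imp_le divide_ennreal_def mult_ac)
qed


section \<open>Distinct points, mean energy and the lower bound for the partition function\<close>

lemma AE_distinct_pair:
  assumes "finite I" "i \<in> I" "j \<in> I" "i \<noteq> j"
  shows "AE x in PiM I (\<lambda>_. M). x i \<noteq> x j"
proof -
  let ?J = "I - {j}"
  have I: "I = insert j ?J" "finite ?J" "j \<notin> ?J" "i \<in> ?J" using assms by auto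
  let ?A = "{x \<in> space (PiM I (\<lambda>_. M)). x i = x j}"
  have [measurable]: "(\<lambda>x. x i) \<in> borel_measurable (PiM I (\<lambda>_. M))" "(\<lambda>x. x j) \<in> borel_measurable (PiM I (\<lambda>_. M))"
    using measurable_component_singleton[of i I "\<lambda>_. M"] measurable_component_singleton[of j I "\<lambda>_. M"] assms
    by (simp_all add: measurable_cong_sets[OF refl sets_M])
  have A [measurable]: "?A \<in> sets (PiM I (\<lambda>_. M))"
    by measurable
  have "emeasure (PiM I (\<lambda>_. M)) ?A = (\<integral>\<^sup>+x. indicator ?A x \<partial>(PiM (insert j ?J) (\<lambda>_. M)))"
    using I(1) A by (subst nn_integral_indicator) auto
  also have "\<dots> = (\<integral>\<^sup>+x. \<integral>\<^sup>+y. indicator ?A (x(j := y)) \<partial>M \<partial>(PiM ?J (\<lambda>_. M)))"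
    using I A by (intro PM.product_nn_integral_insert) (auto simp flip: I(1))
  also have "\<dots> = (\<integral>\<^sup>+x. 0 \<partial>(PiM ?J (\<lambda>_. M)))"
  proof (intro nn_integral_cong)
    fix x
    have "(\<integral>\<^sup>+y. indicator ?A (x(j := y)) \<partial>M) = (\<integral>\<^sup>+y. 0 \<partial>M)"
      by (intro nn_integral_cong_AE) (use diffuse[of "x i"] assms in \<open>auto elim!: eventually_mono simp: indicator_def\<close>)
    then show "(\<integral>\<^sup>+y. indicator ?A (x(j := y)) \<partial>M) = 0" by simp
  qed
  finally have "emeasure (PiM I (\<lambda>_. M)) ?A = 0" by simp
  then show ?thesis
    using A by (intro AE_I[of _ _ ?A]) auto
qed

text \<open>Coinciding points are the only place where \<open>K\<close> has a junk value and where
  it is not above its truncations, so pointwise bounds on the weight are claimed for injective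
  \<open>x\<close> only.\<close>

lemma AE_distinct:
  assumes "finite I"
  shows "AE x in PiM I (\<lambda>_. M). inj_on x I"
proof -
  have "AE x in PiM I (\<lambda>_. M). \<forall>i\<in>I. \<forall>j\<in>I. i \<noteq> j \<longrightarrow> x i \<noteq> x j"
    using assms AE_distinct_pair[OF assms] by (intro AE_finite_allI) (auto intro!: AE_impI)
  then show ?thesis by (rule eventually_mono) (auto simp: inj_on_def)
qed

lemma nn_integral_sum_components:
  fixes f :: "'a \<Rightarrow> ennreal"
  assumes "finite I" and [measurable]: "f \<in> borel_measurable borel"
  shows "(\<integral>\<^sup>+x. (\<Sum>i\<in>I. f (x i)) \<partial>(PiM I (\<lambda>_. M))) = of_nat (card I) * (\<integral>\<^sup>+y. f y \<partial>M)"
  using assms(1)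
proof induction
  case (insert k I)
  note [simp] = insert(1)
  interpret P: prob_space "PiM I (\<lambda>_. M)" by (rule prob_space_PiM)
  have s: "(\<Sum>i\<in>I. f ((x(k := y)) i)) = (\<Sum>i\<in>I. f (x i))" for x y
    using insert by (intro sum.cong) auto
  have "(\<integral>\<^sup>+x. (\<Sum>i\<in>insert k I. f (x i)) \<partial>(PiM (insert k I) (\<lambda>_. M))) =
      (\<integral>\<^sup>+x. \<integral>\<^sup>+y. (\<Sum>i\<in>insert k I. f ((x(k := y)) i)) \<partial>M \<partial>(PiM I (\<lambda>_. M)))"
    using insert by (intro PM.product_nn_integral_insert) auto
  also have "\<dots> = (\<integral>\<^sup>+x. \<integral>\<^sup>+y. f y + (\<Sum>i\<in>I. f (x i)) \<partial>M \<partial>(PiM I (\<lambda>_. M)))"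
    using insert by (simp del: fun_upd_apply add: s) simp
  also have "\<dots> = (\<integral>\<^sup>+x. (\<integral>\<^sup>+y. f y \<partial>M) + (\<Sum>i\<in>I. f (x i)) \<partial>(PiM I (\<lambda>_. M)))"
    by (simp add: nn_integral_add)
  also have "\<dots> = (\<integral>\<^sup>+y. f y \<partial>M) + of_nat (card I) * (\<integral>\<^sup>+y. f y \<partial>M)"
    by (subst nn_integral_add) (auto simp: insert P.emeasure_space_1)
  finally show ?case using insert by (simp add: algebra_simps)
qed simp

text \<open>Since \<open>K\<close> vanishes on the diagonal, the integral has a factor
  \<open>card I * (card I - 1)\<close>. The square is coarser, but it matches the constant of
  \<open>psd_points\<close>, so that the two cancel in \<open>density_le\<close>.\<close>

lemma nn_integral_energy:
  assumes "finite I"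
  shows "(\<integral>\<^sup>+x. (\<Sum>i\<in>I. \<Sum>j\<in>I. K (x i) (x j)) \<partial>(PiM I (\<lambda>_. M))) \<le> ennreal ((real (card I))\<^sup>2 * selfen)"
  using assms
proof induction
  case (insert k I)
  note [simp] = insert(1)
  interpret P: prob_space "PiM I (\<lambda>_. M)" by (rule prob_space_PiM)
  have "(\<integral>\<^sup>+x. (\<Sum>i\<in>insert k I. \<Sum>j\<in>insert k I. K (x i) (x j)) \<partial>(PiM (insert k I) (\<lambda>_. M))) =
      (\<integral>\<^sup>+x. \<integral>\<^sup>+y. (\<Sum>i\<in>insert k I. \<Sum>j\<in>insert k I. K ((x(k := y)) i) ((x(k := y)) j)) \<partial>M \<partial>(PiM I (\<lambda>_. M)))"
    using insert by (intro PM.product_nn_integral_insert) auto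
  also have "\<dots> = (\<integral>\<^sup>+x. \<integral>\<^sup>+y. ennreal (\<Sum>i\<in>I. \<Sum>j\<in>I. K (x i) (x j)) + 2 * (\<Sum>i\<in>I. ennreal (K (x i) y)) \<partial>M \<partial>(PiM I (\<lambda>_. M)))"
    by (intro nn_integral_cong, subst energy_insert[OF insert(1,2)])
      (simp add: ennreal_plus ennreal_mult sum_nonneg K_nonneg K_sym[of _ "_::'a"])
  also have "\<dots> = (\<integral>\<^sup>+x. ennreal (\<Sum>i\<in>I. \<Sum>j\<in>I. K (x i) (x j)) + 2 * (\<Sum>i\<in>I. ennreal (pot (x i))) \<partial>(PiM I (\<lambda>_. M)))"
    by (intro nn_integral_cong) (subst nn_integral_add; simp add: nn_integral_cmult nn_integral_sum nn_integral_K del: sum_ennreal)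
  also have "\<dots> = (\<integral>\<^sup>+x. ennreal (\<Sum>i\<in>I. \<Sum>j\<in>I. K (x i) (x j)) \<partial>(PiM I (\<lambda>_. M))) +
       2 * (of_nat (card I) * ennreal selfen)"
    by (subst nn_integral_add;
        simp add: nn_integral_cmult nn_integral_sum_components[where f="\<lambda>y. ennreal (pot y)"] nn_integral_pot del: sum_ennreal)
  also have "\<dots> \<le> ennreal ((real (card I))\<^sup>2 * selfen) + 2 * (of_nat (card I) * ennreal selfen)"
    by (intro add_mono insert.IH order_refl)
  also have "\<dots> = ennreal ((real (card I))\<^sup>2 * selfen + 2 * (real (card I) * selfen))"
    by (simp add: ennreal_plus ennreal_mult selfen_nonneg ennreal_of_nat_eq_real_of_nat)
  also have "\<dots> \<le> ennreal ((real (card (insert k I)))\<^sup>2 * selfen)"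
    using insert selfen_nonneg by (intro ennreal_leI) (simp add: power2_eq_square algebra_simps)
  finally show ?case .
qed simp

text \<open>Jensen's inequality, through the tangent of \<open>exp\<close> at the mean.\<close>

lemma part_ge:
  assumes "finite I" "0 \<le> g" "0 \<le> b"
  shows "exp (g * real (card I) * selfen - b / 2 * (real (card I))\<^sup>2 * selfen) \<le> part g b I"
proof -
  let ?P = "PiM I (\<lambda>_. M)"
  let ?S = "\<lambda>x. \<Sum>i\<in>I. pot (x i)" and ?H = "\<lambda>x. \<Sum>i\<in>I. \<Sum>j\<in>I. K (x i) (x j)"
  interpret P: prob_space ?P by (rule prob_space_PiM)
  note [simp] = assms(1)
  define m where "m = g * real (card I) * selfen - b / 2 * (real (card I))\<^sup>2 * selfen"
  have S0: "0 \<le> ?S x" "0 \<le> ?H x" for x by (auto intro!: sum_nonneg simp: pot_nonneg K_nonneg)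
  have nS: "(\<integral>\<^sup>+x. ennreal (?S x) \<partial>?P) = ennreal (real (card I) * selfen)"
    using nn_integral_sum_components[of I "\<lambda>y. ennreal (pot y)"]
    by (simp add: pot_nonneg nn_integral_pot ennreal_mult selfen_nonneg ennreal_of_nat_eq_real_of_nat)
  have iS: "integrable ?P ?S" by (rule integrableI_bounded) (auto simp: S0 nS)
  have eS: "(\<integral>x. ?S x \<partial>?P) = real (card I) * selfen"
    by (rule integral_eq_nn_integral[THEN trans]) (auto simp: S0 nS selfen_nonneg)
  have nH: "(\<integral>\<^sup>+x. ennreal (?H x) \<partial>?P) \<le> ennreal ((real (card I))\<^sup>2 * selfen)"
    by (rule nn_integral_energy) simp
  have iH: "integrable ?P ?H"
    by (rule integrableI_bounded) (use nH in \<open>auto simp: S0 intro: le_less_trans\<close>)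
  have eH: "(\<integral>x. ?H x \<partial>?P) \<le> (real (card I))\<^sup>2 * selfen"
    using nH by (subst (asm) nn_integral_eq_integral) (auto simp: S0 iH selfen_nonneg)
  have "exp m * (1 + (g * (\<integral>x. ?S x \<partial>?P) - b / 2 * (\<integral>x. ?H x \<partial>?P)) - m) =
     (\<integral>x. exp m * (1 + (g * ?S x - b / 2 * ?H x) - m) \<partial>?P)"
    using iS iH by (simp add: P.prob_space algebra_simps del: Bochner_Integration.integral_sum)
  also have "\<dots> \<le> part g b I"
    unfolding part_def
  proof (rule integral_mono)
    show "integrable ?P (wt g b I)" using assms by (rule wt_integrable)
    show "exp m * (1 + (g * ?S x - b / 2 * ?H x) - m) \<le> wt g b I x" for x
      unfolding wt_def by (rule exp_ge_tangent)
  qed (use iS iH in auto)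
  finally have *: "exp m * (1 + (g * (\<integral>x. ?S x \<partial>?P) - b / 2 * (\<integral>x. ?H x \<partial>?P)) - m) \<le> part g b I" .
  have "b / 2 * (\<integral>x. ?H x \<partial>?P) \<le> b / 2 * ((real (card I))\<^sup>2 * selfen)"
    using eH assms by (intro mult_left_mono) auto
  then have "1 \<le> 1 + (g * (\<integral>x. ?S x \<partial>?P) - b / 2 * (\<integral>x. ?H x \<partial>?P)) - m"
    unfolding m_def eS by (simp add: algebra_simps)
  then have "exp m * 1 \<le> exp m * (1 + (g * (\<integral>x. ?S x \<partial>?P) - b / 2 * (\<integral>x. ?H x \<partial>?P)) - m)"
    by (intro mult_left_mono) auto
  with * have "exp m \<le> part g b I" by linarith
  then show ?thesis unfolding m_def .
qed

section \<open>Density bound and exponential concentration\<close>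

definition excess :: "real \<Rightarrow> real \<Rightarrow> nat \<Rightarrow> nat \<Rightarrow> real" where
  "excess g b n T = 2 * \<bar>g - b * real n\<bar> * C + b * real n * e T + b / 2 * L T"

lemma excess_nonneg: "0 \<le> b \<Longrightarrow> 0 \<le> excess g b n T"
  by (simp add: excess_def C_nonneg e_nonneg L_nonneg)

text \<open>For \<open>g = b * card I\<close> the exponent differs by a constant from
  \<open>- b / 2\<close> times the form of the fluctuation. \<open>psd_points\<close> gives the sign
  of this form for \<open>Kt T\<close>, and \<open>part_ge\<close> supplies the same constant for
  the partition function. The three terms of \<open>excess\<close> are the mismatch between
  \<open>g\<close> and \<open>b * card I\<close>, the truncation error of the potential, and the
  diagonal of the truncated kernel.\<close>

lemma density_le:
  assumes "finite I" "0 \<le> g" "0 \<le> b" "inj_on x I"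
  shows "wt g b I x \<le> exp (real (card I) * excess g b (card I) T) * part g b I"
proof -
  let ?n = "real (card I)"
  let ?S = "\<Sum>i\<in>I. pot (x i)" and ?H = "\<Sum>i\<in>I. \<Sum>j\<in>I. K (x i) (x j)"
    and ?St = "\<Sum>i\<in>I. pott T (x i)" and ?Ht = "\<Sum>i\<in>I. \<Sum>j\<in>I. Kt T (x i) (x j)"
  have "?Ht = (\<Sum>i\<in>I. Kt T (x i) (x i) + (\<Sum>j\<in>I - {i}. Kt T (x i) (x j)))"
    using assms(1) by (intro sum.cong refl sum.remove) auto
  also have "\<dots> \<le> (\<Sum>i\<in>I. L T + (\<Sum>j\<in>I - {i}. K (x i) (x j)))"
    using assms(4) by (intro sum_mono add_mono Kt_le Kt_le_K) (auto dest: inj_onD)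
  also have "\<dots> = ?n * L T + (\<Sum>i\<in>I. K (x i) (x i) + (\<Sum>j\<in>I - {i}. K (x i) (x j)))"
    by (simp add: sum.distrib K_diag)
  also have "(\<Sum>i\<in>I. K (x i) (x i) + (\<Sum>j\<in>I - {i}. K (x i) (x j))) = ?H"
    using assms(1) by (intro sum.cong refl sum.remove[symmetric]) auto
  finally have 1: "2 * ?n * ?St \<le> ?n * L T + ?H + ?n\<^sup>2 * selfen"
    using psd_points[OF assms(1), of T x] mult_left_mono[OF selfent_le[of T], of "?n\<^sup>2"] by simp
  have 2: "?S \<le> ?St + ?n * e T"
  proof -
    have "?S \<le> (\<Sum>i\<in>I. pott T (x i) + e T)" by (intro sum_mono pot_le_pott)
    then show ?thesis by (simp add: sum.distrib)
  qed
  have S: "0 \<le> ?S" "?S \<le> ?n * C" 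
    by (auto intro!: sum_nonneg sum_bounded_above simp: pot_nonneg pot_le)
  \<comment> \<open>\<open>g\<close> is replaced by \<open>b * ?n\<close> twice, here in the linear
    term and below in the constant; hence the factor 2 in \<open>excess\<close>.\<close>
  have "(g - b * ?n) * ?S \<le> \<bar>g - b * ?n\<bar> * (?n * C)"
    using S by (intro mult_mono) auto
  moreover have "(b * ?n) * ?S \<le> (b * ?n) * (?St + ?n * e T)"
    using assms by (intro mult_left_mono 2) auto
  moreover have "b / 2 * (2 * ?n * ?St) \<le> b / 2 * (?n * L T + ?H + ?n\<^sup>2 * selfen)"
    using assms by (intro mult_left_mono 1) auto
  moreover have "(b * ?n - g) * (?n * selfen) \<le> \<bar>g - b * ?n\<bar> * (?n * C)"
    using selfen_nonneg selfen_le by (intro mult_mono) (auto intro!: mult_left_mono)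
  ultimately have "g * ?S - b / 2 * ?H \<le> ?n * excess g b (card I) T +
      (g * ?n * selfen - b / 2 * ?n\<^sup>2 * selfen)"
    unfolding excess_def by (simp add: algebra_simps power2_eq_square)
  then have "wt g b I x \<le> exp (?n * excess g b (card I) T) * exp (g * ?n * selfen - b / 2 * ?n\<^sup>2 * selfen)"
    unfolding wt_def exp_add[symmetric] by simp
  also have "\<dots> \<le> exp (?n * excess g b (card I) T) * part g b I"
    using part_ge[OF assms(1-3)] by (intro mult_left_mono) auto
  finally show ?thesis .
qed

lemma nn_integral_gibbs_le:
  fixes f :: "('i \<Rightarrow> 'a) \<Rightarrow> ennreal"
  assumes I: "finite I" and f [measurable]: "f \<in> borel_measurable (PiM I (\<lambda>_. M))"
    and gb: "0 \<le> g" "0 \<le> b"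
  shows "(\<integral>\<^sup>+x. f x \<partial>gibbs g b I) \<le>
    ennreal (exp (real (card I) * excess g b (card I) T)) * (\<integral>\<^sup>+x. f x \<partial>(PiM I (\<lambda>_. M)))"
proof -
  have p: "0 < part g b I" using I gb by (rule part_pos)
  have "(\<integral>\<^sup>+x. f x \<partial>gibbs g b I) = (\<integral>\<^sup>+x. ennreal (wt g b I x / part g b I) * f x \<partial>(PiM I (\<lambda>_. M)))"
    unfolding gibbs_def using I by (intro nn_integral_density) measurable
  also have "\<dots> \<le> (\<integral>\<^sup>+x. ennreal (exp (real (card I) * excess g b (card I) T)) * f x \<partial>(PiM I (\<lambda>_. M)))"
  proof (rule nn_integral_mono_AE)
    show "AE x in PiM I (\<lambda>_. M). ennreal (wt g b I x / part g b I) * f x \<le>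
        ennreal (exp (real (card I) * excess g b (card I) T)) * f x"
      using AE_distinct[OF I] 
      by (rule eventually_mono)
        (use p density_le[OF I gb] in \<open>auto intro!: mult_right_mono ennreal_leI simp: divide_le_eq\<close>)
  qed
  also have "\<dots> = ennreal (exp (real (card I) * excess g b (card I) T)) * (\<integral>\<^sup>+x. f x \<partial>(PiM I (\<lambda>_. M)))"
    by (rule nn_integral_cmult) measurable
  finally show ?thesis .
qed

text \<open>The linear term of \<open>exp_quadratic_bound\<close> integrates to 0, so that each
  independent factor is \<open>1 + O(t^2)\<close>. A rate that is quadratic in \<open>t\<close> can
  be made small even after division by \<open>t\<close>.\<close>

lemma mgf_bound:
  assumes [measurable]: "f \<in> borel_measurable borel" and f: "\<And>y. \<bar>f y\<bar> \<le> B" "(\<integral>y. f y \<partial>M) = 0"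
    and t: "0 \<le> t" "t * B \<le> 1" and I: "finite I"
  shows "(\<integral>\<^sup>+x. ennreal (exp (t * (\<Sum>i\<in>I. f (x i)))) \<partial>(PiM I (\<lambda>_. M))) \<le> ennreal (exp (real (card I) * (t * B)\<^sup>2))"
proof -
  have b: "\<bar>t * f y\<bar> \<le> t * B" for y
    using f(1)[of y] t by (simp add: abs_mult mult_left_mono)
  have i: "integrable M f" by (rule integrable_const_bound[where B=B]) (auto simp: f)
  have "(\<integral>\<^sup>+y. ennreal (exp (t * f y)) \<partial>M) \<le> (\<integral>\<^sup>+y. ennreal (1 + t * f y + (t * B)\<^sup>2) \<partial>M)"
  proof (intro nn_integral_mono ennreal_leI)
    fix y
    have "(t * f y)\<^sup>2 \<le> (t * B)\<^sup>2" using power_mono[OF b abs_ge_zero, of y 2] by simp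
    then show "exp (t * f y) \<le> 1 + t * f y + (t * B)\<^sup>2"
      using exp_quadratic_bound[of "t * f y"] b[of y] t by linarith
  qed
  also have "\<dots> = ennreal (\<integral>y. 1 + t * f y + (t * B)\<^sup>2 \<partial>M)"
  proof (rule nn_integral_eq_integral)
    show "AE y in M. 0 \<le> 1 + t * f y + (t * B)\<^sup>2"
    proof (rule AE_I2)
      fix y have "0 \<le> (t * B)\<^sup>2" by simp
      then show "0 \<le> 1 + t * f y + (t * B)\<^sup>2" using b[of y] t by linarith
    qed
  qed (use i in auto)
  also have "(\<integral>y. 1 + t * f y + (t * B)\<^sup>2 \<partial>M) = 1 + (t * B)\<^sup>2"
    using i f by simp
  also have "\<dots> \<le> exp ((t * B)\<^sup>2)" by (rule exp_ge_add_one_self)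
  finally have *: "(\<integral>\<^sup>+y. ennreal (exp (t * f y)) \<partial>M) \<le> ennreal (exp ((t * B)\<^sup>2))"
    by (simp add: ennreal_leI)
  have "(\<integral>\<^sup>+x. ennreal (exp (t * (\<Sum>i\<in>I. f (x i)))) \<partial>(PiM I (\<lambda>_. M))) =
    (\<integral>\<^sup>+x. (\<Prod>i\<in>I. ennreal (exp (t * f (x i)))) \<partial>(PiM I (\<lambda>_. M)))"
    using I by (simp add: sum_distrib_left exp_sum prod_ennreal)
  also have "\<dots> = (\<Prod>i\<in>I. \<integral>\<^sup>+y. ennreal (exp (t * f y)) \<partial>M)"
    using I by (intro PM.product_nn_integral_prod) auto
  also have "\<dots> \<le> (\<Prod>i\<in>I. ennreal (exp ((t * B)\<^sup>2)))"
    using * by (intro prod_mono_ennreal) auto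
  also have "\<dots> = ennreal (exp (real (card I) * (t * B)\<^sup>2))"
    by (simp add: ennreal_power exp_of_nat_mult)
  finally show ?thesis .
qed

text \<open>The Gibbs density is exponential in \<open>card I\<close> with a small rate, so it is dominated by the
  exponential moments of the fluctuation: \<open>z \<le> A + exp (z - A)\<close> with \<open>A\<close> the logarithm of the
  bound.\<close>

lemma gibbs_fluctuation:
  assumes [measurable]: "f \<in> borel_measurable borel" and f: "\<And>y. \<bar>f y\<bar> \<le> B" "(\<integral>y. f y \<partial>M) = 0"
    and t: "0 < t" "t * B \<le> 1" and I: "finite I" and gb: "0 \<le> g" "0 \<le> b"
  shows "(\<integral>\<^sup>+x. ennreal \<bar>\<Sum>i\<in>I. f (x i)\<bar> \<partial>gibbs g b I) \<le>
    ennreal ((real (card I) * (excess g b (card I) T + (t * B)\<^sup>2) + 2) / t)"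
proof -
  let ?P = "PiM I (\<lambda>_. M)" and ?n = "real (card I)"
  let ?X = "\<lambda>x. \<Sum>i\<in>I. f (x i)"
  interpret G: prob_space "gibbs g b I" by (rule prob_space_gibbs) (use I gb in auto)
  \<comment> \<open>Both exponential moments are at most \<open>exp A\<close>; multiplied by
    \<open>exp (- A)\<close> each of them contributes 1, which gives the \<open>+ 2\<close> of the
    statement.\<close>
  define A where "A = ?n * (excess g b (card I) T + (t * B)\<^sup>2)"
  have A0: "0 \<le> A" using gb by (auto simp: A_def excess_nonneg)
  note [simp] = I
  have "t * \<bar>?X x\<bar> \<le> A + exp (- A) * (exp (t * ?X x) + exp (t * (\<Sum>i\<in>I. - f (x i))))" for x
  proof -
    have "t * \<bar>?X x\<bar> - A \<le> exp (t * \<bar>?X x\<bar> - A)" using exp_ge_add_one_self[of "t * \<bar>?X x\<bar> - A"] by linarith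
    also have "\<dots> = exp (- A) * exp (t * \<bar>?X x\<bar>)" by (simp add: exp_add[symmetric])
    also have "exp (t * \<bar>?X x\<bar>) \<le> exp (t * ?X x) + exp (t * (\<Sum>i\<in>I. - f (x i)))"
      by (cases "0 \<le> ?X x") (auto simp: sum_negf)
    finally show ?thesis by (simp add: mult_left_mono)
  qed
  then have "(\<integral>\<^sup>+x. ennreal t * ennreal \<bar>?X x\<bar> \<partial>gibbs g b I) \<le>
    (\<integral>\<^sup>+x. ennreal A + ennreal (exp (- A)) * (ennreal (exp (t * ?X x)) + ennreal (exp (t * (\<Sum>i\<in>I. - f (x i))))) \<partial>gibbs g b I)"
    using t A0 by (intro nn_integral_mono) 
      (simp add: ennreal_mult[symmetric] ennreal_plus[symmetric] add_nonneg_nonneg del: ennreal_plus)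
  also have "\<dots> = ennreal A + ennreal (exp (- A)) * ((\<integral>\<^sup>+x. ennreal (exp (t * ?X x)) \<partial>gibbs g b I) +
      (\<integral>\<^sup>+x. ennreal (exp (t * (\<Sum>i\<in>I. - f (x i)))) \<partial>gibbs g b I))"
    by (simp add: nn_integral_add nn_integral_cmult G.emeasure_space_1)
  also have "\<dots> \<le> ennreal A + ennreal (exp (- A)) * (ennreal (exp A) + ennreal (exp A))"
  proof -
    have *: "(\<integral>\<^sup>+x. ennreal (exp (t * (\<Sum>i\<in>I. h (x i)))) \<partial>gibbs g b I) \<le> ennreal (exp A)"
      if [measurable]: "h \<in> borel_measurable borel" and h: "\<And>y. \<bar>h y\<bar> \<le> B" "(\<integral>y. h y \<partial>M) = 0" for h
    proof -
      have "(\<integral>\<^sup>+x. ennreal (exp (t * (\<Sum>i\<in>I. h (x i)))) \<partial>gibbs g b I) \<le>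
        ennreal (exp (?n * excess g b (card I) T)) * (\<integral>\<^sup>+x. ennreal (exp (t * (\<Sum>i\<in>I. h (x i)))) \<partial>?P)"
        using gb by (intro nn_integral_gibbs_le) auto
      also have "\<dots> \<le> ennreal (exp (?n * excess g b (card I) T)) * ennreal (exp (?n * (t * B)\<^sup>2))"
        using t h by (intro mult_left_mono mgf_bound) auto
      also have "\<dots> = ennreal (exp A)"
        unfolding A_def by (simp add: ennreal_mult[symmetric] exp_add[symmetric] algebra_simps)
      finally show ?thesis .
    qed
    show ?thesis
      using f by (intro add_mono mult_left_mono order_refl *) auto
  qed
  also have "\<dots> = ennreal (A + 2)"
    using A0 by (simp add: ennreal_mult[symmetric] ennreal_plus[symmetric] exp_minus del: ennreal_plus)
  also have "(\<integral>\<^sup>+x. ennreal t * ennreal \<bar>?X x\<bar> \<partial>gibbs g b I) = ennreal t * (\<integral>\<^sup>+x. ennreal \<bar>?X x\<bar> \<partial>gibbs g b I)"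
    by (rule nn_integral_cmult) measurable
  finally have "ennreal (1 / t) * (ennreal t * (\<integral>\<^sup>+x. ennreal \<bar>?X x\<bar> \<partial>gibbs g b I)) \<le> ennreal (1 / t) * ennreal (A + 2)"
    by (intro mult_left_mono) auto
  also have "ennreal (1 / t) * (ennreal t * (\<integral>\<^sup>+x. ennreal \<bar>?X x\<bar> \<partial>gibbs g b I)) = (\<integral>\<^sup>+x. ennreal \<bar>?X x\<bar> \<partial>gibbs g b I)"
  proof -
    have "ennreal (1 / t) * ennreal t = 1" using t by (simp add: ennreal_mult[symmetric])
    then show ?thesis by (simp add: mult.assoc[symmetric])
  qed
  also have "ennreal (1 / t) * ennreal (A + 2) = ennreal ((A + 2) / t)"
    using t A0 by (simp add: ennreal_mult[symmetric] del: ennreal_plus)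
  finally show ?thesis unfolding A_def .
qed

section \<open>The tagged point and its cavity field\<close>

lemma part_insert_ge:
  assumes I: "finite I" "k \<notin> I" and gb: "0 \<le> g" "0 \<le> b"
  shows "part g b I * exp (- (b * real (card I) * C)) \<le> part g b (insert k I)"
proof -
  let ?P = "PiM I (\<lambda>_. M)"
  note [simp] = I(1)
  have 1: "ennreal (exp (- (b * real (card I) * C))) \<le> (\<integral>\<^sup>+y. ennreal (exp (g * pot y) * exp (- b * (\<Sum>i\<in>I. K y (x i)))) \<partial>M)" for x
  proof -
    \<comment> \<open>Jensen's inequality in the inserted point alone, at fixed \<open>x\<close>: by
      symmetry of \<open>K\<close>, \<open>m\<close> is the mean of the exponent over
      \<open>y\<close>. The factor \<open>exp (g * pot y)\<close> is at least 1 and is restored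
      afterwards.\<close>
    define m where "m = - b * (\<Sum>i\<in>I. pot (x i))"
    have K': "integrable M (\<lambda>y. K y (x i))" "(\<integral>y. K y (x i) \<partial>M) = pot (x i)" for i
      using K_integrable[of "x i"] by (simp_all add: K_sym[of _ "x i"] pot_def)
    have "(\<Sum>i\<in>I. pot (x i)) \<le> real (card I) * C"
      by (rule sum_bounded_above) (rule pot_le)
    then have "- (b * real (card I) * C) \<le> m"
      unfolding m_def using gb by (simp add: mult.assoc mult_left_mono)
    then have "exp (- (b * real (card I) * C)) \<le> exp m" by simp
    also have "exp m = (\<integral>y. exp m * (1 + - b * (\<Sum>i\<in>I. K y (x i)) - m) \<partial>M)"
      by (simp add: K' m_def)
    also have "\<dots> \<le> (\<integral>y. exp (- b * (\<Sum>i\<in>I. K y (x i))) \<partial>M)"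
    proof (rule integral_mono)
      show "integrable M (\<lambda>y. exp (- b * (\<Sum>i\<in>I. K y (x i))))"
        using gb by (intro integrable_const_bound[where B=1]) (auto intro!: mult_nonneg_nonneg sum_nonneg simp: K_nonneg)
      show "exp m * (1 + - b * (\<Sum>i\<in>I. K y (x i)) - m) \<le> exp (- b * (\<Sum>i\<in>I. K y (x i)))" for y
        by (rule exp_ge_tangent)
    qed (auto simp: K')
    finally have "ennreal (exp (- (b * real (card I) * C))) \<le> ennreal (\<integral>y. exp (- b * (\<Sum>i\<in>I. K y (x i))) \<partial>M)"
      by (rule ennreal_leI)
    also have "\<dots> = (\<integral>\<^sup>+y. ennreal (exp (- b * (\<Sum>i\<in>I. K y (x i)))) \<partial>M)"
      using gb by (intro nn_integral_eq_integral[symmetric] integrable_const_bound[where B=1])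
        (auto intro!: mult_nonneg_nonneg sum_nonneg simp: K_nonneg)
    also have "\<dots> \<le> (\<integral>\<^sup>+y. ennreal (exp (g * pot y) * exp (- b * (\<Sum>i\<in>I. K y (x i)))) \<partial>M)"
      using gb by (intro nn_integral_mono ennreal_leI) (simp add: pot_nonneg)
    finally show ?thesis .
  qed
  have "ennreal (part g b I * exp (- (b * real (card I) * C))) =
     (\<integral>\<^sup>+x. ennreal (wt g b I x) * ennreal (exp (- (b * real (card I) * C))) \<partial>?P)"
    using gb part_pos[OF I(1) gb] by (simp add: nn_integral_multc nn_integral_wt ennreal_mult less_imp_le)
  also have "\<dots> \<le> (\<integral>\<^sup>+x. ennreal (wt g b I x) * (\<integral>\<^sup>+y. ennreal (exp (g * pot y) * exp (- b * (\<Sum>i\<in>I. K y (x i)))) \<partial>M) \<partial>?P)"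
    by (intro nn_integral_mono mult_left_mono 1) auto
  also have "\<dots> = (\<integral>\<^sup>+x. \<integral>\<^sup>+y. ennreal (wt g b (insert k I) (x(k := y))) \<partial>M \<partial>?P)"
    using I gb by (intro nn_integral_cong, subst nn_integral_cmult[symmetric])
      (auto simp del: fun_upd_apply simp: wt_insert ennreal_mult' wt_pos less_imp_le)
  also have "\<dots> = (\<integral>\<^sup>+x. ennreal (wt g b (insert k I) x) \<partial>(PiM (insert k I) (\<lambda>_. M)))"
    using I by (intro PM.product_nn_integral_insert[symmetric]) auto
  also have "\<dots> = ennreal (part g b (insert k I))"
    using I gb by (intro nn_integral_wt) auto
  finally show ?thesis
    using part_pos[of "insert k I" g b] I gb by (subst (asm) ennreal_le_iff) auto
qed

lemma part_ratio_le:
  assumes I: "finite I" "k \<notin> I" and gb: "0 \<le> g" "0 \<le> b"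
  shows "part g b I / part g b (insert k I) \<le> exp (b * real (card I) * C)"
proof -
  have "part g b I = (part g b I * exp (- (b * real (card I) * C))) * exp (b * real (card I) * C)"
    by (simp add: mult.assoc exp_add[symmetric])
  also have "\<dots> \<le> part g b (insert k I) * exp (b * real (card I) * C)"
    using part_insert_ge[OF assms] by (intro mult_right_mono) auto
  finally show ?thesis
    using part_pos[of "insert k I" g b] I gb by (subst pos_divide_le_eq) (auto simp: mult.commute)
qed

text \<open>The interaction is repulsive, so its factor is at most 1 and the law of one point has
  density with respect to \<open>M\<close> bounded independently of the number of points, as long as
  \<open>b * card I\<close> is bounded. This transfers L1 estimates such as \<open>Kt_approx\<close>
  from \<open>M\<close> to the Gibbs measure.\<close>

lemma gibbs_one_point:
  fixes f :: "'a \<Rightarrow> ennreal"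
  assumes I: "finite I" "k \<in> I" and gb: "0 \<le> g" "0 \<le> b" and [measurable]: "f \<in> borel_measurable borel"
  shows "(\<integral>\<^sup>+x. f (x k) \<partial>gibbs g b I) \<le> ennreal (exp (b * real (card I) * C + g * C)) * (\<integral>\<^sup>+y. f y \<partial>M)"
proof -
  define J where "J = I - {k}"
  have J: "I = insert k J" "finite J" "k \<notin> J" using I by (auto simp: J_def)
  interpret G: prob_space "gibbs g b J" by (rule prob_space_gibbs) (use J gb in auto)
  have "(\<integral>\<^sup>+x. f (x k) \<partial>gibbs g b I) = ennreal (part g b J / part g b I) *
    (\<integral>\<^sup>+y. exp (g * pot y) * (\<integral>\<^sup>+x. f ((x(k := y)) k) * exp (- b * (\<Sum>i\<in>J. K y (x i))) \<partial>gibbs g b J) \<partial>M)"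
    unfolding J(1) using J gb by (intro gibbs_insert) auto
  also have "\<dots> \<le> ennreal (exp (b * real (card I) * C)) * (\<integral>\<^sup>+y. exp (g * C) * f y \<partial>M)"
  proof (rule mult_mono)
    have "part g b J / part g b I \<le> exp (b * real (card J) * C)"
      unfolding J(1) by (rule part_ratio_le) (use J gb in auto)
    also have "\<dots> \<le> exp (b * real (card I) * C)"
      using J gb C_nonneg by (simp add: J(1) mult_left_mono mult_right_mono)
    finally show "ennreal (part g b J / part g b I) \<le> ennreal (exp (b * real (card I) * C))"
      by (rule ennreal_leI)
    have "ennreal (exp (g * pot y)) * (\<integral>\<^sup>+x. f ((x(k := y)) k) * exp (- b * (\<Sum>i\<in>J. K y (x i))) \<partial>gibbs g b J) \<le>
        ennreal (exp (g * C)) * f y" for y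
    proof (intro mult_mono ennreal_leI)
      have "(\<integral>\<^sup>+x. f ((x(k := y)) k) * exp (- b * (\<Sum>i\<in>J. K y (x i))) \<partial>gibbs g b J) \<le>
          (\<integral>\<^sup>+x. f y * 1 \<partial>gibbs g b J)"
        using gb by (simp only: fun_upd_same, intro nn_integral_mono mult_left_mono)
          (auto intro!: mult_nonneg_nonneg sum_nonneg simp: K_nonneg)
      then show "(\<integral>\<^sup>+x. f ((x(k := y)) k) * exp (- b * (\<Sum>i\<in>J. K y (x i))) \<partial>gibbs g b J) \<le> f y"
        by (simp add: G.emeasure_space_1)
    qed (use gb in \<open>auto intro!: mult_left_mono simp: pot_le\<close>)
    then show "(\<integral>\<^sup>+y. exp (g * pot y) * (\<integral>\<^sup>+x. f ((x(k := y)) k) * exp (- b * (\<Sum>i\<in>J. K y (x i))) \<partial>gibbs g b J) \<partial>M) \<le>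
        (\<integral>\<^sup>+y. exp (g * C) * f y \<partial>M)"
      by (rule nn_integral_mono)
  qed auto
  also have "\<dots> = ennreal (exp (b * real (card I) * C + g * C)) * (\<integral>\<^sup>+y. f y \<partial>M)"
    by (subst nn_integral_cmult) (auto simp: exp_add ennreal_mult mult_ac)
  finally show ?thesis .
qed


text \<open>The function \<open>exp (- u)\<close> is 1-Lipschitz for \<open>u \<ge> 0\<close>, so it
  suffices to compare the field \<open>b * (\<Sum>i\<in>I. K y (x i))\<close> with
  \<open>g * pot y\<close>. The truncation \<open>T\<close> acts on this field, whereas
  \<open>T'\<close> enters only through the density bound, so the two can be chosen
  separately.\<close>

lemma cavity_bound:
  assumes I: "finite I" and gb: "0 \<le> g" "0 \<le> b" and t: "0 < t" "t * L T \<le> 1"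
  defines "n \<equiv> real (card I)"
  shows "(\<integral>\<^sup>+x. ennreal \<bar>exp (- b * (\<Sum>i\<in>I. K y (x i))) - exp (- g * pot y)\<bar> \<partial>gibbs g b I) \<le>
    ennreal (b * n * exp (b * n * C + g * C) * e T + b * ((n * (excess g b (card I) T' + (t * L T)\<^sup>2) + 2) / t)
      + \<bar>b * n - g\<bar> * C + g * e T)"
proof -
  note [simp] = I
  interpret G: prob_space "gibbs g b I" by (rule prob_space_gibbs) (use I gb in auto)
  define f where "f z = Kt T y z - pott T y" for z
  have [measurable]: "f \<in> borel_measurable borel" unfolding f_def[abs_def] by measurable
  have pL: "pott T y \<le> L T"
  proof -
    have "pott T y \<le> (\<integral>z. L T \<partial>M)"
      unfolding pott_def by (rule integral_mono) (auto simp: Kt_le)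
    then show ?thesis by simp
  qed
  have fB: "\<bar>f z\<bar> \<le> L T" for z
    using Kt_le[of T y z] Kt_nonneg[of T y z] pott_nonneg[of T y] pL by (auto simp: f_def abs_le_iff)
  have f0: "(\<integral>z. f z \<partial>M) = 0" by (simp add: f_def pott_def)
  \<comment> \<open>The deterministic part of the error: \<open>b * n\<close> against
    \<open>g\<close>, and the truncation of the potential.\<close>
  define R where "R = \<bar>b * n - g\<bar> * C + g * e T"
  have R0: "0 \<le> R" using gb by (simp add: R_def C_nonneg e_nonneg)
  have "\<bar>exp (- b * (\<Sum>i\<in>I. K y (x i))) - exp (- g * pot y)\<bar> \<le>
     b * (\<Sum>i\<in>I. \<bar>K y (x i) - Kt T y (x i)\<bar>) + b * \<bar>\<Sum>i\<in>I. f (x i)\<bar> + R" (is "?l \<le> _") for x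
  proof -
    have lip: "\<bar>exp (- u) - exp (- v)\<bar> \<le> \<bar>u - v\<bar>" if "0 \<le> u" "0 \<le> v" for u v :: real
    proof -
      have *: "exp (- u) - exp (- v) \<le> v - u" if "0 \<le> u" "u \<le> v" for u v :: real
      proof -
        have "exp (- u) * (1 - (v - u)) \<le> exp (- u) * exp (- (v - u))"
          by (intro mult_left_mono) (use exp_ge_add_one_self[of "- (v - u)"] in \<open>linarith | simp\<close>)+
        then have "exp (- u) - exp (- v) \<le> exp (- u) * (v - u)"
          by (simp add: exp_add[symmetric] algebra_simps)
        also have "\<dots> \<le> 1 * (v - u)" using that by (intro mult_right_mono) auto
        finally show ?thesis by simp
      qed
      show ?thesis using *[of u v] *[of v u] that by (cases "u \<le> v") auto
    qed
    have "?l \<le> \<bar>b * (\<Sum>i\<in>I. K y (x i)) - g * pot y\<bar>"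
      using lip[of "b * (\<Sum>i\<in>I. K y (x i))" "g * pot y"] gb
      by (simp add: pot_nonneg sum_nonneg K_nonneg)
    also have "b * (\<Sum>i\<in>I. K y (x i)) - g * pot y = b * (\<Sum>i\<in>I. K y (x i) - Kt T y (x i)) +
        b * (\<Sum>i\<in>I. f (x i)) + ((b * n - g) * pott T y - g * (pot y - pott T y))"
      by (simp add: f_def sum_subtractf n_def algebra_simps)
    also have "\<bar>\<dots>\<bar> \<le> \<bar>b * (\<Sum>i\<in>I. K y (x i) - Kt T y (x i))\<bar> + \<bar>b * (\<Sum>i\<in>I. f (x i))\<bar> + 
        (\<bar>(b * n - g) * pott T y\<bar> + \<bar>g * (pot y - pott T y)\<bar>)"
      by linarith
    also have "\<bar>b * (\<Sum>i\<in>I. K y (x i) - Kt T y (x i))\<bar> \<le> b * (\<Sum>i\<in>I. \<bar>K y (x i) - Kt T y (x i)\<bar>)"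
      using gb by (simp add: abs_mult mult_left_mono sum_abs)
    also have "\<bar>b * (\<Sum>i\<in>I. f (x i))\<bar> = b * \<bar>\<Sum>i\<in>I. f (x i)\<bar>" using gb by (simp add: abs_mult)
    also have "\<bar>(b * n - g) * pott T y\<bar> \<le> \<bar>b * n - g\<bar> * C"
      using order_trans[OF pott_le_pot pot_le, of T y] pott_nonneg[of T y] by (simp add: abs_mult mult_left_mono)
    also have "\<bar>g * (pot y - pott T y)\<bar> \<le> g * e T"
      using gb pott_le_pot[of T y] pot_le_pott[of y T] by (simp add: abs_mult mult_left_mono)
    finally show ?thesis by (simp add: R_def)
  qed
  then have "(\<integral>\<^sup>+x. ennreal \<bar>exp (- b * (\<Sum>i\<in>I. K y (x i))) - exp (- g * pot y)\<bar> \<partial>gibbs g b I) \<le>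
    (\<integral>\<^sup>+x. ennreal b * (\<Sum>i\<in>I. ennreal \<bar>K y (x i) - Kt T y (x i)\<bar>) + ennreal b * ennreal \<bar>\<Sum>i\<in>I. f (x i)\<bar> + ennreal R \<partial>gibbs g b I)"
    using gb R0 by (intro nn_integral_mono)
      (simp add: ennreal_mult[symmetric] sum_nonneg ennreal_plus[symmetric] del: ennreal_plus)
  also have "\<dots> = ennreal b * (\<Sum>i\<in>I. \<integral>\<^sup>+x. ennreal \<bar>K y (x i) - Kt T y (x i)\<bar> \<partial>gibbs g b I) + 
      ennreal b * (\<integral>\<^sup>+x. ennreal \<bar>\<Sum>i\<in>I. f (x i)\<bar> \<partial>gibbs g b I) + ennreal R"
    by (simp add: nn_integral_add nn_integral_cmult nn_integral_sum G.emeasure_space_1 del: sum_ennreal)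
  also have "\<dots> \<le> ennreal b * (\<Sum>i\<in>I. ennreal (exp (b * n * C + g * C)) * ennreal (e T)) +
     ennreal b * ennreal ((n * (excess g b (card I) T' + (t * L T)\<^sup>2) + 2) / t) + ennreal R"
  proof (intro add_mono mult_left_mono order_refl sum_mono)
    fix i assume "i \<in> I"
    have "(\<integral>\<^sup>+x. ennreal \<bar>K y (x i) - Kt T y (x i)\<bar> \<partial>gibbs g b I) \<le>
        ennreal (exp (b * n * C + g * C)) * (\<integral>\<^sup>+z. ennreal \<bar>K y z - Kt T y z\<bar> \<partial>M)"
      unfolding n_def using \<open>i \<in> I\<close> gb by (intro gibbs_one_point) auto
    also have "\<dots> \<le> ennreal (exp (b * n * C + g * C)) * ennreal (e T)"
      by (intro mult_left_mono Kt_approx) auto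
    finally show "(\<integral>\<^sup>+x. ennreal \<bar>K y (x i) - Kt T y (x i)\<bar> \<partial>gibbs g b I) \<le> 
      ennreal (exp (b * n * C + g * C)) * ennreal (e T)" .
  next
    show "(\<integral>\<^sup>+x. ennreal \<bar>\<Sum>i\<in>I. f (x i)\<bar> \<partial>gibbs g b I) \<le>
        ennreal ((n * (excess g b (card I) T' + (t * L T)\<^sup>2) + 2) / t)"
      unfolding n_def using fB f0 t gb by (intro gibbs_fluctuation) auto
  qed auto
  also have "\<dots> = ennreal (b * n * exp (b * n * C + g * C) * e T + b * ((n * (excess g b (card I) T' + (t * L T)\<^sup>2) + 2) / t) + R)"
  proof -
    define Y where "Y = (n * (excess g b (card I) T' + (t * L T)\<^sup>2) + 2) / t"
    have "0 \<le> Y"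
      using t gb by (auto simp: n_def excess_nonneg Y_def)
    then show ?thesis unfolding Y_def[symmetric]
      using gb R0 e_nonneg[of T] by (simp add: n_def ennreal_mult[symmetric] ennreal_plus[symmetric] ennreal_of_nat_eq_real_of_nat mult_ac del: ennreal_plus)
  qed
  finally show ?thesis by (simp add: R_def add.assoc)
qed

text \<open>Three scales: the truncation \<open>T\<close> in the fluctuation, then the rate \<open>t\<close>, and only then the
  truncation \<open>T'\<close> in the density bound.\<close>

lemma cavity_limit:
  assumes g: "0 \<le> g" and b: "\<And>N. 0 \<le> b N" and lim: "(\<lambda>N. b N * real N) \<longlonglongrightarrow> g" and r: "0 < (r::real)"
  shows "\<forall>\<^sub>F N in sequentially. \<forall>I::nat set. finite I \<longrightarrow> card I = N \<longrightarrow>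
    (\<forall>y. (\<integral>\<^sup>+x. ennreal \<bar>exp (- b N * (\<Sum>i\<in>I. K y (x i))) - exp (- g * pot y)\<bar> \<partial>gibbs g (b N) I) \<le> ennreal r)"
proof -
  have b0: "b \<longlonglongrightarrow> 0" by (rule tendsto_zero_if_times_n[OF lim])
  have "(\<lambda>T. g * exp (g * C + g * C) * e T + g * e T) \<longlonglongrightarrow> g * exp (g * C + g * C) * 0 + g * 0"
    by (intro tendsto_intros e_tendsto)
  then have "\<forall>\<^sub>F T in sequentially. g * exp (g * C + g * C) * e T + g * e T < r / 3"
    using r by (intro order_tendstoD(2)[where y="g * exp (g * C + g * C) * 0 + g * 0"]) auto
  then obtain T where T: "g * exp (g * C + g * C) * e T + g * e T < r / 3"
    by (auto simp: eventually_sequentially)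
  \<comment> \<open>The first entry gives \<open>t * L T \<le> 1\<close>, the range of the moment
    bound; the second makes the quadratic error \<open>g * (t * L T)\<^sup>2 / t\<close> at most
    \<open>r / 3\<close>. The added 1 keeps both denominators positive.\<close>
  define t where "t = min (1 / (L T + 1)) (r / (3 * (g * (L T)\<^sup>2 + 1)))"
  have L0: "0 \<le> L T" by (rule L_nonneg)
  have gL: "0 < g * (L T)\<^sup>2 + 1" using g by (simp add: add_nonneg_pos)
  have t0: "0 < t" using L0 r gL by (simp add: t_def)
  have "t \<le> 1 / (L T + 1)" by (simp add: t_def)
  then have "t * L T \<le> 1 / (L T + 1) * L T" using L0 by (rule mult_right_mono)
  also have "\<dots> \<le> 1" using L0 by simp
  finally have t1: "t * L T \<le> 1" .
  have t2: "g * (t * L T)\<^sup>2 / t \<le> r / 3"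
  proof -
    have "g * (t * L T)\<^sup>2 / t = t * (g * (L T)\<^sup>2)" using t0 by (simp add: power2_eq_square)
    also have "\<dots> \<le> r / (3 * (g * (L T)\<^sup>2 + 1)) * (g * (L T)\<^sup>2 + 1)"
      using t0 g gL r by (intro mult_mono) (auto simp: t_def)
    also have "\<dots> = r / 3" using gL by (simp add: field_simps)
    finally show ?thesis .
  qed
  have "(\<lambda>T'. g * (g * e T') / t) \<longlonglongrightarrow> g * (g * 0) / t"
    by (intro tendsto_intros e_tendsto) (use t0 in auto)
  then have "\<forall>\<^sub>F T' in sequentially. g * (g * e T') / t < r / 3"
    using r by (intro order_tendstoD(2)[where y="g * (g * 0) / t"]) auto
  then obtain T' where T': "g * (g * e T') / t < r / 3"
    by (auto simp: eventually_sequentially)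
  \<comment> \<open>The bound of \<open>cavity_bound\<close> rearranged so that \<open>N\<close>
    occurs only through \<open>b N * real N\<close> and \<open>b N\<close>, whose limits are
    \<open>g\<close> and 0.\<close>
  define B where "B N = (b N * real N) * exp ((b N * real N) * C + g * C) * e T +
     ((b N * real N) * ((2 * \<bar>g - b N * real N\<bar> * C + (b N * real N) * e T' + b N / 2 * L T') + (t * L T)\<^sup>2) + b N * 2) / t
      + \<bar>b N * real N - g\<bar> * C + g * e T" for N
  have "B \<longlonglongrightarrow> g * exp (g * C + g * C) * e T + 
     (g * ((2 * \<bar>g - g\<bar> * C + g * e T' + 0 / 2 * L T') + (t * L T)\<^sup>2) + 0 * 2) / t + \<bar>g - g\<bar> * C + g * e T"
    unfolding B_def[abs_def] by (intro tendsto_intros lim b0) (use t0 in auto)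
  moreover have "g * exp (g * C + g * C) * e T + 
     (g * ((2 * \<bar>g - g\<bar> * C + g * e T' + 0 / 2 * L T') + (t * L T)\<^sup>2) + 0 * 2) / t + \<bar>g - g\<bar> * C + g * e T < r"
  proof -
    have "g * ((2 * \<bar>g - g\<bar> * C + g * e T' + 0 / 2 * L T') + (t * L T)\<^sup>2) + 0 * 2 = g * (g * e T') + g * (t * L T)\<^sup>2"
      by (simp add: distrib_left)
    then have "g * exp (g * C + g * C) * e T + 
     (g * ((2 * \<bar>g - g\<bar> * C + g * e T' + 0 / 2 * L T') + (t * L T)\<^sup>2) + 0 * 2) / t + \<bar>g - g\<bar> * C + g * e T =
      (g * exp (g * C + g * C) * e T + g * e T) + g * (g * e T') / t + g * (t * L T)\<^sup>2 / t"
      by (simp only: add_divide_distrib) simp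
    then show ?thesis using T T' t2 by linarith
  qed
  ultimately have "\<forall>\<^sub>F N in sequentially. B N < r" by (rule order_tendstoD(2))
  then show ?thesis
  proof eventually_elim
    case (elim N)
    show ?case
    proof (intro allI impI)
      fix I :: "nat set" and y assume I: "finite I" "card I = N"
      have "B N = b N * real N * exp (b N * real N * C + g * C) * e T + 
        b N * ((real N * (excess g (b N) N T' + (t * L T)\<^sup>2) + 2) / t) + \<bar>b N * real N - g\<bar> * C + g * e T"
        by (simp add: B_def excess_def field_simps)
      then show "(\<integral>\<^sup>+x. ennreal \<bar>exp (- b N * (\<Sum>i\<in>I. K y (x i))) - exp (- g * pot y)\<bar> \<partial>gibbs g (b N) I) \<le> ennreal r"
        using cavity_bound[OF I(1) g b[of N] t0 t1, of y T'] elim I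
        by (auto intro: order_trans ennreal_leI less_imp_le)
    qed
  qed
qed


text \<open>If \<open>x k\<close> is integrated out last, \<open>q = exp (g * pot y)\<close> cancels the cavity factor up to \<open>r\<close>, so
  \<open>x k\<close> is nearly independent of the other points and nearly distributed as \<open>M\<close>.\<close>

lemma gibbs_product_step:
  assumes J: "finite J" "k \<notin> J" "S \<subseteq> J" and gb: "0 \<le> g" "0 \<le> b"
    and p [measurable]: "p \<in> borel_measurable borel" and p01: "\<And>y. 0 \<le> p y" "\<And>y. p y \<le> 1"
    and r: "0 \<le> r" "exp (g * C) * r \<le> 1 / 2"
    and cavity: "\<And>y. (\<integral>\<^sup>+x. ennreal \<bar>exp (- b * (\<Sum>i\<in>J. K y (x i))) - exp (- g * pot y)\<bar> \<partial>gibbs g b J) \<le> ennreal r"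
  defines "A \<equiv> \<lambda>S. (\<integral>x. (\<Prod>i\<in>S. p (x i)) \<partial>gibbs g b (insert k J))"
    and "\<eta> \<equiv> (\<integral>y. 1 - p y \<partial>M)"
  shows "\<bar>A (insert k S) - (1 - \<eta>) * A S\<bar> \<le> 4 * \<eta> * (exp (g * C) * r)"
proof -
  note [simp] = J(1)
  let ?G = "gibbs g b J" and ?I = "insert k J"
  interpret G: prob_space ?G by (rule prob_space_gibbs) (use gb in auto)
  interpret GI: prob_space "gibbs g b ?I" by (rule prob_space_gibbs) (use gb in auto)
  have fS [simp]: "finite S" using J finite_subset by blast
  define \<rho> where "\<rho> = part g b J / part g b ?I"
  have \<rho>0: "0 \<le> \<rho>"
    using part_pos[of J g b] part_pos[of ?I g b] gb by (simp add: \<rho>_def)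
  \<comment> \<open>Up to the factor \<open>\<rho>\<close>, this is the density in
    \<open>y = x k\<close> of the expectation of the product over \<open>U\<close>. By the cavity
    estimate it is almost constant in \<open>y\<close>.\<close>
  define \<phi> where "\<phi> U y = exp (g * pot y) * (\<integral>x. (\<Prod>i\<in>U. p (x i)) * exp (- b * (\<Sum>i\<in>J. K y (x i))) \<partial>?G)" for U y
  have comp: "(\<lambda>x. p (x i)) \<in> borel_measurable (PiM J (\<lambda>_. M))" if "i \<in> J" for i
    using that by (intro measurable_compose[OF measurable_component_singleton[of i J "\<lambda>_. M"]]) (auto simp: measurable_cong_sets[OF sets_M refl])
  have compI: "(\<lambda>x. p (x i)) \<in> borel_measurable (PiM ?I (\<lambda>_. M))" if "i \<in> ?I" for i
    using that by (intro measurable_compose[OF measurable_component_singleton[of i ?I "\<lambda>_. M"]]) (auto simp: measurable_cong_sets[OF sets_M refl])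
  have prodm: "(\<lambda>x. \<Prod>i\<in>U. p (x i)) \<in> borel_measurable (PiM J (\<lambda>_. M))" if "U \<subseteq> J" for U
    using comp that by (intro borel_measurable_prod) auto
  have p01': "0 \<le> (\<Prod>i\<in>U. p (x i))" "(\<Prod>i\<in>U. p (x i)) \<le> 1" for U :: "'b set" and x
    by (auto intro!: prod_nonneg prod_le_1 simp: p01)
  have e01: "exp (- b * (\<Sum>i\<in>J. K y (x i))) \<le> 1" for y x
    using gb by (auto intro!: mult_nonneg_nonneg sum_nonneg simp: K_nonneg)
  have int1: "integrable ?G (\<lambda>x. (\<Prod>i\<in>U. p (x i)) * exp (- b * (\<Sum>i\<in>J. K y (x i))))" if "U \<subseteq> J" for U y
  proof (rule G.integrable_const_bound[where B=1])
    note [measurable] = prodm[OF that]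
    show "(\<lambda>x. (\<Prod>i\<in>U. p (x i)) * exp (- b * (\<Sum>i\<in>J. K y (x i)))) \<in> borel_measurable ?G" by measurable
  qed (use p01' e01 in \<open>auto intro!: mult_le_one simp: abs_mult\<close>)
  have int2: "integrable ?G (\<lambda>x. (\<Prod>i\<in>U. p (x i)))" if "U \<subseteq> J" for U
  proof (rule G.integrable_const_bound[where B=1])
    note [measurable] = prodm[OF that]
    show "(\<lambda>x. (\<Prod>i\<in>U. p (x i))) \<in> borel_measurable ?G" by measurable
  qed (use p01' in auto)
  have \<phi>m: "\<phi> U \<in> borel_measurable borel" if "U \<subseteq> J" for U
  proof -
    note [measurable] = prodm[OF that]
    show ?thesis unfolding \<phi>_def[abs_def] by measurable
  qed
  have \<phi>0: "0 \<le> \<phi> U y" for U y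
    unfolding \<phi>_def by (intro mult_nonneg_nonneg Bochner_Integration.integral_nonneg) (auto simp: p01' )
  have egC: "exp (g * pot y) \<le> exp (g * C)" for y
    using gb by (simp add: mult_left_mono pot_le)
  have \<phi>c: "\<bar>\<phi> U y - (\<integral>x. (\<Prod>i\<in>U. p (x i)) \<partial>?G)\<bar> \<le> exp (g * C) * r" if U: "U \<subseteq> J" for U y
  proof -
    note [measurable] = prodm[OF that]
    let ?d = "\<lambda>x. exp (- b * (\<Sum>i\<in>J. K y (x i))) - exp (- g * pot y)"
    have aux: "E * E' = 1 \<Longrightarrow> D = X - c * E' \<Longrightarrow> E * X - c = E * D" for E E' D X c :: real
      by (simp add: right_diff_distrib mult.left_commute)
    have "exp (g * pot y) * exp (- g * pot y) = 1" by (simp flip: exp_add)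
    moreover have "(\<integral>x. (\<Prod>i\<in>U. p (x i)) * ?d x \<partial>?G) =
        (\<integral>x. (\<Prod>i\<in>U. p (x i)) * exp (- b * (\<Sum>i\<in>J. K y (x i))) \<partial>?G) - (\<integral>x. (\<Prod>i\<in>U. p (x i)) \<partial>?G) * exp (- g * pot y)"
      unfolding right_diff_distrib
      by (subst Bochner_Integration.integral_diff[OF int1[OF U] integrable_mult_left[OF int2[OF U]]])
        (simp only: integral_mult_left_zero)
    ultimately have eq: "\<phi> U y - (\<integral>x. (\<Prod>i\<in>U. p (x i)) \<partial>?G) = exp (g * pot y) * (\<integral>x. (\<Prod>i\<in>U. p (x i)) * ?d x \<partial>?G)"
      unfolding \<phi>_def by (rule aux)
    have "\<bar>\<phi> U y - (\<integral>x. (\<Prod>i\<in>U. p (x i)) \<partial>?G)\<bar> = exp (g * pot y) * \<bar>\<integral>x. (\<Prod>i\<in>U. p (x i)) * ?d x \<partial>?G\<bar>"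
      unfolding eq by (simp only: abs_mult abs_exp_cancel)
    also have "\<dots> \<le> exp (g * C) * r"
    proof (rule mult_mono)
      have i: "integrable ?G (\<lambda>x. \<bar>?d x\<bar>)"
        using le_less_trans[OF cavity[of y] ennreal_less_top] by (intro integrableI_bounded) simp_all
      have "\<bar>\<integral>x. (\<Prod>i\<in>U. p (x i)) * ?d x \<partial>?G\<bar> \<le> (\<integral>x. \<bar>?d x\<bar> \<partial>?G)"
      proof (rule order_trans[OF integral_abs_bound integral_mono[OF integrable_abs]])
        show "integrable ?G (\<lambda>x. (\<Prod>i\<in>U. p (x i)) * ?d x)"
          unfolding right_diff_distrib
          by (rule Bochner_Integration.integrable_diff[OF int1[OF U] integrable_mult_left[OF int2[OF U]]])
        show "\<bar>(\<Prod>i\<in>U. p (x i)) * ?d x\<bar> \<le> \<bar>?d x\<bar>" for x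
          unfolding abs_mult by (intro mult_left_le_one_le) (simp_all add: p01')
      qed (rule i)
      also have "\<dots> \<le> r"
        using cavity[of y] r(1) unfolding nn_integral_eq_integral[OF i AE_I2[OF abs_ge_zero]] by (simp only: ennreal_le_iff)
      finally show "\<bar>\<integral>x. (\<Prod>i\<in>U. p (x i)) * ?d x \<partial>?G\<bar> \<le> r" .
    qed (rule egC, simp_all)
    finally show ?thesis .
  qed
  have \<phi>int: "integrable M (\<phi> U)" if "U \<subseteq> J" for U
  proof (rule integrable_const_bound[where B="1 + exp (g * C) * r"])
    show "AE y in M. norm (\<phi> U y) \<le> 1 + exp (g * C) * r"
    proof (rule AE_I2)
      fix y
      have "(\<integral>x. (\<Prod>i\<in>U. p (x i)) \<partial>?G) \<le> (\<integral>x. 1 \<partial>?G)"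
        by (rule integral_mono) (use int2[OF that] p01' in auto)
      then show "norm (\<phi> U y) \<le> 1 + exp (g * C) * r"
        using \<phi>c[OF that, of y] \<phi>0[of U y] by (simp add: G.prob_space)
    qed
  qed (use \<phi>m[OF that] in simp)
  have key: "(\<integral>x. w (x k) * (\<Prod>i\<in>U. p (x i)) \<partial>gibbs g b ?I) = \<rho> * (\<integral>y. w y * \<phi> U y \<partial>M)"
    if U: "U \<subseteq> J" and w [measurable]: "w \<in> borel_measurable borel" and w01: "\<And>y. 0 \<le> w y" "\<And>y. w y \<le> 1" for U w
  proof -
    have Um [measurable]: "(\<lambda>x. \<Prod>i\<in>U. p (x i)) \<in> borel_measurable (PiM ?I (\<lambda>_. M))"
      using compI U by (intro borel_measurable_prod) auto
    note [measurable] = prodm[OF U] \<phi>m[OF U]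
    have "(\<integral>\<^sup>+x. ennreal (w (x k) * (\<Prod>i\<in>U. p (x i))) \<partial>gibbs g b ?I) = ennreal \<rho> *
      (\<integral>\<^sup>+y. ennreal (exp (g * pot y)) * (\<integral>\<^sup>+x. ennreal (w ((x(k := y)) k) * (\<Prod>i\<in>U. p ((x(k := y)) i))) * ennreal (exp (- b * (\<Sum>i\<in>J. K y (x i)))) \<partial>?G) \<partial>M)"
      unfolding \<rho>_def using J gb by (intro gibbs_insert) auto
    also have "\<dots> = ennreal \<rho> * (\<integral>\<^sup>+y. ennreal (w y * \<phi> U y) \<partial>M)"
    proof (intro arg_cong2[of _ _ _ _ "(*)"] refl nn_integral_cong)
      fix y
      have "(\<integral>\<^sup>+x. ennreal (w ((x(k := y)) k) * (\<Prod>i\<in>U. p ((x(k := y)) i))) * ennreal (exp (- b * (\<Sum>i\<in>J. K y (x i)))) \<partial>?G) =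
        (\<integral>\<^sup>+x. ennreal (w y) * ennreal ((\<Prod>i\<in>U. p (x i)) * exp (- b * (\<Sum>i\<in>J. K y (x i)))) \<partial>?G)"
      proof (rule nn_integral_cong)
        fix x
        have "(\<Prod>i\<in>U. p ((x(k := y)) i)) = (\<Prod>i\<in>U. p (x i))"
          using U J by (intro prod.cong) auto
        then show "ennreal (w ((x(k := y)) k) * (\<Prod>i\<in>U. p ((x(k := y)) i))) * ennreal (exp (- b * (\<Sum>i\<in>J. K y (x i)))) =
          ennreal (w y) * ennreal ((\<Prod>i\<in>U. p (x i)) * exp (- b * (\<Sum>i\<in>J. K y (x i))))"
          using w01 p01' by (simp add: ennreal_mult mult.assoc)
      qed
      also have "\<dots> = ennreal (w y) * ennreal (\<integral>x. (\<Prod>i\<in>U. p (x i)) * exp (- b * (\<Sum>i\<in>J. K y (x i))) \<partial>?G)"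
        by (subst nn_integral_cmult, measurable, subst nn_integral_eq_integral[OF int1[OF U]]) (auto simp: p01')
      finally show "ennreal (exp (g * pot y)) * (\<integral>\<^sup>+x. ennreal (w ((x(k := y)) k) * (\<Prod>i\<in>U. p ((x(k := y)) i))) * ennreal (exp (- b * (\<Sum>i\<in>J. K y (x i)))) \<partial>?G) =
          ennreal (w y * \<phi> U y)"
        using w01 by (simp add: \<phi>_def ennreal_mult[symmetric] p01' mult_ac)
    qed
    also have "(\<integral>\<^sup>+y. ennreal (w y * \<phi> U y) \<partial>M) = ennreal (\<integral>y. w y * \<phi> U y \<partial>M)"
    proof (rule nn_integral_eq_integral)
      show "integrable M (\<lambda>y. w y * \<phi> U y)"
        by (rule Bochner_Integration.integrable_bound[OF \<phi>int[OF U]])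
          (use w01 \<phi>0 in \<open>auto simp: abs_mult mult_left_le_one_le\<close>)
    qed (use w01 \<phi>0 in auto)
    finally have nn: "(\<integral>\<^sup>+x. ennreal (w (x k) * (\<Prod>i\<in>U. p (x i))) \<partial>gibbs g b ?I) = ennreal (\<rho> * (\<integral>y. w y * \<phi> U y \<partial>M))"
      using \<rho>0 by (simp add: ennreal_mult')
    have [measurable]: "(\<lambda>x. w (x k)) \<in> borel_measurable (PiM ?I (\<lambda>_. M))"
      by (intro measurable_compose[OF measurable_component_singleton[of k ?I "\<lambda>_. M"]]) (auto simp: measurable_cong_sets[OF sets_M refl])
    have "(\<integral>x. w (x k) * (\<Prod>i\<in>U. p (x i)) \<partial>gibbs g b ?I) = enn2real (\<integral>\<^sup>+x. ennreal (w (x k) * (\<Prod>i\<in>U. p (x i))) \<partial>gibbs g b ?I)"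
      by (rule integral_eq_nn_integral) (use w01 p01' in auto)
    also have "\<dots> = \<rho> * (\<integral>y. w y * \<phi> U y \<partial>M)"
      unfolding nn using \<rho>0 w01 \<phi>0 by (auto intro!: enn2real_ennreal mult_nonneg_nonneg Bochner_Integration.integral_nonneg)
    finally show ?thesis .
  qed
  have AS: "A S = \<rho> * (\<integral>y. \<phi> S y \<partial>M)"
    using key[OF J(3), of "\<lambda>_. 1"] by (simp add: A_def)
  have "k \<notin> S" using J by auto
  then have AkS: "A (insert k S) = \<rho> * (\<integral>y. p y * \<phi> S y \<partial>M)"
    using key[OF J(3) p p01] by (simp add: A_def)
  \<comment> \<open>The empty product determines the normalization: \<open>\<phi> {}\<close> is at
    least 1/2 everywhere, hence \<open>\<rho> \<le> 2\<close>.\<close>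
  have one: "1 = \<rho> * (\<integral>y. \<phi> {} y \<partial>M)"
    using key[of "{}" "\<lambda>_. 1"] by (simp add: GI.prob_space)
  have "(\<integral>y. 1 - exp (g * C) * r \<partial>M) \<le> (\<integral>y. \<phi> {} y \<partial>M)"
  proof (rule integral_mono)
    show "1 - exp (g * C) * r \<le> \<phi> {} y" for y
      using \<phi>c[of "{}" y] by (simp add: G.prob_space)
  qed (use \<phi>int[of "{}"] in auto)
  then have "1 / 2 \<le> (\<integral>y. \<phi> {} y \<partial>M)" using r by simp
  from mult_left_mono[OF this \<rho>0] one have \<rho>2: "\<rho> \<le> 2" by simp
  have pint: "integrable M p" by (rule integrable_const_bound[where B=1]) (auto simp: p01)
  have \<eta>: "\<eta> = 1 - (\<integral>y. p y \<partial>M)" using pint by (simp add: \<eta>_def)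
  have \<eta>0: "0 \<le> \<eta>" unfolding \<eta>_def by (intro Bochner_Integration.integral_nonneg) (simp add: p01)
  define c where "c = (\<integral>x. (\<Prod>i\<in>S. p (x i)) \<partial>?G)"
  have pphi: "integrable M (\<lambda>y. p y * \<phi> S y)"
    by (rule Bochner_Integration.integrable_bound[OF \<phi>int[OF J(3)]])
      (use p01 \<phi>0 \<phi>m[OF J(3)] in \<open>auto simp: abs_mult mult_left_le_one_le\<close>)
  \<comment> \<open>Since \<open>p - (1 - \<eta>)\<close> has mean 0 under \<open>M\<close>, the
    constant \<open>c\<close> may be subtracted from \<open>\<phi> S\<close>. Both factors are then
    small: the first has L1 norm at most \<open>2 * \<eta>\<close>, the second is bounded by
    \<open>exp (g * C) * r\<close>.\<close>
  have "A (insert k S) - (1 - \<eta>) * A S = \<rho> * (\<integral>y. (p y - (1 - \<eta>)) * (\<phi> S y - c) \<partial>M)"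
  proof -
    have "(\<integral>y. (p y - (1 - \<eta>)) * (\<phi> S y - c) \<partial>M) =
       (\<integral>y. p y * \<phi> S y - (1 - \<eta>) * \<phi> S y - (c * p y - c * (1 - \<eta>)) \<partial>M)"
      by (intro Bochner_Integration.integral_cong) (auto simp: algebra_simps)
    also have "\<dots> = (\<integral>y. p y * \<phi> S y \<partial>M) - (1 - \<eta>) * (\<integral>y. \<phi> S y \<partial>M)"
      using pphi \<phi>int[OF J(3)] pint by (simp add: \<eta>)
    finally have eq: "(\<integral>y. (p y - (1 - \<eta>)) * (\<phi> S y - c) \<partial>M) =
        (\<integral>y. p y * \<phi> S y \<partial>M) - (1 - \<eta>) * (\<integral>y. \<phi> S y \<partial>M)" .
    show ?thesis unfolding AS AkS eq by (simp add: algebra_simps)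
  qed
  also have "\<bar>\<dots>\<bar> = \<rho> * \<bar>\<integral>y. (p y - (1 - \<eta>)) * (\<phi> S y - c) \<partial>M\<bar>" using \<rho>0 by (simp add: abs_mult)
  also have "\<dots> \<le> 2 * (\<integral>y. (exp (g * C) * r) * ((1 - p y) + \<eta>) \<partial>M)"
  proof (intro mult_mono)
    show "\<bar>\<integral>y. (p y - (1 - \<eta>)) * (\<phi> S y - c) \<partial>M\<bar> \<le> (\<integral>y. (exp (g * C) * r) * ((1 - p y) + \<eta>) \<partial>M)"
    proof (rule order_trans[OF integral_abs_bound integral_mono[OF integrable_abs]])
      have "(p y - (1 - \<eta>)) * (\<phi> S y - c) = p y * \<phi> S y - (1 - \<eta>) * \<phi> S y - (c * p y - c * (1 - \<eta>))" for y
        by (simp add: algebra_simps)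
      then show "integrable M (\<lambda>y. (p y - (1 - \<eta>)) * (\<phi> S y - c))"
        using pphi \<phi>int[OF J(3)] pint by simp
      show "\<bar>(p y - (1 - \<eta>)) * (\<phi> S y - c)\<bar> \<le> (exp (g * C) * r) * ((1 - p y) + \<eta>)" for y
        unfolding abs_mult mult.commute[of "\<bar>p y - (1 - \<eta>)\<bar>"] c_def
        using r \<eta>0 p01[of y] by (intro mult_mono \<phi>c[OF J(3)]) auto
    qed (use pint in auto)
  qed (use \<rho>2 in auto)
  also have "\<dots> = 4 * \<eta> * (exp (g * C) * r)"
    using pint by (simp add: \<eta>)
  finally show ?thesis .
qed

text \<open>Only the set of factors grows in the induction, the Gibbs measure on \<open>I\<close>
  stays fixed. The multiplier \<open>1 - \<eta>\<close> lies between 0 and 1, so earlier errors are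
  not amplified and the errors just add up.\<close>

lemma gibbs_product:
  assumes I: "finite I" "S \<subseteq> I" and gb: "0 \<le> g" "0 \<le> b"
    and p [measurable]: "p \<in> borel_measurable borel" and p01: "\<And>y. 0 \<le> p y" "\<And>y. p y \<le> 1"
    and r: "0 \<le> r" "exp (g * C) * r \<le> 1 / 2"
    and cavity: "\<And>k y. k \<in> I \<Longrightarrow> (\<integral>\<^sup>+x. ennreal \<bar>exp (- b * (\<Sum>i\<in>I - {k}. K y (x i))) - exp (- g * pot y)\<bar> \<partial>gibbs g b (I - {k})) \<le> ennreal r"
  shows "\<bar>(\<integral>x. (\<Prod>i\<in>S. p (x i)) \<partial>gibbs g b I) - (1 - (\<integral>y. 1 - p y \<partial>M)) ^ card S\<bar>
    \<le> real (card S) * (4 * (\<integral>y. 1 - p y \<partial>M) * (exp (g * C) * r))"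
proof -
  have "finite S" using I finite_subset by auto
  then show ?thesis using I(2)
  proof induction
    case empty
    interpret G: prob_space "gibbs g b I" by (rule prob_space_gibbs) (use gb I in auto)
    show ?case by (simp add: G.prob_space)
  next
    case (insert k S)
    let ?\<eta> = "\<integral>y. 1 - p y \<partial>M"
    let ?A = "\<lambda>S. (\<integral>x. (\<Prod>i\<in>S. p (x i)) \<partial>gibbs g b I)"
    have pint: "integrable M p" by (rule integrable_const_bound[where B=1]) (auto simp: p01)
    have "0 \<le> ?\<eta>" by (intro Bochner_Integration.integral_nonneg) (simp add: p01)
    moreover have "?\<eta> = 1 - (\<integral>y. p y \<partial>M)" using pint by simp
    moreover have "0 \<le> (\<integral>y. p y \<partial>M)" by (intro Bochner_Integration.integral_nonneg) (simp add: p01)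
    ultimately have \<eta>: "0 \<le> 1 - ?\<eta>" "1 - ?\<eta> \<le> 1" by auto
    have Ik: "insert k (I - {k}) = I" using insert by auto
    have "\<bar>?A (insert k S) - (1 - ?\<eta>) * ?A S\<bar> \<le> 4 * ?\<eta> * (exp (g * C) * r)"
    proof (rule gibbs_product_step[where k=k and J="I - {k}" and S=S, unfolded Ik])
      show "S \<subseteq> I - {k}" using insert by auto
      show "(\<integral>\<^sup>+x. ennreal \<bar>exp (- b * (\<Sum>i\<in>I - {k}. K y (x i))) - exp (- g * pot y)\<bar> \<partial>gibbs g b (I - {k})) \<le> ennreal r" for y
        using insert by (intro cavity) auto
    qed (use I(1) gb p01 r in simp_all)
    moreover have "\<bar>(1 - ?\<eta>) * ?A S - (1 - ?\<eta>) * (1 - ?\<eta>) ^ card S\<bar> \<le> \<bar>?A S - (1 - ?\<eta>) ^ card S\<bar>"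
      unfolding right_diff_distrib[symmetric] abs_mult using \<eta> by (simp add: mult_left_le_one_le)
    moreover have "\<bar>?A S - (1 - ?\<eta>) ^ card S\<bar> \<le> real (card S) * (4 * ?\<eta> * (exp (g * C) * r))"
      using insert by auto
    ultimately have "\<bar>?A (insert k S) - (1 - ?\<eta>) * (1 - ?\<eta>) ^ card S\<bar> \<le>
      real (card S) * (4 * ?\<eta> * (exp (g * C) * r)) + 4 * ?\<eta> * (exp (g * C) * r)"
      by linarith
    then show ?case using insert(1,2) by (simp add: algebra_simps)
  qed
qed

lemma gibbs_product_limit:
  assumes g: "0 \<le> g" and b: "\<And>N. 0 \<le> b N" and lim: "(\<lambda>N. real N * b N) \<longlonglongrightarrow> g"
    and p [measurable]: "\<And>N. p N \<in> borel_measurable borel" and p01: "\<And>N y. 0 \<le> p N y" "\<And>N y. p N y \<le> 1"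
    and \<kappa>: "(\<lambda>N. real N * (\<integral>y. 1 - p N y \<partial>M)) \<longlonglongrightarrow> \<kappa>"
  shows "(\<lambda>N. \<integral>x. (\<Prod>i\<in>{1..N}. p N (x i)) \<partial>gibbs g (b N) {1..N}) \<longlonglongrightarrow> exp (- \<kappa>)"
proof -
  define \<eta> where "\<eta> N = (\<integral>y. 1 - p N y \<partial>M)" for N
  have b0: "b \<longlonglongrightarrow> 0"
    by (rule tendsto_zero_if_times_n[of b g]) (use lim in \<open>simp add: mult.commute\<close>)
  \<comment> \<open>The cavity of \<open>Suc N\<close> points has \<open>N\<close> points but keeps
    the coupling \<open>b (Suc N)\<close>; their product still tends to \<open>g\<close>.\<close>
  have "(\<lambda>N. real (Suc N) * b (Suc N) - b (Suc N)) \<longlonglongrightarrow> g - 0"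
    by (intro tendsto_diff LIMSEQ_Suc lim b0)
  then have lim': "(\<lambda>N. b (Suc N) * real N) \<longlonglongrightarrow> g"
    by (simp add: algebra_simps)
  have \<eta>01: "0 \<le> \<eta> N" "\<eta> N \<le> 1" for N
  proof -
    have pint: "integrable M (p N)" by (rule integrable_const_bound[where B=1]) (auto simp: p01)
    show "0 \<le> \<eta> N" unfolding \<eta>_def by (intro Bochner_Integration.integral_nonneg) (simp add: p01)
    have "0 \<le> (\<integral>y. p N y \<partial>M)" by (intro Bochner_Integration.integral_nonneg) (simp add: p01)
    then show "\<eta> N \<le> 1" unfolding \<eta>_def using pint by simp
  qed
  have k0: "0 \<le> \<kappa>"
    by (rule LIMSEQ_le_const[OF \<kappa>]) (use \<eta>01 in \<open>auto simp: \<eta>_def\<close>)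
  have pow: "(\<lambda>N. (1 - \<eta> N) ^ N) \<longlonglongrightarrow> exp (- \<kappa>)"
  proof -
    have e: "(\<lambda>N. (1 + (- \<kappa>) / real N) ^ N) \<longlonglongrightarrow> exp (- \<kappa>)"
      by (rule tendsto_exp_limit_sequentially)
    have "(\<lambda>N. (1 - \<eta> N) ^ N - (1 + (- \<kappa>) / real N) ^ N) \<longlonglongrightarrow> 0"
    proof (rule Lim_null_comparison)
      show "(\<lambda>N. \<bar>real N * \<eta> N - \<kappa>\<bar>) \<longlonglongrightarrow> 0"
        using \<kappa> unfolding \<eta>_def[symmetric] by (simp add: LIM_zero_iff tendsto_rabs_zero_iff)
      \<comment> \<open>Beyond \<open>N0\<close> the base \<open>1 - \<kappa> / N\<close> lies in
        the unit interval, where \<open>norm_power_diff\<close> applies.\<close>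
      obtain N0 :: nat where N0: "\<kappa> < real N0" using reals_Archimedean2 by blast
      show "\<forall>\<^sub>F N in sequentially. norm ((1 - \<eta> N) ^ N - (1 + (- \<kappa>) / real N) ^ N) \<le> \<bar>real N * \<eta> N - \<kappa>\<bar>"
        using eventually_gt_at_top[of N0]
      proof eventually_elim
        case (elim N)
        then have N: "0 < real N" "\<kappa> < real N" using N0 k0 by auto
        have "norm ((1 - \<eta> N) ^ N - (1 + (- \<kappa>) / real N) ^ N) \<le> real N * norm ((1 - \<eta> N) - (1 + (- \<kappa>) / real N))"
          using \<eta>01[of N] N k0 by (intro norm_power_diff) (auto simp: field_simps)
        also have "\<dots> = \<bar>real N * ((1 - \<eta> N) - (1 + (- \<kappa>) / real N))\<bar>" by (simp add: abs_mult)
        also have "real N * ((1 - \<eta> N) - (1 + (- \<kappa>) / real N)) = \<kappa> - real N * \<eta> N" using N by (simp add: field_simps)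
        finally show ?case by (simp add: abs_minus_commute)
      qed
    qed
    from tendsto_add[OF this e] show ?thesis by simp
  qed
  have "(\<lambda>N. (\<integral>x. (\<Prod>i\<in>{1..N}. p N (x i)) \<partial>gibbs g (b N) {1..N}) - (1 - \<eta> N) ^ N) \<longlonglongrightarrow> 0"
  proof (rule tendstoI)
    fix \<epsilon> :: real assume \<epsilon>: "0 < \<epsilon>"
    \<comment> \<open>Eventually \<open>N * \<eta> N < \<kappa> + 1\<close>, so this choice makes
      the total error of \<open>gibbs_product\<close> at most
      \<open>\<epsilon> * (\<kappa> + 1) / (\<kappa> + 2)\<close>, which is strictly below
      \<open>\<epsilon>\<close>. The cap 1/2 is what \<open>gibbs_product_step\<close> asks
      for.\<close>
    define r where "r = min (1 / 2) (\<epsilon> / (4 * (\<kappa> + 2))) / exp (g * C)"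
    have r0: "0 < r" using \<epsilon> k0 by (simp add: r_def)
    have r1: "exp (g * C) * r \<le> 1 / 2" "exp (g * C) * r \<le> \<epsilon> / (4 * (\<kappa> + 2))" 
    proof -
      have *: "exp (g * C) * r = min (1 / 2) (\<epsilon> / (4 * (\<kappa> + 2)))" by (simp add: r_def)
      show "exp (g * C) * r \<le> 1 / 2" "exp (g * C) * r \<le> \<epsilon> / (4 * (\<kappa> + 2))"
        unfolding * by (rule min.cobounded1, rule min.cobounded2)
    qed
    have "\<forall>\<^sub>F N in sequentially. \<forall>I::nat set. finite I \<longrightarrow> card I = N \<longrightarrow>
      (\<forall>y. (\<integral>\<^sup>+x. ennreal \<bar>exp (- b (Suc N) * (\<Sum>i\<in>I. K y (x i))) - exp (- g * pot y)\<bar> \<partial>gibbs g (b (Suc N)) I) \<le> ennreal r)"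
      by (rule cavity_limit) (use g b lim' r0 in auto)
    moreover have "\<forall>\<^sub>F N in sequentially. real (Suc N) * \<eta> (Suc N) < \<kappa> + 1"
      using LIMSEQ_Suc[OF \<kappa>] unfolding \<eta>_def[symmetric] by (rule order_tendstoD) simp
    ultimately have "\<forall>\<^sub>F N in sequentially. dist ((\<integral>x. (\<Prod>i\<in>{1..Suc N}. p (Suc N) (x i)) \<partial>gibbs g (b (Suc N)) {1..Suc N}) - (1 - \<eta> (Suc N)) ^ Suc N) 0 < \<epsilon>"
    proof eventually_elim
      case (elim N)
      have "\<bar>(\<integral>x. (\<Prod>i\<in>{1..Suc N}. p (Suc N) (x i)) \<partial>gibbs g (b (Suc N)) {1..Suc N}) - (1 - \<eta> (Suc N)) ^ card {1..Suc N}\<bar>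
         \<le> real (card {1..Suc N}) * (4 * \<eta> (Suc N) * (exp (g * C) * r))"
        unfolding \<eta>_def
      proof (rule gibbs_product)
        fix k y assume "k \<in> {1..Suc N}"
        then have "card ({1..Suc N} - {k}) = N" by simp
        then show "(\<integral>\<^sup>+x. ennreal \<bar>exp (- b (Suc N) * (\<Sum>i\<in>{1..Suc N} - {k}. K y (x i))) - exp (- g * pot y)\<bar> \<partial>gibbs g (b (Suc N)) ({1..Suc N} - {k})) \<le> ennreal r"
          using elim(1) by auto
      qed (use g b p01 r0 r1 in auto)
      also have "\<dots> = (4 * (exp (g * C) * r)) * (real (Suc N) * \<eta> (Suc N))" by simp
      also have "\<dots> \<le> (4 * (\<epsilon> / (4 * (\<kappa> + 2)))) * (\<kappa> + 1)"
        using r0 r1 elim(2) \<eta>01 \<epsilon> k0 by (intro mult_mono) auto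
      also have "\<dots> < \<epsilon>" using \<epsilon> k0 by (simp add: field_simps)
      finally show ?case by (simp add: dist_real_def)
    qed
    then show "\<forall>\<^sub>F N in sequentially. dist ((\<integral>x. (\<Prod>i\<in>{1..N}. p N (x i)) \<partial>gibbs g (b N) {1..N}) - (1 - \<eta> N) ^ N) 0 < \<epsilon>"
      by (rule eventually_sequentially_Suc[THEN iffD1])
  qed
  from tendsto_add[OF this pow] show ?thesis by simp
qed


section \<open>The mean-field equation\<close>

definition bd :: "('a \<Rightarrow> real) \<Rightarrow> bool" where
  "bd f \<longleftrightarrow> f \<in> borel_measurable borel \<and> (\<exists>B. \<forall>x. \<bar>f x\<bar> \<le> B)"

lemma bd_measurable: "bd f \<Longrightarrow> f \<in> borel_measurable borel"
  by (simp add: bd_def)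

lemma bdI: "f \<in> borel_measurable borel \<Longrightarrow> (\<And>x. \<bar>f x\<bar> \<le> B) \<Longrightarrow> bd f"
  by (auto simp: bd_def)

lemma bdE: assumes "bd f" obtains B where "0 \<le> B" "\<And>x. \<bar>f x\<bar> \<le> B"
  using assms unfolding bd_def by (meson abs_ge_zero order_trans)

lemma bd_const [simp]: "bd (\<lambda>_. c)"
  by (rule bdI[of _ "\<bar>c\<bar>"]) auto

lemma bd_mult [simp]: assumes "bd f" "bd h" shows "bd (\<lambda>x. f x * h x)"
proof -
  note [measurable] = bd_measurable[OF assms(1)] bd_measurable[OF assms(2)]
  obtain A where A: "0 \<le> A" "\<And>x. \<bar>f x\<bar> \<le> A" using assms(1) by (rule bdE) blast
  obtain B where B: "0 \<le> B" "\<And>x. \<bar>h x\<bar> \<le> B" using assms(2) by (rule bdE) blast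
  show ?thesis
    by (rule bdI[of _ "A * B"]) (use A B in \<open>auto simp: abs_mult intro!: mult_mono\<close>)
qed

lemma bd_add [simp]: assumes "bd f" "bd h" shows "bd (\<lambda>x. f x + h x)"
proof -
  note [measurable] = bd_measurable[OF assms(1)] bd_measurable[OF assms(2)]
  obtain A where A: "0 \<le> A" "\<And>x. \<bar>f x\<bar> \<le> A" using assms(1) by (rule bdE) blast
  obtain B where B: "0 \<le> B" "\<And>x. \<bar>h x\<bar> \<le> B" using assms(2) by (rule bdE) blast
  show ?thesis
    by (rule bdI[of _ "A + B"]) (auto intro: order_trans[OF abs_triangle_ineq add_mono[OF A(2) B(2)]])
qed

lemma bd_uminus [simp]: "bd f \<Longrightarrow> bd (\<lambda>x. - f x)"
  using bd_mult[of "\<lambda>_. - 1" f] by simp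

lemma bd_diff [simp]: "bd f \<Longrightarrow> bd h \<Longrightarrow> bd (\<lambda>x. f x - h x)"
  using bd_add[of f "\<lambda>x. - h x"] by simp

lemma bd_abs [simp]: "bd f \<Longrightarrow> bd (\<lambda>x. \<bar>f x\<bar>)"
  unfolding bd_def by auto

lemma bd_integrable [simp]: assumes "bd f" shows "integrable M f"
proof -
  note [measurable] = bd_measurable[OF assms]
  obtain B where "\<And>x. \<bar>f x\<bar> \<le> B" using assms by (rule bdE) blast
  then show ?thesis by (intro integrable_const_bound[where B=B]) auto
qed

text \<open>No sign is required, so that the truncation error \<open>K - Kt T\<close> is a kernel as
  well, with the small constant \<open>e T\<close>.\<close>

definition kernel :: "('a \<Rightarrow> 'a \<Rightarrow> real) \<Rightarrow> real \<Rightarrow> bool" where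
  "kernel k c \<longleftrightarrow> (\<lambda>(x, y). k x y) \<in> borel_measurable (borel \<Otimes>\<^sub>M borel) \<and> (\<forall>x y. k x y = k y x) \<and>
     (\<forall>x. (\<integral>\<^sup>+y. \<bar>k x y\<bar> \<partial>M) \<le> ennreal c) \<and> 0 \<le> c"

definition iop :: "('a \<Rightarrow> 'a \<Rightarrow> real) \<Rightarrow> ('a \<Rightarrow> real) \<Rightarrow> 'a \<Rightarrow> real" where
  "iop k f x = (\<integral>y. k x y * f y \<partial>M)"

definition form :: "('a \<Rightarrow> 'a \<Rightarrow> real) \<Rightarrow> ('a \<Rightarrow> real) \<Rightarrow> ('a \<Rightarrow> real) \<Rightarrow> real" where
  "form k f h = (\<integral>x. f x * iop k h x \<partial>M)"

lemma kernel_measurable: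
  "kernel k c \<Longrightarrow> f \<in> borel_measurable N \<Longrightarrow> g \<in> borel_measurable N \<Longrightarrow> (\<lambda>w. k (f w) (g w)) \<in> borel_measurable N"
  using measurable_compose[OF measurable_Pair[of f N borel g borel], of "\<lambda>(x, y). k x y" borel]
  by (simp add: kernel_def)

lemma kernel_integrable: "kernel k c \<Longrightarrow> integrable M (k x)"
proof (rule integrableI_bounded)
  assume k: "kernel k c"
  show "k x \<in> borel_measurable M" using kernel_measurable[OF k, of "\<lambda>_. x" M "\<lambda>y. y"] by simp
  have "(\<integral>\<^sup>+y. \<bar>k x y\<bar> \<partial>M) \<le> ennreal c" using k unfolding kernel_def by blast
  then show "(\<integral>\<^sup>+y. ennreal (norm (k x y)) \<partial>M) < \<infinity>"
    by (simp add: le_less_trans[OF _ ennreal_less_top])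
qed

lemma kernel_abs_integral: assumes "kernel k c" shows "(\<integral>y. \<bar>k x y\<bar> \<partial>M) \<le> c"
proof -
  have "(\<integral>\<^sup>+y. \<bar>k x y\<bar> \<partial>M) \<le> ennreal c" "0 \<le> c" using assms unfolding kernel_def by blast+
  then show ?thesis using kernel_integrable[OF assms, of x]
    by (subst (asm) nn_integral_eq_integral) auto
qed

lemma iop_integrable: assumes "kernel k c" "bd f" shows "integrable M (\<lambda>y. k x y * f y)"
proof -
  obtain B where B: "0 \<le> B" "\<And>x. \<bar>f x\<bar> \<le> B" using assms(2) by (rule bdE) blast
  show ?thesis
  proof (rule Bochner_Integration.integrable_bound)
    show "integrable M (\<lambda>y. B * k x y)" using kernel_integrable[OF assms(1)] by simp
    show "(\<lambda>y. k x y * f y) \<in> borel_measurable M"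
      using kernel_measurable[OF assms(1), of "\<lambda>_. x" M "\<lambda>y. y"] bd_measurable[OF assms(2)] by simp
    show "AE y in M. norm (k x y * f y) \<le> norm (B * k x y)"
      using B by (auto simp: abs_mult mult.commute[of B] intro!: mult_left_mono)
  qed
qed

lemma iop_bound: assumes "kernel k c" "bd f" "\<And>x. \<bar>f x\<bar> \<le> B" shows "\<bar>iop k f x\<bar> \<le> c * B"
proof -
  have B0: "0 \<le> B" using assms(3) abs_ge_zero order_trans by blast
  have "\<bar>iop k f x\<bar> \<le> (\<integral>y. \<bar>k x y * f y\<bar> \<partial>M)" unfolding iop_def by (rule integral_abs_bound)
  also have "\<dots> \<le> (\<integral>y. \<bar>k x y\<bar> * B \<partial>M)"
  proof (rule integral_mono)
    show "\<bar>k x y * f y\<bar> \<le> \<bar>k x y\<bar> * B" for y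
      unfolding abs_mult using assms(3) by (intro mult_left_mono) auto
  qed (use iop_integrable[OF assms(1,2)] kernel_integrable[OF assms(1)] in auto)
  also have "\<dots> = (\<integral>y. \<bar>k x y\<bar> \<partial>M) * B" by simp
  also have "\<dots> \<le> c * B" using kernel_abs_integral[OF assms(1)] B0 by (rule mult_right_mono)
  finally show ?thesis .
qed

lemma bd_iop [simp]: assumes "kernel k c" "bd f" shows "bd (iop k f)"
proof -
  obtain B where B: "0 \<le> B" "\<And>x. \<bar>f x\<bar> \<le> B" using assms(2) by (rule bdE) blast
  note [measurable] = bd_measurable[OF assms(2)] kernel_measurable[OF assms(1)]
  have "iop k f \<in> borel_measurable borel"
    unfolding iop_def[abs_def] by measurable
  then show ?thesis by (rule bdI) (rule iop_bound[OF assms B(2)])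
qed

lemma iop_add: "kernel k c \<Longrightarrow> bd f \<Longrightarrow> bd h \<Longrightarrow> iop k (\<lambda>y. a * f y + b * h y) x = a * iop k f x + b * iop k h x"
  using iop_integrable[of k c f x] iop_integrable[of k c h x]
  by (simp add: iop_def distrib_left mult.left_commute)

lemma form_sym: assumes k: "kernel k c" and "bd f" "bd h" shows "form k f h = form k h f"
proof -
  note [measurable] = bd_measurable[OF assms(2)] bd_measurable[OF assms(3)] kernel_measurable[OF assms(1)]
  obtain A where A: "0 \<le> A" "\<And>x. \<bar>f x\<bar> \<le> A" using assms(2) by (rule bdE) blast
  obtain B where B: "0 \<le> B" "\<And>x. \<bar>h x\<bar> \<le> B" using assms(3) by (rule bdE) blast
  interpret P: pair_sigma_finite M M ..
  let ?F = "\<lambda>x y. f x * (k x y * h y)"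
  have "integrable (M \<Otimes>\<^sub>M M) (\<lambda>(x, y). ?F x y)"
  proof (rule P.Fubini_integrable)
    show "(\<lambda>(x, y). ?F x y) \<in> borel_measurable (M \<Otimes>\<^sub>M M)" by measurable
    show "AE x in M. integrable M (\<lambda>y. case (x, y) of (x, y) \<Rightarrow> ?F x y)"
      using iop_integrable[OF k assms(3)] by simp
    have *: "(\<integral>y. \<bar>?F x y\<bar> \<partial>M) \<le> A * (c * B)" for x
    proof -
      have "(\<integral>y. \<bar>?F x y\<bar> \<partial>M) \<le> (\<integral>y. A * (\<bar>k x y\<bar> * B) \<partial>M)"
      proof (rule integral_mono)
        show "\<bar>?F x y\<bar> \<le> A * (\<bar>k x y\<bar> * B)" for y
          unfolding abs_mult using A B by (intro mult_mono mult_left_mono) auto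
      qed (use iop_integrable[OF k assms(3)] kernel_integrable[OF k] in auto)
      also have "\<dots> = A * ((\<integral>y. \<bar>k x y\<bar> \<partial>M) * B)" by simp
      also have "\<dots> \<le> A * (c * B)"
        using kernel_abs_integral[OF k] A B by (intro mult_left_mono mult_right_mono) auto
      finally show ?thesis .
    qed
    show "integrable M (\<lambda>x. \<integral>y. norm (case (x, y) of (x, y) \<Rightarrow> ?F x y) \<partial>M)"
      by (rule integrable_const_bound[where B="A * (c * B)"]) (use * in auto)
  qed
  then have "(\<integral>y. (\<integral>x. ?F x y \<partial>M) \<partial>M) = (\<integral>x. (\<integral>y. ?F x y \<partial>M) \<partial>M)"
    by (rule P.Fubini_integral)
  moreover have "(\<integral>x. ?F x y \<partial>M) = h y * iop k f y" for y
  proof -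
    have "(\<integral>x. ?F x y \<partial>M) = (\<integral>x. h y * (k y x * f x) \<partial>M)"
      using k by (intro Bochner_Integration.integral_cong) (auto simp: kernel_def mult_ac)
    then show ?thesis by (simp add: iop_def)
  qed
  moreover have "(\<integral>y. ?F x y \<partial>M) = f x * iop k h x" for x
    by (simp add: iop_def)
  ultimately show ?thesis unfolding form_def by (simp only:)
qed

lemma form_lin_right:
  assumes "kernel k c" "bd f" "bd h" "bd w"
  shows "form k w (\<lambda>y. a * f y + b * h y) = a * form k w f + b * form k w h"
proof -
  have "form k w (\<lambda>y. a * f y + b * h y) = (\<integral>x. a * (w x * iop k f x) + b * (w x * iop k h x) \<partial>M)"
    unfolding form_def using assms
    by (intro Bochner_Integration.integral_cong) (auto simp: iop_add algebra_simps)
  also have "\<dots> = a * form k w f + b * form k w h"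
    unfolding form_def using assms by simp
  finally show ?thesis .
qed

lemma form_quadratic:
  assumes "kernel k c" "bd f" "bd h"
  shows "form k (\<lambda>y. a * f y + b * h y) (\<lambda>y. a * f y + b * h y) =
    a\<^sup>2 * form k f f + 2 * a * b * form k f h + b\<^sup>2 * form k h h"
proof -
  let ?w = "\<lambda>y. a * f y + b * h y"
  have w: "bd ?w" using assms by simp
  have "form k ?w ?w = a * form k f ?w + b * form k h ?w"
    using form_lin_right[OF assms w] form_sym[OF assms(1) w] assms by simp
  also have "\<dots> = a * (a * form k f f + b * form k f h) + b * (a * form k h f + b * form k h h)"
    using assms by (simp add: form_lin_right)
  also have "form k h f = form k f h" using assms by (intro form_sym)
  finally show ?thesis by (simp add: algebra_simps power2_eq_square)
qed

lemma kernel_K: "kernel K C"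
  using K_pot by (auto simp: kernel_def K_borel K_nonneg C_nonneg intro: K_sym)

lemma kernel_Kt: "kernel (Kt T) C"
  unfolding kernel_def
  using pott_le_pot pot_le order_trans[OF pott_le_pot pot_le]
  by (auto simp: Kt_borel Kt_nonneg C_nonneg nn_integral_Kt intro: Kt_sym intro!: ennreal_leI)

lemma kernel_diff: "kernel (\<lambda>x y. K x y - Kt T x y) (e T)"
  unfolding kernel_def using Kt_approx by (auto simp: e_nonneg K_sym[of _ "_ :: 'a"] Kt_sym[of T _ "_ :: 'a"])

text \<open>The assumption \<open>psd\<close> speaks of two positive measures; here they have the
  densities \<open>max 0 f\<close> and \<open>max 0 (- f)\<close> with respect to
  \<open>M\<close>.\<close>

lemma form_Kt_nonneg: assumes f: "bd f" shows "0 \<le> form (Kt T) f f"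
proof -
  define p where "p x = max 0 (f x)" for x
  define n where "n x = max 0 (- f x)" for x
  have [measurable]: "f \<in> borel_measurable borel" using f by (rule bd_measurable)
  obtain B where B: "0 \<le> B" "\<And>x. \<bar>f x\<bar> \<le> B" using f by (rule bdE) blast
  have bd: "bd p" "bd n"
    by (rule bdI[of _ B]; use B in \<open>auto simp: p_def[abs_def] n_def[abs_def] abs_le_iff\<close>)+
  note [measurable] = bd_measurable[OF bd(1)] bd_measurable[OF bd(2)]
  have pn: "0 \<le> p x" "0 \<le> n x" for x by (auto simp: p_def n_def)
  have fe: "f = (\<lambda>x. 1 * p x + (- 1) * n x)" by (auto simp: p_def n_def)
  have nn: "(\<integral>\<^sup>+x. \<integral>\<^sup>+y. Kt T x y \<partial>density M (\<lambda>y. ennreal (v y)) \<partial>density M (\<lambda>x. ennreal (w x))) = ennreal (form (Kt T) w v)"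
    if v: "bd v" "\<And>x. 0 \<le> v x" and w: "bd w" "\<And>x. 0 \<le> w x" for v w
  proof -
    note [measurable] = bd_measurable[OF v(1)] bd_measurable[OF w(1)]
    have iop0: "0 \<le> iop (Kt T) v x" for x unfolding iop_def by (simp add: Kt_nonneg v)
    have "(\<integral>\<^sup>+y. Kt T x y \<partial>density M (\<lambda>y. ennreal (v y))) = ennreal (iop (Kt T) v x)" for x
    proof -
      have "(\<integral>\<^sup>+y. Kt T x y \<partial>density M (\<lambda>y. ennreal (v y))) = (\<integral>\<^sup>+y. ennreal (Kt T x y * v y) \<partial>M)"
        by (subst nn_integral_density) (auto simp: ennreal_mult[symmetric] Kt_nonneg v mult.commute)
      also have "\<dots> = ennreal (iop (Kt T) v x)"
        unfolding iop_def by (rule nn_integral_eq_integral[OF iop_integrable[OF kernel_Kt v(1)]]) (auto simp: Kt_nonneg v)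
      finally show ?thesis .
    qed
    then have "(\<integral>\<^sup>+x. \<integral>\<^sup>+y. Kt T x y \<partial>density M (\<lambda>y. ennreal (v y)) \<partial>density M (\<lambda>x. ennreal (w x))) =
      (\<integral>\<^sup>+x. ennreal (iop (Kt T) v x) \<partial>density M (\<lambda>x. ennreal (w x)))" by simp
    also have "\<dots> = (\<integral>\<^sup>+x. ennreal (w x * iop (Kt T) v x) \<partial>M)"
      using bd_measurable[OF bd_iop[OF kernel_Kt v(1)], of T]
      by (subst nn_integral_density) (auto simp: ennreal_mult[symmetric] iop0 w)
    also have "\<dots> = ennreal (form (Kt T) w v)"
      unfolding form_def by (rule nn_integral_eq_integral) (auto simp: iop0 w v bd_iop[OF kernel_Kt])
    finally show ?thesis .
  qed
  have fin: "finite_measure (density M (\<lambda>x. ennreal (v x)))" if v: "bd v" "\<And>x. 0 \<le> v x" for v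
  proof (rule finite_measureI)
    note [measurable] = bd_measurable[OF v(1)]
    have "emeasure (density M (\<lambda>x. ennreal (v x))) UNIV = (\<integral>\<^sup>+x. ennreal (v x) \<partial>M)"
      by (subst emeasure_density) (auto simp: sets_M)
    also have "\<dots> = ennreal (\<integral>x. v x \<partial>M)" by (rule nn_integral_eq_integral) (use v in auto)
    finally show "emeasure (density M (\<lambda>x. ennreal (v x))) (space (density M (\<lambda>x. ennreal (v x)))) \<noteq> \<infinity>" by simp
  qed
  have f0: "0 \<le> form (Kt T) w v" if "bd v" "\<And>x. 0 \<le> v x" "\<And>x. 0 \<le> w x" for v w
    unfolding form_def iop_def by (intro Bochner_Integration.integral_nonneg mult_nonneg_nonneg that Kt_nonneg)
  have "2 * ennreal (form (Kt T) p n) \<le> ennreal (form (Kt T) p p) + ennreal (form (Kt T) n n)"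
    using psd[OF fin[OF bd(1) pn(1)] fin[OF bd(2) pn(2)], of T] bd pn by (simp add: nn sets_M)
  then have "ennreal (2 * form (Kt T) p n) \<le> ennreal (form (Kt T) p p + form (Kt T) n n)"
    using bd pn by (simp add: ennreal_mult f0)
  then have "2 * form (Kt T) p n \<le> form (Kt T) p p + form (Kt T) n n"
    using bd pn f0 by (subst (asm) ennreal_le_iff) auto
  then show ?thesis
    by (subst (1 2) fe, subst form_quadratic[OF kernel_Kt bd]) simp
qed

text \<open>The sign survives the limit to the singular kernel: for \<open>f\<close> bounded by
  \<open>B\<close>, the forms of \<open>K\<close> and \<open>Kt T\<close> differ by at most
  \<open>e T * B * B\<close>.\<close>

lemma form_nonneg: assumes f: "bd f" shows "0 \<le> form K f f"
proof -
  obtain B where B: "0 \<le> B" "\<And>x. \<bar>f x\<bar> \<le> B" using f by (rule bdE) blast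
  have "- (e T * B * B) \<le> form K f f" for T
  proof -
    have "form K f f - form (Kt T) f f = (\<integral>x. f x * iop (\<lambda>x y. K x y - Kt T x y) f x \<partial>M)"
    proof -
      have "iop (\<lambda>x y. K x y - Kt T x y) f x = iop K f x - iop (Kt T) f x" for x
        using iop_integrable[OF kernel_K f, of x] iop_integrable[OF kernel_Kt f, of T x]
        by (simp add: iop_def left_diff_distrib)
      then show ?thesis unfolding form_def using f bd_iop[OF kernel_K f] bd_iop[OF kernel_Kt f]
        by (simp add: right_diff_distrib)
    qed
    also have "\<bar>\<dots>\<bar> \<le> (\<integral>x. \<bar>f x * iop (\<lambda>x y. K x y - Kt T x y) f x\<bar> \<partial>M)" by (rule integral_abs_bound)
    also have "\<dots> \<le> (\<integral>x. B * (e T * B) \<partial>M)"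
      using f bd_iop[OF kernel_diff f] iop_bound[OF kernel_diff f B(2), of T] B
      by (intro integral_mono) (auto simp: abs_mult intro!: mult_mono)
    finally show ?thesis using form_Kt_nonneg[OF f, of T] by (simp add: mult_ac)
  qed
  moreover have "(\<lambda>T. - (e T * B * B)) \<longlonglongrightarrow> - (0 * B * B)"
    by (intro tendsto_intros e_tendsto)
  ultimately have "- (0 * B * B) \<le> form K f f" by (intro LIMSEQ_le_const2[where X="\<lambda>T. - (e T * B * B)"]) auto
  then show ?thesis by simp
qed

text \<open>Schur's test: \<open>f x * f y \<le> ((f x)\<^sup>2 + (f y)\<^sup>2) / 2\<close> and the symmetry of the kernel.\<close>

lemma form_le: assumes f: "bd f" shows "form K f f \<le> C * (\<integral>x. (f x)\<^sup>2 \<partial>M)"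
proof -
  let ?s = "\<lambda>x. (f x)\<^sup>2"
  have s: "bd ?s" using bd_mult[OF f f] by (simp add: power2_eq_square)
  note b = bd_iop[OF kernel_K]
  have pot: "pot = iop K (\<lambda>_. 1)" by (auto simp: iop_def pot_def)
  have "form K f f \<le> (\<integral>x. (1 / 2) * (?s x * pot x) + (1 / 2) * (1 * iop K ?s x) \<partial>M)"
    unfolding form_def
  proof (rule integral_mono)
    show "f x * iop K f x \<le> (1 / 2) * (?s x * pot x) + (1 / 2) * (1 * iop K ?s x)" for x
    proof -
      have "f x * iop K f x = (\<integral>y. f x * (K x y * f y) \<partial>M)" by (simp add: iop_def)
      also have "\<dots> \<le> (\<integral>y. (1 / 2) * ?s x * K x y + (1 / 2) * (K x y * ?s y) \<partial>M)"
      proof (rule integral_mono)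
        show "f x * (K x y * f y) \<le> (1 / 2) * ?s x * K x y + (1 / 2) * (K x y * ?s y)" for y
        proof -
          have "f x * f y \<le> (?s x + ?s y) / 2" using sum_squares_bound[of "f x" "f y"] by simp
          then have "K x y * (f x * f y) \<le> K x y * ((?s x + ?s y) / 2)" by (rule mult_left_mono) (rule K_nonneg)
          then show ?thesis by (simp add: algebra_simps)
        qed
      qed (use iop_integrable[OF kernel_K f] iop_integrable[OF kernel_K s] in auto)
      also have "\<dots> = (1 / 2) * (?s x * pot x) + (1 / 2) * (1 * iop K ?s x)"
        using iop_integrable[OF kernel_K s, of x] by (simp add: iop_def pot_def)
      finally show ?thesis .
    qed
  qed (use f s b[OF f] b[OF s] b[of "\<lambda>_. 1"] in \<open>auto simp: pot\<close>)
  also have "\<dots> = (1 / 2) * form K ?s (\<lambda>_. 1) + (1 / 2) * form K (\<lambda>_. 1) ?s"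
    unfolding form_def pot using f s b[OF f] b[OF s] b[of "\<lambda>_. 1"] by simp
  also have "form K (\<lambda>_. 1) ?s = form K ?s (\<lambda>_. 1)" by (rule form_sym[OF kernel_K]) (use s in auto)
  also have "(1 / 2) * form K ?s (\<lambda>_. 1) + (1 / 2) * form K ?s (\<lambda>_. 1) = (\<integral>x. ?s x * pot x \<partial>M)"
    by (simp add: form_def pot)
  also have "\<dots> \<le> (\<integral>x. ?s x * C \<partial>M)"
    using s b[of "\<lambda>_. 1"] by (intro integral_mono mult_left_mono pot_le) (auto simp: pot)
  finally show ?thesis by (simp add: mult.commute)
qed


section \<open>The fixed-point map and its damped iteration\<close>

definition mfZ :: "real \<Rightarrow> ('a \<Rightarrow> real) \<Rightarrow> real" where
  "mfZ g u = (\<integral>x. exp (- g * iop K u x) \<partial>M)"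

text \<open>Densities here are relative to \<open>M\<close>, which is the normalized
  \<open>exp (- V)\<close> when the equation is solved in
  \<open>riesz_mean_field_density\<close>.\<close>

definition mf :: "real \<Rightarrow> ('a \<Rightarrow> real) \<Rightarrow> 'a \<Rightarrow> real" where
  "mf g u x = exp (- g * iop K u x) / mfZ g u"

text \<open>The upper bound \<open>exp (g * C)\<close> is the one that \<open>mf\<close> reproduces:
  its numerator is at most 1 and its normalization at least \<open>exp (- g * C)\<close>.\<close>

definition pdens :: "real \<Rightarrow> ('a \<Rightarrow> real) \<Rightarrow> bool" where
  "pdens g u \<longleftrightarrow> u \<in> borel_measurable borel \<and> (\<forall>x. 0 \<le> u x \<and> u x \<le> exp (g * C)) \<and> (\<integral>x. u x \<partial>M) = 1"

lemma pdens_bd: "pdens g u \<Longrightarrow> bd u"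
  by (rule bdI[of _ "exp (g * C)"]) (auto simp: pdens_def)

lemma iop_K_nonneg: "(\<And>x. 0 \<le> u x) \<Longrightarrow> 0 \<le> iop K u x"
  unfolding iop_def by (simp add: K_nonneg)

lemma bd_exp_iop:
  assumes "bd u" "\<And>x. 0 \<le> u x" "0 \<le> g"
  shows "bd (\<lambda>x. exp (- g * iop K u x))"
proof (rule bdI[of _ 1])
  show "(\<lambda>x. exp (- g * iop K u x)) \<in> borel_measurable borel"
    using bd_measurable[OF bd_iop[OF kernel_K assms(1)]] by measurable
qed (use assms in \<open>simp add: iop_K_nonneg\<close>)

text \<open>The lower bound is Jensen's inequality: by symmetry of the form, the mean of
  \<open>iop K u\<close> under \<open>M\<close> equals the mean of \<open>pot\<close> with weight
  \<open>u\<close>, which is at most \<open>C\<close>.\<close>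

lemma mfZ_bounds:
  assumes u: "pdens g u" and g: "0 \<le> g"
  shows "exp (- g * C) \<le> mfZ g u" "mfZ g u \<le> 1" "0 < mfZ g u"
proof -
  have bu: "bd u" and u0: "\<And>x. 0 \<le> u x" and u1: "(\<integral>x. u x \<partial>M) = 1"
    using u pdens_bd by (auto simp: pdens_def)
  note i = bd_iop[OF kernel_K bu] bd_exp_iop[OF bu u0 g]
  have "mfZ g u \<le> (\<integral>x. 1 \<partial>M)"
    unfolding mfZ_def by (rule integral_mono) (use i g u0 in \<open>auto simp: iop_K_nonneg\<close>)
  then show "mfZ g u \<le> 1" by simp
  have pot: "pot = iop K (\<lambda>_. 1)" by (auto simp: iop_def pot_def)
  have "(\<integral>x. iop K u x \<partial>M) = form K (\<lambda>_. 1) u" by (simp add: form_def)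
  also have "\<dots> = form K u (\<lambda>_. 1)" by (rule form_sym[OF kernel_K]) (use bu in auto)
  also have "\<dots> \<le> (\<integral>x. u x * C \<partial>M)"
    unfolding form_def pot[symmetric] using bu bd_iop[OF kernel_K bd_const, of 1]
    by (intro integral_mono mult_left_mono u0 pot_le) (auto simp: pot)
  also have "\<dots> = C" using u1 by simp
  finally have *: "(\<integral>x. iop K u x \<partial>M) \<le> C" .
  have "exp (- g * C) \<le> exp (- g * C) * (1 + - g * (\<integral>x. iop K u x \<partial>M) - - g * C)"
    using mult_left_mono[OF * g] by (simp add: mult_le_cancel_left1)
  also have "\<dots> = (\<integral>x. exp (- g * C) * (1 + - g * iop K u x - - g * C) \<partial>M)"
    using i by simp
  also have "\<dots> \<le> mfZ g u"
    unfolding mfZ_def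
  proof (rule integral_mono)
    show "exp (- g * C) * (1 + - g * iop K u x - - g * C) \<le> exp (- g * iop K u x)" for x
      by (rule exp_ge_tangent)
  qed (use i in auto)
  finally show 1: "exp (- g * C) \<le> mfZ g u" .
  show "0 < mfZ g u" by (rule less_le_trans[OF exp_gt_zero 1])
qed

lemma mf_pdens:
  assumes u: "pdens g u" and g: "0 \<le> g"
  shows "pdens g (mf g u)" "0 < mf g u x"
proof -
  have bu: "bd u" and u0: "\<And>x. 0 \<le> u x"
    using u pdens_bd by (auto simp: pdens_def)
  note i = bd_exp_iop[OF bu u0 g] and Z = mfZ_bounds[OF u g]
  have "mf g u x \<le> exp (g * C)" for x
  proof -
    have "exp (- g * iop K u x) \<le> 1" using g u0 by (simp add: iop_K_nonneg)
    also have "1 \<le> exp (g * C) * mfZ g u"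
      using mult_left_mono[OF Z(1), of "exp (g * C)"] by (simp add: exp_minus)
    finally show ?thesis using Z(3) by (simp add: mf_def pos_divide_le_eq)
  qed
  then show "pdens g (mf g u)"
    unfolding pdens_def using Z bd_measurable[OF i] by (auto simp: mf_def[abs_def] mfZ_def)
  show "0 < mf g u x" using Z by (simp add: mf_def)
qed

text \<open>The map \<open>mf\<close> is decreasing in the sense of the positive definite form of the kernel, so a
  damped iteration contracts that form although \<open>mf\<close> itself need not be a contraction.\<close>

lemma mf_damped_step:
  fixes u :: "'a \<Rightarrow> real"
  assumes u: "pdens g u" and g: "0 \<le> g"
  defines "B \<equiv> exp (g * C)"
  defines "\<tau> \<equiv> 1 / (2 + g * C * B)"
  defines "d \<equiv> \<lambda>x. mf g u x - u x"
  defines "u' \<equiv> \<lambda>x. u x + \<tau> * d x"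
  defines "D \<equiv> \<lambda>x. mf g u' x - mf g u x"
  defines "d' \<equiv> \<lambda>x. mf g u' x - u' x"
  shows "pdens g u'" "d' x = (1 - \<tau>) * d x + D x"
    "g * form K d' d' + (\<integral>x. (D x)\<^sup>2 \<partial>M) / B \<le> (1 - \<tau>)\<^sup>2 * (g * form K d d)"
proof -
  have B1: "1 \<le> B" using g C_nonneg by (simp add: B_def)
  have gCB: "0 \<le> g * C * B" using g C_nonneg B1 by simp
  have \<tau>: "0 < \<tau>" "\<tau> \<le> 1 / 2" using gCB by (auto simp: \<tau>_def divide_simps)
  have pT: "pdens g (mf g u)" by (rule mf_pdens[OF u g])
  have bu: "bd u" "bd (mf g u)" using u pT pdens_bd by auto
  have bdd: "bd d" unfolding d_def using bu by simp
  have u'eq: "u' x = (1 - \<tau>) * u x + \<tau> * mf g u x" for x by (simp add: u'_def d_def algebra_simps)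
  have bu': "bd u'" unfolding u'_def using bdd bu by simp
  show pu': "pdens g u'"
    unfolding pdens_def
  proof (intro conjI allI)
    show "u' \<in> borel_measurable borel" using bu' by (rule bd_measurable)
    fix x
    have 0: "0 \<le> u x" "u x \<le> B" "0 \<le> mf g u x" "mf g u x \<le> B" using u pT by (auto simp: pdens_def B_def)
    show "0 \<le> u' x" unfolding u'eq using 0 \<tau> by (intro add_nonneg_nonneg mult_nonneg_nonneg) auto
    have "u' x \<le> (1 - \<tau>) * B + \<tau> * B" unfolding u'eq using 0 \<tau> by (intro add_mono mult_left_mono) auto
    then show "u' x \<le> exp (g * C)" by (simp add: algebra_simps B_def)
  next
    show "(\<integral>x. u' x \<partial>M) = 1" unfolding u'eq using u pT bu by (simp add: pdens_def)
  qed
  have pT': "pdens g (mf g u')" by (rule mf_pdens[OF pu' g])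
  have bT': "bd (mf g u')" using pT' by (rule pdens_bd)
  have bD: "bd D" unfolding D_def using bT' bu by simp
  show d'x: "d' x = (1 - \<tau>) * d x + D x" for x
    by (simp add: d'_def u'_def d_def D_def algebra_simps)
  note i = bd_iop[OF kernel_K]
  have D0: "(\<integral>x. D x \<partial>M) = 0"
    unfolding D_def using pT pT' bT' bu by (simp add: pdens_def)
  \<comment> \<open>Taking logarithms makes \<open>mf\<close> affine in the potential, up to this
    constant. It disappears after multiplication by \<open>D\<close> and integration, because
    \<open>D\<close> has mean 0.\<close>
  define c where "c = ln (mfZ g u) - ln (mfZ g u')"
  have pw: "(D x)\<^sup>2 / B \<le> D x * (- g * \<tau> * iop K d x) + D x * c" for x
  proof -
    have "iop K u' x = 1 * iop K u x + \<tau> * iop K d x"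
      unfolding u'_def using iop_add[OF kernel_K bu(1) bdd, of 1 \<tau> x] by simp
    then have "ln (mf g u' x) - ln (mf g u x) = - g * \<tau> * iop K d x + c"
      unfolding mf_def c_def using mfZ_bounds(3)[OF u g] mfZ_bounds(3)[OF pu' g]
      by (simp add: ln_div algebra_simps)
    moreover have "(D x)\<^sup>2 / B \<le> D x * (ln (mf g u' x) - ln (mf g u x))"
    proof (cases "mf g u x \<le> mf g u' x")
      case True
      then show ?thesis unfolding D_def using mf_pdens(2)[OF u g, of x] pT'
        by (intro ln_diff_ge) (auto simp: pdens_def B_def)
    next
      case False
      then have "(mf g u x - mf g u' x)\<^sup>2 / B \<le> (mf g u x - mf g u' x) * (ln (mf g u x) - ln (mf g u' x))"
        using mf_pdens(2)[OF pu' g, of x] pT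
        by (intro ln_diff_ge) (auto simp: pdens_def B_def)
      then show ?thesis unfolding D_def by (simp add: power2_commute algebra_simps)
    qed
    ultimately show ?thesis by (simp only: distrib_left)
  qed
  have bD2: "bd (\<lambda>x. (D x)\<^sup>2)" using bd_mult[OF bD bD] by (simp add: power2_eq_square)
  have "(\<integral>x. (D x)\<^sup>2 \<partial>M) / B = (\<integral>x. (D x)\<^sup>2 / B \<partial>M)" by simp
  also have "\<dots> \<le> (\<integral>x. (- g * \<tau>) * (D x * iop K d x) + c * D x \<partial>M)"
    by (rule integral_mono) (use bD2 bD i[OF bdd] pw in \<open>auto simp: mult_ac\<close>)
  also have "\<dots> = - g * \<tau> * form K D d"
    unfolding form_def using bD i[OF bdd] D0 by simp
  finally have 1: "(\<integral>x. (D x)\<^sup>2 \<partial>M) / B \<le> - g * \<tau> * form K D d" .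
  have d'e: "d' = (\<lambda>x. (1 - \<tau>) * d x + 1 * D x)" using d'x by auto
  have 2: "form K d' d' = (1 - \<tau>)\<^sup>2 * form K d d + 2 * (1 - \<tau>) * form K D d + form K D D"
    unfolding d'e using form_quadratic[OF kernel_K bdd bD, of "1 - \<tau>" 1] form_sym[OF kernel_K bD bdd] by simp
  have N: "0 \<le> (\<integral>x. (D x)\<^sup>2 \<partial>M)" by simp
  have 3: "g * form K D D \<le> g * (C * (\<integral>x. (D x)\<^sup>2 \<partial>M))"
    using form_le[OF bD] g by (intro mult_left_mono)
  \<comment> \<open>The reason for the value of \<open>\<tau>\<close>: the negative cross term now
    dominates the form of \<open>D\<close>, which \<open>form_le\<close> bounds by \<open>C\<close>
    times the squared L2 norm, and leaves at least one copy of that squared norm over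
    \<open>B\<close>.\<close>
  have \<tau>e: "1 - \<tau> = \<tau> * (1 + g * C * B)" using gCB by (simp add: \<tau>_def field_simps)
  have "2 * (1 - \<tau>) * (g * form K D d) = 2 * (1 + g * C * B) * (g * \<tau> * form K D d)"
    unfolding \<tau>e by (simp add: mult_ac)
  also have "\<dots> \<le> 2 * (1 + g * C * B) * (- ((\<integral>x. (D x)\<^sup>2 \<partial>M) / B))"
    using 1 gCB by (intro mult_left_mono) auto
  also have "\<dots> = - 2 * ((\<integral>x. (D x)\<^sup>2 \<partial>M) / B) - 2 * (g * (C * (\<integral>x. (D x)\<^sup>2 \<partial>M)))"
    using B1 by (simp add: field_simps)
  finally have 4: "2 * (1 - \<tau>) * (g * form K D d) \<le> - 2 * ((\<integral>x. (D x)\<^sup>2 \<partial>M) / B) - 2 * (g * (C * (\<integral>x. (D x)\<^sup>2 \<partial>M)))" .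
  have 5: "0 \<le> (\<integral>x. (D x)\<^sup>2 \<partial>M) / B" "0 \<le> g * (C * (\<integral>x. (D x)\<^sup>2 \<partial>M))"
    using N B1 g C_nonneg by auto
  have "g * form K d' d' = (1 - \<tau>)\<^sup>2 * (g * form K d d) + 2 * (1 - \<tau>) * (g * form K D d) + g * form K D D"
    unfolding 2 by (simp add: algebra_simps)
  then show "g * form K d' d' + (\<integral>x. (D x)\<^sup>2 \<partial>M) / B \<le> (1 - \<tau>)\<^sup>2 * (g * form K d d)"
    using 3 4 5 by linarith
qed

text \<open>The form decays geometrically, but it controls the defect \<open>d\<close> only weakly.
  Convergence is read off from the other term of \<open>mf_damped_step\<close>: the loss of the form
  bounds the L2 norm of \<open>D k\<close>, and \<open>d (Suc k) = q * d k + D k\<close> then makes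
  the L1 norms of the defects summable. So the iterates converge almost everywhere, which suffices
  because \<open>mf\<close> depends on its argument only through integrals.\<close>

lemma mean_field_exists:
  assumes g: "0 \<le> g"
  obtains u where "pdens g u" "\<And>x. mf g u x = u x"
proof -
  define B where "B = exp (g * C)"
  define \<tau> where "\<tau> = 1 / (2 + g * C * B)"
  have B1: "1 \<le> B" using g C_nonneg by (simp add: B_def)
  have gCB: "0 \<le> g * C * B" using g C_nonneg B1 by simp
  have \<tau>: "0 < \<tau>" "\<tau> \<le> 1 / 2" using gCB by (auto simp: \<tau>_def divide_simps)
  define q where "q = 1 - \<tau>"
  have q: "0 < q" "q < 1" using \<tau> by (auto simp: q_def)
  \<comment> \<open>The iteration starts from density 1, that is from \<open>M\<close>
    itself.\<close>
  define U where "U = rec_nat (\<lambda>_. 1) (\<lambda>_ u x. u x + \<tau> * (mf g u x - u x))"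
  have U0: "U 0 = (\<lambda>_. 1)" and US: "U (Suc k) = (\<lambda>x. U k x + \<tau> * (mf g (U k) x - U k x))" for k
    by (simp_all add: U_def)
  define d where "d k x = mf g (U k) x - U k x" for k x
  define D where "D k x = mf g (U (Suc k)) x - mf g (U k) x" for k x
  have p: "pdens g (U k)" for k
  proof (induction k)
    case 0
    show ?case using g C_nonneg by (auto simp: U0 pdens_def)
  next
    case (Suc k)
    then show ?case unfolding US \<tau>_def B_def by (rule mf_damped_step(1)) (rule g)
  qed
  have bd: "bd (U k)" "bd (mf g (U k))" for k using p[of k] mf_pdens(1)[OF p[of k] g] pdens_bd by auto
  have bdd: "bd (d k)" "bd (D k)" for k using bd[of k] bd[of "Suc k"] by (simp_all add: d_def[abs_def] D_def[abs_def])
  have dS: "d (Suc k) x = q * d k x + D k x" for k x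
    using mf_damped_step(2)[OF p[of k] g, of x] unfolding d_def D_def q_def \<tau>_def B_def US .
  have step: "g * form K (d (Suc k)) (d (Suc k)) + (\<integral>x. (D k x)\<^sup>2 \<partial>M) / B \<le> q\<^sup>2 * (g * form K (d k) (d k))" for k
    using mf_damped_step(3)[OF p[of k] g] unfolding d_def[abs_def] D_def q_def \<tau>_def B_def US .
  \<comment> \<open>The added 1 makes \<open>A\<close> positive, so that \<open>A * q ^ k\<close>
    can serve as a divisor below.\<close>
  define A where "A = sqrt (B * (g * form K (d 0) (d 0)) + 1)"
  have F0: "0 \<le> g * form K (d k) (d k)" for k using g bdd by (intro mult_nonneg_nonneg form_nonneg) auto
  have A0: "0 < A" using F0[of 0] B1 by (simp add: A_def add_nonneg_pos)
  have F: "g * form K (d k) (d k) \<le> (q ^ k)\<^sup>2 * (g * form K (d 0) (d 0))" for k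
  proof (induction k)
    case (Suc k)
    have "0 \<le> (\<integral>x. (D k x)\<^sup>2 \<partial>M) / B" using B1 by auto
    then have "g * form K (d (Suc k)) (d (Suc k)) \<le> q\<^sup>2 * (g * form K (d k) (d k))" using step[of k] by linarith
    also have "\<dots> \<le> q\<^sup>2 * ((q ^ k)\<^sup>2 * (g * form K (d 0) (d 0)))" using Suc by (intro mult_left_mono) auto
    finally show ?case by (simp add: power_mult_distrib mult_ac)
  qed simp
  have D2: "(\<integral>x. (D k x)\<^sup>2 \<partial>M) \<le> (A * q ^ k)\<^sup>2" for k
  proof -
    have "(\<integral>x. (D k x)\<^sup>2 \<partial>M) / B \<le> q\<^sup>2 * (g * form K (d k) (d k))" using step[of k] F0[of "Suc k"] by linarith
    also have "\<dots> \<le> 1 * (g * form K (d k) (d k))" using q F0 by (intro mult_right_mono) (auto simp: power_le_one)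
    also have "\<dots> \<le> (q ^ k)\<^sup>2 * (g * form K (d 0) (d 0))" using F by simp
    finally have "(\<integral>x. (D k x)\<^sup>2 \<partial>M) \<le> (q ^ k)\<^sup>2 * (B * (g * form K (d 0) (d 0)))"
      using B1 by (simp add: field_simps)
    also have "\<dots> \<le> (q ^ k)\<^sup>2 * A\<^sup>2" using F0[of 0] B1 by (intro mult_left_mono) (auto simp: A_def)
    finally show ?thesis by (simp add: power_mult_distrib mult_ac)
  qed
  have D1: "(\<integral>x. \<bar>D k x\<bar> \<partial>M) \<le> A * q ^ k" for k
  proof -
    define s where "s = A * q ^ k"
    have s: "0 < s" using A0 q by (simp add: s_def)
    have bD2: "bd (\<lambda>x. (D k x)\<^sup>2)" using bd_mult[OF bdd(2) bdd(2), of k k] by (simp add: power2_eq_square)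
    \<comment> \<open>The inequality of arithmetic and geometric means at the scale \<open>s\<close>
      plays the part of Cauchy-Schwarz on a probability space.\<close>
    have "(\<integral>x. \<bar>D k x\<bar> \<partial>M) \<le> (\<integral>x. s / 2 + (1 / (2 * s)) * (D k x)\<^sup>2 \<partial>M)"
    proof (rule integral_mono)
      fix x
      have "2 * s * \<bar>D k x\<bar> \<le> s\<^sup>2 + (D k x)\<^sup>2" using sum_squares_bound[of s "\<bar>D k x\<bar>"] by simp
      then show "\<bar>D k x\<bar> \<le> s / 2 + (1 / (2 * s)) * (D k x)\<^sup>2"
        using s by (simp add: field_simps power2_eq_square)
    qed (use bdd bD2 in auto)
    also have "\<dots> = s / 2 + (1 / (2 * s)) * (\<integral>x. (D k x)\<^sup>2 \<partial>M)" using bD2 by simp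
    also have "\<dots> \<le> s / 2 + (1 / (2 * s)) * s\<^sup>2"
      using D2[of k] s by (intro add_left_mono mult_left_mono) (auto simp: s_def)
    also have "\<dots> = s" using s by (simp add: field_simps power2_eq_square)
    finally show ?thesis by (simp add: s_def)
  qed
  define a where "a k = (\<integral>x. \<bar>d k x\<bar> \<partial>M)" for k
  have a0: "0 \<le> a k" for k by (simp add: a_def)
  have aS: "a (Suc k) \<le> q * a k + A * q ^ k" for k
  proof -
    have "a (Suc k) \<le> (\<integral>x. q * \<bar>d k x\<bar> + \<bar>D k x\<bar> \<partial>M)"
      unfolding a_def dS
    proof (rule integral_mono)
      show "\<bar>q * d k x + D k x\<bar> \<le> q * \<bar>d k x\<bar> + \<bar>D k x\<bar>" for x
        using abs_triangle_ineq[of "q * d k x" "D k x"] q by (simp add: abs_mult)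
    qed (use bdd in auto)
    also have "\<dots> = q * a k + (\<integral>x. \<bar>D k x\<bar> \<partial>M)" using bdd by (simp add: a_def)
    finally show ?thesis using D1[of k] by linarith
  qed
  have "summable a"
  proof (rule summableI_nonneg_bounded)
    \<comment> \<open>The summed recursion has \<open>q\<close> times the same partial sum on the
      right and is solved for it.\<close>
    show "sum a {..<n} \<le> (a 0 + A / (1 - q)) / (1 - q)" for n
    proof -
      have "sum a {..<n} \<le> sum a {..<Suc n}" using a0 by simp
      also have "\<dots> = a 0 + (\<Sum>k<n. a (Suc k))" by (rule sum.lessThan_Suc_shift)
      also have "\<dots> \<le> a 0 + (\<Sum>k<n. q * a k + A * q ^ k)" by (intro add_left_mono sum_mono aS)
      also have "\<dots> = a 0 + q * sum a {..<n} + A * (\<Sum>k<n. q ^ k)"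
        by (simp add: sum.distrib sum_distrib_left)
      also have "(\<Sum>k<n. q ^ k) \<le> 1 / (1 - q)"
        using q by (subst sum_gp_strict) (auto simp: field_simps)
      finally have "sum a {..<n} \<le> a 0 + q * sum a {..<n} + A * (1 / (1 - q))"
        using A0 by (simp add: mult_left_mono)
      then have "sum a {..<n} * (1 - q) \<le> a 0 + A / (1 - q)" by (simp add: algebra_simps)
      then show ?thesis using q by (simp add: pos_le_divide_eq)
    qed
  qed (rule a0)
  have "(\<integral>\<^sup>+x. (\<Sum>k. ennreal \<bar>d k x\<bar>) \<partial>M) = (\<Sum>k. \<integral>\<^sup>+x. ennreal \<bar>d k x\<bar> \<partial>M)"
    by (rule nn_integral_suminf) (use bd_measurable[OF bdd(1)] in auto)
  also have "\<dots> = (\<Sum>k. ennreal (a k))"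
    unfolding a_def using bdd by (subst nn_integral_eq_integral) auto
  also have "\<dots> = ennreal (\<Sum>k. a k)"
    by (rule suminf_ennreal2[OF a0 \<open>summable a\<close>])
  finally have fin: "(\<integral>\<^sup>+x. (\<Sum>k. ennreal \<bar>d k x\<bar>) \<partial>M) \<noteq> \<infinity>" by simp
  have "AE x in M. (\<Sum>k. ennreal \<bar>d k x\<bar>) \<noteq> \<infinity>"
    using fin bd_measurable[OF bdd(1)] by (intro nn_integral_PInf_AE) auto
  then have AEs: "AE x in M. summable (\<lambda>k. \<bar>d k x\<bar>)"
    by (rule eventually_mono) (auto intro: summable_suminf_not_top)
  \<comment> \<open>Clipping enforces the bounds of \<open>pdens\<close> also on the null set where
    the iterates may diverge; elsewhere it changes nothing.\<close>
  define v where "v x = max 0 (min B (lim (\<lambda>k. U k x)))" for x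
  have Um: "U k \<in> borel_measurable borel" for k using bd bd_measurable by auto
  have v_meas [measurable]: "v \<in> borel_measurable borel"
    unfolding v_def[abs_def] using borel_measurable_lim_metric[of U borel] Um by measurable
  have vb: "0 \<le> v x" "v x \<le> B" for x using B1 by (auto simp: v_def)
  have bv: "bd v" by (rule bdI[of _ B]) (use vb in auto)
  have Ub: "0 \<le> U k x" "U k x \<le> B" for k x using p[of k] by (auto simp: pdens_def B_def)
  have conv: "AE x in M. (\<lambda>k. U k x) \<longlonglongrightarrow> v x \<and> (\<lambda>k. d k x) \<longlonglongrightarrow> 0"
    using AEs
  proof (rule eventually_mono)
    fix x assume "summable (\<lambda>k. \<bar>d k x\<bar>)"
    then have s: "summable (\<lambda>k. d k x)" by (rule summable_rabs_cancel)
    have Ueq: "U k x = 1 + \<tau> * (\<Sum>j<k. d j x)" for k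
      by (induction k) (simp_all add: U0 US d_def algebra_simps)
    have "(\<lambda>k. 1 + \<tau> * (\<Sum>j<k. d j x)) \<longlonglongrightarrow> 1 + \<tau> * (\<Sum>j. d j x)"
      by (intro tendsto_intros summable_LIMSEQ s)
    then have l: "(\<lambda>k. U k x) \<longlonglongrightarrow> 1 + \<tau> * (\<Sum>j. d j x)" unfolding Ueq .
    then have "lim (\<lambda>k. U k x) = 1 + \<tau> * (\<Sum>j. d j x)" by (rule limI)
    moreover have "0 \<le> 1 + \<tau> * (\<Sum>j. d j x)" using LIMSEQ_le_const[OF l] Ub by blast
    moreover have "1 + \<tau> * (\<Sum>j. d j x) \<le> B" using LIMSEQ_le_const2[OF l] Ub by blast
    ultimately have "v x = 1 + \<tau> * (\<Sum>j. d j x)" by (simp add: v_def)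
    then show "(\<lambda>k. U k x) \<longlonglongrightarrow> v x \<and> (\<lambda>k. d k x) \<longlonglongrightarrow> 0"
      using l summable_LIMSEQ_zero[OF s] by simp
  qed
  have v1: "(\<integral>x. v x \<partial>M) = 1"
  proof -
    have "(\<lambda>k. \<integral>x. U k x \<partial>M) \<longlonglongrightarrow> (\<integral>x. v x \<partial>M)"
    proof (rule integral_dominated_convergence[where w="\<lambda>_. B"])
      show "AE x in M. (\<lambda>k. U k x) \<longlonglongrightarrow> v x" using conv by (rule eventually_mono) auto
    qed (use Ub Um in auto)
    moreover have "(\<integral>x. U k x \<partial>M) = 1" for k using p[of k] by (simp add: pdens_def)
    ultimately show ?thesis by (simp add: LIMSEQ_const_iff)
  qed
  have pv: "pdens g v" using vb v1 by (simp add: pdens_def B_def)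
  have Glim: "(\<lambda>k. iop K (U k) x) \<longlonglongrightarrow> iop K v x" for x
    unfolding iop_def
  proof (rule integral_dominated_convergence[where w="\<lambda>y. B * K x y"])
    show "AE y in M. (\<lambda>k. K x y * U k y) \<longlonglongrightarrow> K x y * v y"
      using conv by (rule eventually_mono) (auto intro: tendsto_intros)
    show "AE y in M. norm (K x y * U k y) \<le> B * K x y" for k
      using Ub by (auto simp: abs_mult K_nonneg mult.commute[of B] intro!: mult_left_mono)
    show "(\<lambda>y. K x y * U k y) \<in> borel_measurable M" for k using Um by measurable
  qed auto
  have Zlim: "(\<lambda>k. mfZ g (U k)) \<longlonglongrightarrow> mfZ g v"
    unfolding mfZ_def
  proof (rule integral_dominated_convergence[where w="\<lambda>_. 1"])
    show "AE x in M. (\<lambda>k. exp (- g * iop K (U k) x)) \<longlonglongrightarrow> exp (- g * iop K v x)"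
      by (intro AE_I2 tendsto_intros Glim)
    show "AE x in M. norm (exp (- g * iop K (U k) x)) \<le> 1" for k
      using Ub g by (auto simp: iop_K_nonneg)
  qed (use bd_measurable[OF bd_exp_iop[OF _ _ g]] bd bv Ub vb in auto)
  have mflim: "(\<lambda>k. mf g (U k) x) \<longlonglongrightarrow> mf g v x" for x
    unfolding mf_def using mfZ_bounds(3)[OF pv g] by (intro tendsto_intros Glim Zlim) auto
  have "AE x in M. mf g v x = v x"
    using conv
  proof (rule eventually_mono)
    fix x assume x: "(\<lambda>k. U k x) \<longlonglongrightarrow> v x \<and> (\<lambda>k. d k x) \<longlonglongrightarrow> 0"
    then have "(\<lambda>k. U k x + d k x) \<longlonglongrightarrow> v x + 0" by (intro tendsto_intros) auto
    moreover have "(\<lambda>k. U k x + d k x) = (\<lambda>k. mf g (U k) x)" by (simp add: d_def)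
    ultimately show "mf g v x = v x" using mflim[of x] LIMSEQ_unique by auto
  qed
  \<comment> \<open>So far \<open>v\<close> solves the equation almost everywhere. Integrals ignore
    null sets, so \<open>mf g v\<close> solves it at every point, and a value at the single point
    \<open>E\<close> is needed later.\<close>
  then have "iop K (mf g v) x = iop K v x" for x
    unfolding iop_def using v_meas bd_measurable[OF pdens_bd[OF mf_pdens(1)[OF pv g]]]
    by (intro integral_cong_AE) (auto elim: eventually_mono)
  then have "mf g (mf g v) x = mf g v x" for x
    by (simp add: mf_def[of g "mf g v"] mf_def[of g v x] mfZ_def)
  with mf_pdens(1)[OF pv g] show thesis by (rule that)
qed

end

section \<open>The Riesz kernel as a superposition of Gaussians\<close>

lemma nn_integral_lborel_affine:
  fixes t :: "'a::euclidean_space" and f :: "'a \<Rightarrow> ennreal"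
  assumes [measurable]: "f \<in> borel_measurable borel" and c: "c \<noteq> 0"
  shows "(\<integral>\<^sup>+x. f x \<partial>lborel) = ennreal (\<bar>c\<bar> ^ DIM('a)) * (\<integral>\<^sup>+x. f (t + c *\<^sub>R x) \<partial>lborel)"
  by (subst lborel_affine[OF c, of t])
    (simp add: nn_integral_density nn_integral_distr nn_integral_cmult)

lemma nn_integral_lborel_shift:
  fixes t :: "'a::euclidean_space" and f :: "'a \<Rightarrow> ennreal"
  assumes [measurable]: "f \<in> borel_measurable borel"
  shows "(\<integral>\<^sup>+x. f (t + x) \<partial>lborel) = (\<integral>\<^sup>+x. f x \<partial>lborel)"
  using nn_integral_lborel_affine[OF assms, of 1 t] by simp

lemma le_suminf_ennreal: "f k \<le> (\<Sum>k. f k)" for f :: "nat \<Rightarrow> ennreal"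
  using sum_le_suminf[of f "{k}"] by simp

text \<open>Dyadic decomposition: between the radii \<open>2^(-k-1)\<close> and
  \<open>2^(-k)\<close> the function is at most \<open>2^(s * (k + 1))\<close>, and the larger ball
  has volume proportional to \<open>2^(-k * n)\<close>, with \<open>n\<close> the dimension. The
  ratio \<open>2^(s - n)\<close> of the geometric series is below 1 exactly because
  \<open>s < n\<close>.\<close>

lemma riesz_locally_integrable:
  assumes s: "0 < s" "s < real DIM('a::euclidean_space)"
  shows "(\<integral>\<^sup>+z. ennreal (norm z powr - s) * indicator (ball 0 1) z \<partial>(lborel :: 'a measure)) < \<infinity>"
proof -
  let ?n = "DIM('a)"
  have half_power: "(1 / 2 :: real) ^ k = 2 powr - real k" for k
    by (simp only: powr_minus powr_realpow zero_less_numeral power_one_over) (simp add: divide_inverse)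
  define B where "B k = ball (0::'a) ((1 / 2) ^ k)" for k :: nat
  have [measurable]: "B k \<in> sets borel" for k by (simp add: B_def)
  have B: "emeasure lborel (B k) = ennreal (((1 / 2) ^ k) ^ ?n) * emeasure lborel (ball (0::'a) 1)" for k
  proof -
    have "emeasure lborel (B k) = (\<integral>\<^sup>+z. indicator (B k) z \<partial>lborel)" by (simp add: B_def)
    also have "\<dots> = ennreal (\<bar>(1 / 2) ^ k\<bar> ^ ?n) * (\<integral>\<^sup>+z. indicator (B k) (0 + (1 / 2) ^ k *\<^sub>R z) \<partial>lborel)"
      by (rule nn_integral_lborel_affine) auto
    also have "(\<integral>\<^sup>+z. indicator (B k) (0 + (1 / 2) ^ k *\<^sub>R z) \<partial>lborel) = (\<integral>\<^sup>+z. indicator (ball (0::'a) 1) z \<partial>lborel)"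
      by (intro nn_integral_cong) (auto simp: B_def indicator_def power_one_over field_simps)
    finally show ?thesis by simp
  qed
  define x where "x = (2::real) powr (s - real ?n)"
  have x: "0 \<le> x" "x < 1" using s powr_less_cancel_iff[of 2 "s - real ?n" 0] by (simp_all add: x_def)
  have "(\<integral>\<^sup>+z. ennreal (norm z powr - s) * indicator (ball 0 1) z \<partial>(lborel :: 'a measure)) \<le>
    (\<integral>\<^sup>+z. (\<Sum>k. ennreal (2 powr (s * (real k + 1))) * indicator (B k) z) \<partial>lborel)"
  proof (rule nn_integral_mono)
    fix z :: 'a
    let ?g = "\<lambda>k. ennreal (2 powr (s * (real k + 1))) * indicator (B k) z"
    show "ennreal (norm z powr - s) * indicator (ball 0 1) z \<le> (\<Sum>k. ?g k)"
    proof (cases "z \<noteq> 0 \<and> norm z < 1")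
      case True
      then have z: "0 < norm z" "norm z < 1" by auto
      have "\<exists>k. (1 / 2) ^ k \<le> norm z" 
      proof -
        obtain k where "(1 / 2) ^ k < norm z" using real_arch_pow_inv[of "norm z" "1 / 2"] z by auto
        then show ?thesis by (intro exI[of _ k]) simp
      qed
      define m where "m = (LEAST k. (1 / 2 :: real) ^ k \<le> norm z)"
      have m: "(1 / 2) ^ m \<le> norm z" unfolding m_def by (rule LeastI_ex) fact
      have "m \<noteq> 0" 
      proof
        assume "m = 0"
        then show False using m z by simp
      qed
      then obtain k where k: "m = Suc k" by (cases m) auto
      have "\<not> (1 / 2) ^ k \<le> norm z" using not_less_Least[of k "\<lambda>k. (1 / 2 :: real) ^ k \<le> norm z"] k by (simp add: m_def)
      then have zB: "z \<in> B k" by (simp add: B_def)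
      have "(1 / 2 :: real) ^ m = 2 powr - real m" by (rule half_power)
      then have "norm z powr - s \<le> (2 powr - real m) powr - s"
        using m s by (intro powr_mono2') simp_all
      also have "\<dots> = 2 powr (s * (real k + 1))" unfolding powr_powr k by (simp add: algebra_simps)
      finally have "ennreal (norm z powr - s) * indicator (ball 0 1) z \<le> ?g k"
        using zB z by (simp add: ennreal_leI)
      moreover have "?g k \<le> (\<Sum>k. ?g k)"
        by (rule le_suminf_ennreal)
      ultimately show ?thesis by (rule order_trans)
    next
      case False
      then have "ennreal (norm z powr - s) * indicator (ball 0 1) z = 0"
        using s by (cases "z = 0") simp_all
      then show ?thesis by (simp only: zero_le)
    qed
  qed
  also have "\<dots> = (\<Sum>k. \<integral>\<^sup>+z. ennreal (2 powr (s * (real k + 1))) * indicator (B k) z \<partial>lborel)"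
    by (rule nn_integral_suminf) measurable
  also have "\<dots> = (\<Sum>k. ennreal (2 powr (s * (real k + 1))) * emeasure lborel (B k))"
    by (intro suminf_cong nn_integral_cmult_indicator) simp
  also have "\<dots> = (\<Sum>k. ennreal (2 powr s * x ^ k) * emeasure lborel (ball (0::'a) 1))"
  proof (rule suminf_cong)
    fix k
    have "x ^ k = 2 powr ((s - real ?n) * real k)"
      unfolding x_def by (simp only: powr_powr[symmetric] powr_realpow powr_gt_zero)
    moreover have "((1 / 2 :: real) ^ k) ^ ?n = 2 powr (- real ?n * real k)"
      using half_power[of "k * ?n"] by (simp only: power_mult of_nat_mult) (simp add: mult.commute)
    ultimately have eq: "2 powr s * x ^ k = 2 powr (s * (real k + 1)) * ((1 / 2) ^ k) ^ ?n"
      by (simp only: powr_add[symmetric]) (simp add: algebra_simps)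
    show "ennreal (2 powr (s * (real k + 1))) * emeasure lborel (B k) = ennreal (2 powr s * x ^ k) * emeasure lborel (ball (0::'a) 1)"
      unfolding eq B by (subst ennreal_mult) (simp_all add: mult.assoc)
  qed
  also have "\<dots> = (\<Sum>k. ennreal (2 powr s * x ^ k)) * emeasure lborel (ball (0::'a) 1)"
    by (rule ennreal_suminf_multc)
  also have "\<dots> < \<infinity>"
  proof -
    have "(\<Sum>k. ennreal (2 powr s * x ^ k)) = ennreal (\<Sum>k. 2 powr s * x ^ k)"
      using x by (intro suminf_ennreal2 summable_mult summable_geometric) auto
    then show ?thesis
      using emeasure_lborel_ball_finite[of "0::'a" 1] by (simp add: ennreal_mult_less_top)
  qed
  finally show ?thesis .
qed

lemma nn_integral_powr_exp:
  assumes a: "0 < a" and c: "0 < (c::real)"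
  shows "(\<integral>\<^sup>+t. ennreal (indicator {0<..} t * t powr (a - 1) * exp (- c * t)) \<partial>lborel) = ennreal (c powr - a * Gamma a)"
proof -
  let ?f = "\<lambda>t. indicator {0<..} t * t powr (a - 1) * exp (- t)"
  have "((\<lambda>t. t powr (a - 1) / exp t) has_integral Gamma a) {0..}" by (rule Gamma_integral_real[OF a])
  then have "((\<lambda>t. if t \<in> {0..} then t powr (a - 1) / exp t else 0) has_integral Gamma a) UNIV"
    by (simp only: has_integral_restrict_UNIV)
  moreover have "(\<lambda>t. if t \<in> {0..} then t powr (a - 1) / exp t else 0) = ?f"
    by (rule ext) (auto simp: indicator_def exp_minus divide_inverse)
  ultimately have "(?f has_integral Gamma a) UNIV" by simp
  then have 1: "(\<integral>\<^sup>+t. ennreal (?f t) \<partial>lborel) = ennreal (Gamma a)"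
    by (intro nn_integral_has_integral_lborel) auto
  have 2: "(\<integral>\<^sup>+t. ennreal (?f t) \<partial>lborel) = ennreal \<bar>c\<bar> * (\<integral>\<^sup>+t. ennreal (?f (0 + c * t)) \<partial>lborel)"
    by (rule nn_integral_real_affine) (use c in auto)
  have 3: "(\<integral>\<^sup>+t. ennreal (?f (0 + c * t)) \<partial>lborel) =
      (\<integral>\<^sup>+t. ennreal (c powr (a - 1)) * ennreal (indicator {0<..} t * t powr (a - 1) * exp (- c * t)) \<partial>lborel)"
    using c by (intro nn_integral_cong)
      (auto simp: indicator_def ennreal_mult[symmetric] powr_mult zero_less_mult_iff mult_ac)
  have 4: "ennreal (Gamma a) = ennreal (c * c powr (a - 1)) *
      (\<integral>\<^sup>+t. ennreal (indicator {0<..} t * t powr (a - 1) * exp (- c * t)) \<partial>lborel)" (is "_ = _ * ?X")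
    using c unfolding 1[symmetric] 2 3 by (subst nn_integral_cmult) (auto simp: ennreal_mult mult.assoc)
  have 5: "c * c powr (a - 1) = c powr a" using c by (simp add: powr_diff)
  have "?X = ennreal (c powr - a * c powr a) * ?X" using c by (simp add: powr_add[symmetric])
  also have "\<dots> = ennreal (c powr - a) * ennreal (Gamma a)"
    unfolding 4 5 by (simp add: ennreal_mult mult.assoc)
  also have "\<dots> = ennreal (c powr - a * Gamma a)" using Gamma_real_pos[OF a] by (simp add: ennreal_mult)
  finally show ?thesis .
qed

text \<open>For \<open>t > 0\<close> this is \<open>(pi / (2 * t))\<close> to the power
  \<open>n / 2\<close>. The value is divided out in \<open>psd_riesz_trunc\<close>, so finiteness
  and positivity are what counts. The \<open>itself\<close> argument carries the dimension.\<close>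

definition gauss_mass :: "'a::euclidean_space itself \<Rightarrow> real \<Rightarrow> ennreal" where
  "gauss_mass _ t = (\<integral>\<^sup>+z. ennreal (exp (- 2 * t * (norm (z::'a))\<^sup>2)) \<partial>lborel)"

lemma gauss_mass_measurable [measurable]: "gauss_mass TYPE('a::euclidean_space) \<in> borel_measurable borel"
  unfolding gauss_mass_def[abs_def] by measurable

lemma gauss_mass_finite:
  assumes "0 < t" shows "gauss_mass TYPE('a::euclidean_space) t < \<infinity>"
proof -
  have 1: "(\<integral>\<^sup>+x. ennreal (exp (- 2 * t * x\<^sup>2)) \<partial>lborel) < \<infinity>"
  proof -
    define \<sigma> where "\<sigma> = 1 / (2 * sqrt t)"
    have \<sigma>: "0 < \<sigma>" "2 * \<sigma>\<^sup>2 = 1 / (2 * t)" using assms by (auto simp: \<sigma>_def power_divide power_mult_distrib)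
    have "(\<integral>\<^sup>+x. ennreal (exp (- 2 * t * x\<^sup>2)) \<partial>lborel) = (\<integral>\<^sup>+x. ennreal (sqrt (2 * pi * \<sigma>\<^sup>2)) * ennreal (normal_density 0 \<sigma> x) \<partial>lborel)"
    proof (rule nn_integral_cong)
      fix x
      have "- x\<^sup>2 / (2 * \<sigma>\<^sup>2) = - 2 * t * x\<^sup>2" unfolding \<sigma>(2) using assms by simp
      moreover have "sqrt (2 * pi * \<sigma>\<^sup>2) \<noteq> 0" using \<sigma>(1) by simp
      ultimately have "exp (- 2 * t * x\<^sup>2) = sqrt (2 * pi * \<sigma>\<^sup>2) * normal_density 0 \<sigma> x"
        by (simp add: normal_density_def)
      then show "ennreal (exp (- 2 * t * x\<^sup>2)) = ennreal (sqrt (2 * pi * \<sigma>\<^sup>2)) * ennreal (normal_density 0 \<sigma> x)"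
        by (simp add: ennreal_mult)
    qed
    also have "\<dots> = ennreal (sqrt (2 * pi * \<sigma>\<^sup>2)) * (\<integral>\<^sup>+x. ennreal (normal_density 0 \<sigma> x) \<partial>lborel)"
      by (rule nn_integral_cmult) measurable
    also have "(\<integral>\<^sup>+x. ennreal (normal_density 0 \<sigma> x) \<partial>lborel) = 1"
      using prob_space.emeasure_space_1[OF prob_space_normal_density[OF \<sigma>(1), of 0]]
      by (simp add: emeasure_density)
    finally show ?thesis by simp
  qed
  have "gauss_mass TYPE('a) t = (\<integral>\<^sup>+z. (\<Prod>b\<in>Basis. ennreal (exp (- 2 * t * (z \<bullet> b)\<^sup>2))) \<partial>(lborel :: 'a measure))"
    unfolding gauss_mass_def
  proof (rule nn_integral_cong)
    fix z :: 'a
    have "(norm z)\<^sup>2 = (\<Sum>b\<in>Basis. (z \<bullet> b)\<^sup>2)"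
      unfolding power2_norm_eq_inner by (subst euclidean_inner) (simp add: power2_eq_square)
    then show "ennreal (exp (- 2 * t * (norm z)\<^sup>2)) = (\<Prod>b\<in>Basis. ennreal (exp (- 2 * t * (z \<bullet> b)\<^sup>2)))"
      by (simp add: sum_distrib_left exp_sum[symmetric] prod_ennreal sum_negf)
  qed
  also have "\<dots> = (\<Prod>b\<in>(Basis::'a set). \<integral>\<^sup>+x. ennreal (exp (- 2 * t * x\<^sup>2)) \<partial>lborel)"
    by (rule nn_integral_lborel_prod) auto
  also have "\<dots> < \<infinity>" using 1 by (simp add: power_less_top_ennreal)
  finally show ?thesis .
qed

lemma gauss_mass_pos: "gauss_mass TYPE('a::euclidean_space) t \<noteq> 0"
proof
  assume "gauss_mass TYPE('a) t = 0"
  then have "AE z in (lborel :: 'a measure). ennreal (exp (- 2 * t * (norm z)\<^sup>2)) = 0"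
    unfolding gauss_mass_def by (subst (asm) nn_integral_0_iff_AE) auto
  then have "AE z in (lborel :: 'a measure). False" by (rule eventually_mono) (simp add: ennreal_eq_0_iff)
  then show False by (simp add: eventually_False ae_filter_eq_bot_iff)
qed

text \<open>Parallelogram identity around the midpoint of \<open>x\<close> and \<open>y\<close>. It
  exhibits a Gaussian of \<open>x - y\<close> as an inner product over \<open>z\<close> of Gaussians
  centred at \<open>x\<close> and at \<open>y\<close>, which is its positive definiteness.\<close>

lemma gauss_convolution:
  fixes x y :: "'a::euclidean_space"
  shows "(\<integral>\<^sup>+z. ennreal (exp (- t * (norm (x - z))\<^sup>2)) * ennreal (exp (- t * (norm (y - z))\<^sup>2)) \<partial>lborel)
    = ennreal (exp (- t * (norm (x - y))\<^sup>2 / 2)) * gauss_mass TYPE('a) t"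
proof -
  define m where "m = (1 / 2) *\<^sub>R (x + y)"
  have "(\<integral>\<^sup>+z. ennreal (exp (- t * (norm (x - z))\<^sup>2)) * ennreal (exp (- t * (norm (y - z))\<^sup>2)) \<partial>lborel) =
    (\<integral>\<^sup>+z. ennreal (exp (- t * (norm (x - (m + z)))\<^sup>2)) * ennreal (exp (- t * (norm (y - (m + z)))\<^sup>2)) \<partial>lborel)"
    by (rule nn_integral_lborel_shift[symmetric]) measurable
  also have "\<dots> = (\<integral>\<^sup>+z. ennreal (exp (- t * (norm (x - y))\<^sup>2 / 2)) * ennreal (exp (- 2 * t * (norm (z::'a))\<^sup>2)) \<partial>lborel)"
  proof (rule nn_integral_cong)
    fix z :: 'a
    define h where "h = (1 / 2) *\<^sub>R (x - y)"
    have eq: "x - (m + z) = h - z" "y - (m + z) = - (h + z)"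
      by (simp_all add: m_def h_def algebra_simps flip: scaleR_left_distrib)
    have "(norm (x - (m + z)))\<^sup>2 + (norm (y - (m + z)))\<^sup>2 = 2 * (norm h)\<^sup>2 + 2 * (norm z)\<^sup>2"
      unfolding eq norm_minus_cancel by (simp add: power2_norm_eq_inner algebra_simps inner_commute)
    moreover have "(norm h)\<^sup>2 = (norm (x - y))\<^sup>2 / 4" by (simp add: h_def power_divide)
    ultimately have "(norm (x - (m + z)))\<^sup>2 + (norm (y - (m + z)))\<^sup>2 = (norm (x - y))\<^sup>2 / 2 + 2 * (norm z)\<^sup>2" by simp
    then have "- t * (norm (x - (m + z)))\<^sup>2 + - t * (norm (y - (m + z)))\<^sup>2 = - t * (norm (x - y))\<^sup>2 / 2 + - 2 * t * (norm z)\<^sup>2"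
      by (simp add: algebra_simps flip: distrib_left)
    then show "ennreal (exp (- t * (norm (x - (m + z)))\<^sup>2)) * ennreal (exp (- t * (norm (y - (m + z)))\<^sup>2)) =
      ennreal (exp (- t * (norm (x - y))\<^sup>2 / 2)) * ennreal (exp (- 2 * t * (norm z)\<^sup>2))"
      by (simp only: ennreal_mult[symmetric] exp_ge_zero exp_add[symmetric])
  qed
  also have "\<dots> = ennreal (exp (- t * (norm (x - y))\<^sup>2 / 2)) * gauss_mass TYPE('a) t"
    unfolding gauss_mass_def by (rule nn_integral_cmult) measurable
  finally show ?thesis .
qed

lemma two_mult_le_sum_squares_ennreal: "2 * (a * b) \<le> a * a + b * (b::ennreal)"
proof (cases "a = \<top> \<or> b = \<top>")
  case False
  then obtain r q where "a = ennreal r" "b = ennreal q" "0 \<le> r" "0 \<le> q"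
    by (metis ennreal_cases)
  then show ?thesis using sum_squares_bound[of r q]
    by (simp add: ennreal_mult[symmetric] ennreal_plus[symmetric] power2_eq_square mult.assoc ennreal_leI
        flip: ennreal_numeral del: ennreal_plus)
qed (auto simp: ennreal_mult_top)

text \<open>By Fubini each double integral becomes the integral over \<open>p\<close> of
  \<open>V p\<close> times the product of the averages of \<open>h p\<close> under the two measures;
  what remains is \<open>2 * a * b \<le> a^2 + b^2\<close> at each \<open>p\<close>. Working in
  \<open>ennreal\<close> keeps possibly infinite integrals harmless.\<close>

lemma psd_superposition:
  fixes h :: "'p \<Rightarrow> 'a::euclidean_space \<Rightarrow> ennreal" and V :: "'p \<Rightarrow> ennreal"
  assumes "sigma_finite_measure m" and V [measurable]: "V \<in> borel_measurable m"
    and h: "(\<lambda>(p, x). h p x) \<in> borel_measurable (m \<Otimes>\<^sub>M borel)"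
    and k: "\<And>x y. k x y = (\<integral>\<^sup>+p. V p * (h p x * h p y) \<partial>m)"
    and R: "finite_measure R1" "finite_measure R2" "sets R1 = sets borel" "sets R2 = sets borel"
  shows "2 * (\<integral>\<^sup>+x. \<integral>\<^sup>+y. k x y \<partial>R2 \<partial>R1)
          \<le> (\<integral>\<^sup>+x. \<integral>\<^sup>+y. k x y \<partial>R1 \<partial>R1) + (\<integral>\<^sup>+x. \<integral>\<^sup>+y. k x y \<partial>R2 \<partial>R2)"
proof -
  interpret m: sigma_finite_measure m by fact
  define A where "A R p = (\<integral>\<^sup>+x. h p x \<partial>R)" for R p
  have Am: "A R \<in> borel_measurable m" if "finite_measure R" "sets R = sets borel" for R
  proof -
    interpret R: finite_measure R by fact
    have [measurable]: "(\<lambda>(p, x). h p x) \<in> borel_measurable (m \<Otimes>\<^sub>M R)"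
      using h by (simp add: measurable_cong_sets[OF sets_pair_measure_cong[OF refl that(2)] refl])
    show ?thesis unfolding A_def[abs_def] by measurable
  qed
  have *: "(\<integral>\<^sup>+x. \<integral>\<^sup>+y. k x y \<partial>R' \<partial>R) = (\<integral>\<^sup>+p. V p * (A R p * A R' p) \<partial>m)"
    if R: "finite_measure R" "sets R = sets borel" "finite_measure R'" "sets R' = sets borel" for R R'
  proof -
    interpret R: finite_measure R by fact
    interpret R': finite_measure R' by fact
    interpret P: pair_sigma_finite m R' ..
    interpret Q: pair_sigma_finite m R ..
    note [measurable_cong] = R(2,4) and [measurable] = Am[OF R(1,2)] Am[OF R(3,4)]
    have [measurable (raw)]: "(\<lambda>w. h (f w) (g w)) \<in> borel_measurable N"
      if "f \<in> measurable N m" "g \<in> borel_measurable N" for f g and N :: "'z measure"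
      using measurable_compose[OF measurable_Pair[OF that] h] by simp
    have [measurable]: "(\<lambda>(p, x). h p x) \<in> borel_measurable (m \<Otimes>\<^sub>M R)" "(\<lambda>(p, x). h p x) \<in> borel_measurable (m \<Otimes>\<^sub>M R')"
      using h by (simp_all add: measurable_cong_sets[OF sets_pair_measure_cong[OF refl R(2)] refl]
          measurable_cong_sets[OF sets_pair_measure_cong[OF refl R(4)] refl])
    have hm: "h p \<in> borel_measurable borel" if "p \<in> space m" for p
      using measurable_compose[OF measurable_Pair1'[OF that] h] by simp
    have hm': "(\<lambda>p. h p x) \<in> borel_measurable m" for x
      using measurable_compose[OF measurable_Pair2'[of x borel m] h] by simp
    have "(\<integral>\<^sup>+y. k x y \<partial>R') = (\<integral>\<^sup>+p. V p * (h p x * A R' p) \<partial>m)" for x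
    proof -
      have [measurable]: "(\<lambda>p. h p x) \<in> borel_measurable m" by (rule hm')
      have "(\<integral>\<^sup>+y. k x y \<partial>R') = (\<integral>\<^sup>+p. (\<integral>\<^sup>+y. V p * (h p x * h p y) \<partial>R') \<partial>m)"
        unfolding k by (rule P.Fubini') measurable
      also have "\<dots> = (\<integral>\<^sup>+p. V p * (h p x * A R' p) \<partial>m)"
        using hm R unfolding A_def by (intro nn_integral_cong) (auto simp: nn_integral_cmult mult.assoc[symmetric])
      finally show ?thesis .
    qed
    then have "(\<integral>\<^sup>+x. \<integral>\<^sup>+y. k x y \<partial>R' \<partial>R) = (\<integral>\<^sup>+x. \<integral>\<^sup>+p. V p * (h p x * A R' p) \<partial>m \<partial>R)" by simp
    also have "\<dots> = (\<integral>\<^sup>+p. \<integral>\<^sup>+x. V p * (h p x * A R' p) \<partial>R \<partial>m)"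
      by (rule Q.Fubini') measurable
    also have "\<dots> = (\<integral>\<^sup>+p. V p * (A R p * A R' p) \<partial>m)"
    proof (rule nn_integral_cong)
      fix p assume p: "p \<in> space m"
      have "(\<integral>\<^sup>+x. V p * (h p x * A R' p) \<partial>R) = (\<integral>\<^sup>+x. (V p * A R' p) * h p x \<partial>R)" by (simp add: mult_ac)
      also have "\<dots> = (V p * A R' p) * A R p"
        unfolding A_def by (rule nn_integral_cmult) (use hm[OF p] R in auto)
      finally show "(\<integral>\<^sup>+x. V p * (h p x * A R' p) \<partial>R) = V p * (A R p * A R' p)" by (simp add: mult_ac)
    qed
    finally show ?thesis .
  qed
  note [measurable] = Am[OF R(1,3)] Am[OF R(2,4)]
  have "2 * (\<integral>\<^sup>+p. V p * (A R1 p * A R2 p) \<partial>m) = (\<integral>\<^sup>+p. V p * (2 * (A R1 p * A R2 p)) \<partial>m)"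
    by (subst nn_integral_cmult[symmetric]) (auto simp: mult_ac)
  also have "\<dots> \<le> (\<integral>\<^sup>+p. V p * (A R1 p * A R1 p + A R2 p * A R2 p) \<partial>m)"
    by (intro nn_integral_mono mult_left_mono two_mult_le_sum_squares_ennreal) auto
  also have "\<dots> = (\<integral>\<^sup>+p. V p * (A R1 p * A R1 p) \<partial>m) + (\<integral>\<^sup>+p. V p * (A R2 p * A R2 p) \<partial>m)"
    by (subst nn_integral_add[symmetric]) (auto simp: distrib_left)
  finally show ?thesis using R by (simp add: *)
qed

text \<open>At \<open>x = y\<close> this is \<open>0 powr (- s) = 0\<close>.\<close>

definition riesz :: "real \<Rightarrow> 'a::euclidean_space \<Rightarrow> 'a \<Rightarrow> real" where
  "riesz s x y = norm (x - y) powr (- s)"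

text \<open>Up to the factor \<open>gconst s\<close>, \<open>r powr (- s)\<close> is the integral of \<open>gsup s r\<close> over \<open>t > 0\<close>; the
  truncations restrict it to \<open>t \<le> T\<close>.\<close>

definition gsup :: "real \<Rightarrow> real \<Rightarrow> real \<Rightarrow> real" where
  "gsup s r t = indicator {0<..} t * t powr (s / 2 - 1) * exp (- (r\<^sup>2 / 2) * t)"

definition gconst :: "real \<Rightarrow> real" where
  "gconst s = 2 powr (s / 2) * Gamma (s / 2)"

definition trunc :: "real \<Rightarrow> nat \<Rightarrow> real \<Rightarrow> real" where
  "trunc s T r = enn2real (\<integral>\<^sup>+t. ennreal (gsup s r t) * indicator {..real T} t \<partial>lborel) / gconst s"

definition riesz_trunc :: "real \<Rightarrow> nat \<Rightarrow> 'a::euclidean_space \<Rightarrow> 'a \<Rightarrow> real" where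
  "riesz_trunc s T x y = trunc s T (norm (x - y))"

section \<open>Finiteness, monotonicity and convergence of the truncations\<close>

lemma gsup_nonneg: "0 \<le> gsup s r t"
  by (simp add: gsup_def)

lemma gsup_measurable [measurable (raw)]:
  assumes [measurable]: "f \<in> borel_measurable N" "g \<in> borel_measurable N"
  shows "(\<lambda>w. gsup s (f w) (g w)) \<in> borel_measurable N"
  unfolding gsup_def by measurable

lemma gsup_antimono: "0 \<le> r \<Longrightarrow> r \<le> r' \<Longrightarrow> gsup s r' t \<le> gsup s r t"
proof (cases "0 < t")
  case True
  assume "0 \<le> r" "r \<le> r'"
  then have "r\<^sup>2 / 2 * t \<le> r'\<^sup>2 / 2 * t"
    using True by (intro mult_right_mono divide_right_mono power_mono) auto
  then have "exp (- (r'\<^sup>2 / 2) * t) \<le> exp (- (r\<^sup>2 / 2) * t)" by simp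
  then show ?thesis unfolding gsup_def by (intro mult_left_mono) auto
qed (simp add: gsup_def)

lemma gconst_pos: "0 < s \<Longrightarrow> 0 < gconst s"
  by (simp add: gconst_def Gamma_real_pos)

lemma nn_integral_gsup:
  assumes s: "0 < s" and r: "0 < r"
  shows "(\<integral>\<^sup>+t. ennreal (gsup s r t) \<partial>lborel) = ennreal (gconst s * r powr - s)"
proof -
  have "(r\<^sup>2 / 2) powr - (s / 2) = 2 powr (s / 2) * r powr - s"
  proof -
    have "(r\<^sup>2 / 2) powr - (s / 2) = (r powr 2) powr - (s / 2) / 2 powr - (s / 2)"
      using r by (simp add: powr_divide)
    moreover have "(r powr 2) powr - (s / 2) = r powr - s" by (simp add: powr_powr)
    moreover have "x / 2 powr - (s / 2) = 2 powr (s / 2) * x" for x :: real by (simp only: powr_minus_divide) simp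
    ultimately show ?thesis by simp
  qed
  moreover have "(\<integral>\<^sup>+t. ennreal (gsup s r t) \<partial>lborel) = ennreal ((r\<^sup>2 / 2) powr - (s / 2) * Gamma (s / 2))"
    unfolding gsup_def by (rule nn_integral_powr_exp) (use s r in auto)
  ultimately show ?thesis by (simp only: gconst_def mult.assoc mult.left_commute mult.commute)
qed

text \<open>For \<open>0 < t \<le> T\<close> the exponential is at most \<open>exp (T - t)\<close>,
  which leads to a Gamma integral. This includes \<open>r = 0\<close>, where the full integral
  diverges: the truncated kernel is finite on the diagonal.\<close>

lemma trunc_finite:
  assumes s: "0 < s"
  shows "(\<integral>\<^sup>+t. ennreal (gsup s r t) * indicator {..real T} t \<partial>lborel) < \<infinity>"
proof -
  have "(\<integral>\<^sup>+t. ennreal (gsup s r t) * indicator {..real T} t \<partial>lborel) \<le>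
    (\<integral>\<^sup>+t. ennreal (exp (real T)) * ennreal (indicator {0<..} t * t powr (s / 2 - 1) * exp (- 1 * t)) \<partial>lborel)"
  proof (rule nn_integral_mono)
    fix t :: real
    have "gsup s r t \<le> exp (real T) * (indicator {0<..} t * t powr (s / 2 - 1) * exp (- 1 * t))" if "t \<le> real T"
    proof (cases "0 < t")
      case True
      have "exp (- (r\<^sup>2 / 2) * t) \<le> exp (real T) * exp (- 1 * t)"
      proof -
        have "0 \<le> (r\<^sup>2 / 2) * t" using True by simp
        then have "- (r\<^sup>2 / 2) * t \<le> real T + - 1 * t" using that by linarith
        then show ?thesis by (simp only: exp_add[symmetric] exp_le_cancel_iff)
      qed
      then show ?thesis using True by (simp add: gsup_def mult_left_mono mult.left_commute)
    qed (simp add: gsup_def)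
    then show "ennreal (gsup s r t) * indicator {..real T} t \<le>
        ennreal (exp (real T)) * ennreal (indicator {0<..} t * t powr (s / 2 - 1) * exp (- 1 * t))"
      by (auto simp: indicator_def ennreal_mult[symmetric] intro!: ennreal_leI)
  qed
  also have "\<dots> = ennreal (exp (real T)) * ennreal (1 powr - (s / 2) * Gamma (s / 2))"
    using nn_integral_powr_exp[of "s / 2" 1] s by (subst nn_integral_cmult) auto
  also have "\<dots> < \<infinity>" by (simp add: ennreal_mult_less_top)
  finally show ?thesis .
qed

lemma ennreal_trunc:
  assumes s: "0 < s"
  shows "ennreal (trunc s T r) * ennreal (gconst s) = (\<integral>\<^sup>+t. ennreal (gsup s r t) * indicator {..real T} t \<partial>lborel)"
  using trunc_finite[OF s, of r T] gconst_pos[OF s]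
  by (simp add: trunc_def ennreal_mult[symmetric] less_top)

lemma trunc_nonneg: "0 < s \<Longrightarrow> 0 \<le> trunc s T r"
  using gconst_pos[of s] by (simp add: trunc_def)

lemma trunc_antimono:
  assumes s: "0 < s" and r: "0 \<le> r" "r \<le> r'"
  shows "trunc s T r' \<le> trunc s T r"
  unfolding trunc_def using gconst_pos[OF s] trunc_finite[OF s] r
  by (intro divide_right_mono enn2real_mono nn_integral_mono mult_right_mono ennreal_leI gsup_antimono) auto

lemma trunc_measurable [measurable]: "trunc s T \<in> borel_measurable borel"
  unfolding trunc_def[abs_def] by measurable

text \<open>The error of truncation is itself a superposition of Gaussians, over
  \<open>t > T\<close>; its sign and its monotonicity in \<open>r\<close> are inherited from the
  integrand.\<close>

lemma trunc_remainder:
  assumes s: "0 < s" and r: "0 < r"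
  shows "(\<integral>\<^sup>+t. ennreal (gsup s r t) * indicator {real T<..} t \<partial>lborel) = ennreal (gconst s * (r powr - s - trunc s T r))"
    and "trunc s T r \<le> r powr - s"
proof -
  let ?H = "\<integral>\<^sup>+t. ennreal (gsup s r t) * indicator {real T<..} t \<partial>lborel"
  have "ennreal (gconst s * r powr - s) = (\<integral>\<^sup>+t. ennreal (gsup s r t) * indicator {..real T} t + ennreal (gsup s r t) * indicator {real T<..} t \<partial>lborel)"
    unfolding nn_integral_gsup[OF s r, symmetric] by (intro nn_integral_cong) (auto simp: indicator_def)
  also have "\<dots> = ennreal (trunc s T r) * ennreal (gconst s) + ?H"
    unfolding ennreal_trunc[OF s] by (rule nn_integral_add) measurable
  finally have *: "ennreal (gconst s * r powr - s) = ennreal (trunc s T r * gconst s) + ?H"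
    using gconst_pos[OF s] trunc_nonneg[OF s] by (simp add: ennreal_mult)
  have "ennreal (trunc s T r * gconst s) \<le> ennreal (gconst s * r powr - s)" unfolding * by simp
  then have "gconst s * trunc s T r \<le> gconst s * r powr - s"
    using gconst_pos[OF s] by (simp add: mult.commute)
  then show le: "trunc s T r \<le> r powr - s" using gconst_pos[OF s] by simp
  have "?H = ennreal (gconst s * r powr - s) - ennreal (trunc s T r * gconst s)"
    unfolding * by simp
  also have "\<dots> = ennreal (gconst s * (r powr - s - trunc s T r))"
    using gconst_pos[OF s] trunc_nonneg[OF s] by (subst ennreal_minus) (auto simp: algebra_simps)
  finally show "?H = ennreal (gconst s * (r powr - s - trunc s T r))" .
qed

text \<open>Bounds the truncation error at all distances at least 1 by its value at 1.\<close>

lemma remainder_antimono: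
  assumes s: "0 < s" and r: "0 < r" "r \<le> r'"
  shows "r' powr - s - trunc s T r' \<le> r powr - s - trunc s T r"
proof -
  have "ennreal (gconst s * (r' powr - s - trunc s T r')) \<le> ennreal (gconst s * (r powr - s - trunc s T r))"
    unfolding trunc_remainder(1)[OF s r(1), symmetric] trunc_remainder(1)[OF s less_le_trans[OF r], symmetric]
    using r by (intro nn_integral_mono mult_right_mono ennreal_leI gsup_antimono) auto
  then show ?thesis
    using gconst_pos[OF s] trunc_remainder(2)[OF s r(1), of T] by (subst (asm) ennreal_le_iff) auto
qed

lemma trunc_tendsto:
  assumes s: "0 < s" and r: "0 < r"
  shows "(\<lambda>T. trunc s T r) \<longlonglongrightarrow> r powr - s"
proof -
  have "(\<lambda>T. \<integral>\<^sup>+t. ennreal (gsup s r t) * indicator {..real T} t \<partial>lborel) \<longlonglongrightarrow> (\<integral>\<^sup>+t. ennreal (gsup s r t) \<partial>lborel)"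
  proof (rule nn_integral_LIMSEQ)
    show "incseq (\<lambda>T t. ennreal (gsup s r t) * indicator {..real T} t)"
      by (auto simp: incseq_def le_fun_def indicator_def)
    show "(\<lambda>T. ennreal (gsup s r t) * indicator {..real T} t) \<longlonglongrightarrow> ennreal (gsup s r t)" for t
    proof (rule tendsto_eventually)
      obtain n :: nat where "t \<le> real n" using real_arch_simple by blast
      then show "\<forall>\<^sub>F T in sequentially. ennreal (gsup s r t) * indicator {..real T} t = ennreal (gsup s r t)"
        by (intro eventually_sequentiallyI[of n]) (auto simp: indicator_def)
    qed
  qed measurable
  then have "(\<lambda>T. ennreal (gconst s * trunc s T r)) \<longlonglongrightarrow> ennreal (gconst s * r powr - s)"
    unfolding nn_integral_gsup[OF s r] ennreal_trunc[OF s, symmetric]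
    using gconst_pos[OF s] trunc_nonneg[OF s] by (simp add: ennreal_mult[symmetric] mult.commute)
  then have "(\<lambda>T. gconst s * trunc s T r) \<longlonglongrightarrow> gconst s * r powr - s"
    using gconst_pos[OF s] trunc_nonneg[OF s] by (subst (asm) tendsto_ennreal_iff) auto
  then show ?thesis using gconst_pos[OF s] by (subst (asm) tendsto_mult_left_iff) auto
qed

text \<open>Within distance 1 the density is at most \<open>D\<close> and Lebesgue measure is
  translation invariant; beyond it the mass of \<open>M\<close> is at most 1. The bound does not
  depend on \<open>x\<close>, as the uniform assumptions of \<open>approx_kernel\<close>
  require.\<close>

lemma radial_integral_le:
  fixes M :: "'a::euclidean_space measure" and \<phi> :: "real \<Rightarrow> real"
  assumes M: "M = density lborel (\<lambda>x. ennreal (d x))" "prob_space M"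
    and [measurable]: "d \<in> borel_measurable borel" and d: "\<And>x. 0 \<le> d x" "\<And>x. d x \<le> D"
    and [measurable]: "\<phi> \<in> borel_measurable borel" and \<phi>: "\<And>r. 0 \<le> \<phi> r" "\<And>r. 1 \<le> r \<Longrightarrow> \<phi> r \<le> c"
  shows "(\<integral>\<^sup>+y. ennreal (\<phi> (norm (x - y))) \<partial>M) \<le>
    ennreal D * (\<integral>\<^sup>+z. ennreal (\<phi> (norm z)) * indicator (ball 0 1) z \<partial>(lborel :: 'a measure)) + ennreal c"
proof -
  interpret prob_space M by fact
  have [measurable_cong]: "sets M = sets borel" by (simp add: M(1))
  have [measurable]: "ball (0::'a) 1 \<in> sets borel" by simp
  have "(\<integral>\<^sup>+y. ennreal (\<phi> (norm (x - y))) \<partial>M) \<le>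
     (\<integral>\<^sup>+y. ennreal (\<phi> (norm (y - x))) * indicator (ball 0 1) (y - x) + ennreal c \<partial>M)"
    using \<phi> by (intro nn_integral_mono) (auto simp: indicator_def norm_minus_commute intro!: ennreal_leI add_increasing2)
  also have "\<dots> = (\<integral>\<^sup>+y. ennreal (\<phi> (norm (y - x))) * indicator (ball 0 1) (y - x) \<partial>M) + ennreal c"
    by (subst nn_integral_add) (simp_all add: emeasure_space_1)
  also have "(\<integral>\<^sup>+y. ennreal (\<phi> (norm (y - x))) * indicator (ball 0 1) (y - x) \<partial>M) =
     (\<integral>\<^sup>+y. ennreal (d y) * (ennreal (\<phi> (norm (y - x))) * indicator (ball 0 1) (y - x)) \<partial>lborel)"
    unfolding M(1) by (rule nn_integral_density) measurable
  also have "\<dots> \<le> (\<integral>\<^sup>+y. ennreal D * (ennreal (\<phi> (norm (y - x))) * indicator (ball 0 1) (y - x)) \<partial>lborel)"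
    using d by (intro nn_integral_mono mult_right_mono ennreal_leI) auto
  also have "\<dots> = ennreal D * (\<integral>\<^sup>+y. ennreal (\<phi> (norm (- x + y))) * indicator (ball 0 1) (- x + y) \<partial>lborel)"
    by (subst nn_integral_cmult) auto
  also have "(\<integral>\<^sup>+y. ennreal (\<phi> (norm (- x + y))) * indicator (ball 0 1) (- x + y) \<partial>lborel) =
      (\<integral>\<^sup>+z. ennreal (\<phi> (norm z)) * indicator (ball 0 1) z \<partial>(lborel :: 'a measure))"
    by (rule nn_integral_lborel_shift[of "\<lambda>z. ennreal (\<phi> (norm z)) * indicator (ball 0 1) z"]) measurable
  finally show ?thesis by simp
qed

lemma psd_riesz_trunc:
  fixes R1 R2 :: "'a::euclidean_space measure"
  assumes s: "0 < s"
    and R: "finite_measure R1" "finite_measure R2" "sets R1 = sets borel" "sets R2 = sets borel"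
  shows "2 * (\<integral>\<^sup>+x. \<integral>\<^sup>+y. riesz_trunc s T x y \<partial>R2 \<partial>R1)
     \<le> (\<integral>\<^sup>+x. \<integral>\<^sup>+y. riesz_trunc s T x y \<partial>R1 \<partial>R1) + (\<integral>\<^sup>+x. \<integral>\<^sup>+y. riesz_trunc s T x y \<partial>R2 \<partial>R2)"
proof -
  let ?m = "(lborel :: real measure) \<Otimes>\<^sub>M (lborel :: 'a measure)"
  let ?g = "gauss_mass TYPE('a)"
  interpret P: pair_sigma_finite "lborel :: real measure" "lborel :: 'a measure" ..
  \<comment> \<open>The mixing parameter is the pair of a scale \<open>t\<close> and a centre
    \<open>z\<close>. Dividing by the Gaussian mass in \<open>v\<close> undoes the factor from
    \<open>gauss_convolution\<close>, so that integrating out \<open>z\<close> leaves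
    \<open>exp (- t * r\<^sup>2 / 2)\<close>.\<close>
  define h :: "real \<times> 'a \<Rightarrow> 'a \<Rightarrow> ennreal" where "h p x = ennreal (exp (- fst p * (norm (x - snd p))\<^sup>2))" for p x
  define v where "v t = ennreal (indicator {0<..} t * t powr (s / 2 - 1) / gconst s) * indicator {..real T} t / ?g t" for t
  define V :: "real \<times> 'a \<Rightarrow> ennreal" where "V p = v (fst p)" for p
  have v [measurable]: "v \<in> borel_measurable borel" unfolding v_def[abs_def] by measurable
  have h' [measurable]: "(\<lambda>p. h p x) \<in> borel_measurable ?m" for x unfolding h_def[abs_def] by measurable
  have V' [measurable]: "V \<in> borel_measurable ?m" unfolding V_def[abs_def] by measurable
  show ?thesis
  proof (rule psd_superposition[where m="?m" and V=V and h=h])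
    show "sigma_finite_measure ?m" by unfold_locales
    show "(\<lambda>(p, x). h p x) \<in> borel_measurable (?m \<Otimes>\<^sub>M borel)"
      unfolding h_def by measurable
    fix x y :: 'a
    let ?r = "norm (x - y)"
    have "(\<integral>\<^sup>+p. V p * (h p x * h p y) \<partial>?m) = (\<integral>\<^sup>+t. \<integral>\<^sup>+z. V (t, z) * (h (t, z) x * h (t, z) y) \<partial>lborel \<partial>lborel)"
      by (rule lborel.nn_integral_fst[symmetric]) measurable
    also have "\<dots> = (\<integral>\<^sup>+t. (ennreal (gsup s ?r t) * indicator {..real T} t) / ennreal (gconst s) \<partial>lborel)"
    proof (rule nn_integral_cong)
      fix t :: real
      have "(\<integral>\<^sup>+z. V (t, z) * (h (t, z) x * h (t, z) y) \<partial>lborel) =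
        v t * (\<integral>\<^sup>+z. ennreal (exp (- t * (norm (x - z))\<^sup>2)) * ennreal (exp (- t * (norm (y - z))\<^sup>2)) \<partial>lborel)"
        unfolding V_def h_def fst_conv snd_conv by (rule nn_integral_cmult) measurable
      also have "\<dots> = v t * (ennreal (exp (- t * ?r\<^sup>2 / 2)) * ?g t)" unfolding gauss_convolution ..
      also have "\<dots> = (ennreal (gsup s ?r t) * indicator {..real T} t) / ennreal (gconst s)"
      proof (cases "0 < t \<and> t \<le> real T")
        case True
        have g: "?g t \<noteq> 0" "?g t \<noteq> \<top>" using gauss_mass_pos[where 'a='a] gauss_mass_finite[where 'a='a, of t] True by auto
        have "v t * (ennreal (exp (- t * ?r\<^sup>2 / 2)) * ?g t) =
            ennreal (t powr (s / 2 - 1) / gconst s) * ennreal (exp (- t * ?r\<^sup>2 / 2)) * (?g t / ?g t)"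
          using True by (simp add: v_def ennreal_divide_times ennreal_times_divide mult_ac)
        also have "?g t / ?g t = 1" using g by (intro ennreal_divide_self) (auto simp: less_top)
        also have "ennreal (t powr (s / 2 - 1) / gconst s) * ennreal (exp (- t * ?r\<^sup>2 / 2)) * 1 =
            ennreal (gsup s ?r t) / ennreal (gconst s)"
          using True gconst_pos[OF s] by (simp add: ennreal_mult[symmetric] divide_ennreal gsup_def mult_ac)
        finally show ?thesis using True by simp
      qed (auto simp: v_def gsup_def indicator_def)
      finally show "(\<integral>\<^sup>+z. V (t, z) * (h (t, z) x * h (t, z) y) \<partial>lborel) =
        (ennreal (gsup s ?r t) * indicator {..real T} t) / ennreal (gconst s)" .
    qed
    also have "\<dots> = (ennreal (trunc s T ?r) * ennreal (gconst s)) / ennreal (gconst s)"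
      unfolding ennreal_trunc[OF s] by (rule nn_integral_divide) measurable
    also have "\<dots> = ennreal (trunc s T ?r)"
      using gconst_pos[OF s] trunc_nonneg[OF s] by (simp add: ennreal_mult[symmetric] divide_ennreal)
    finally show "ennreal (riesz_trunc s T x y) = (\<integral>\<^sup>+p. V p * (h p x * h p y) \<partial>?m)"
      by (simp add: riesz_trunc_def)
  qed (use R in auto)
qed

lemma riesz_approx_kernel:
  fixes M :: "'a::euclidean_space measure"
  assumes s: "0 < s" "s < real DIM('a)"
    and M: "M = density lborel (\<lambda>x. ennreal (d x))" "prob_space M"
    and [measurable]: "d \<in> borel_measurable borel" and d: "\<And>x. 0 \<le> d x" "\<And>x. d x \<le> D"
  obtains C e where "approx_kernel M (riesz s) (riesz_trunc s) C (\<lambda>T. trunc s T 0) e"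
proof -
  interpret prob_space M by fact
  have D0: "0 \<le> D" using d order_trans by blast
  let ?B = "\<lambda>z. indicator (ball 0 1) (z::'a) :: ennreal"
  have [measurable]: "ball (0::'a) 1 \<in> sets borel" by simp
  define I0 where "I0 = (\<integral>\<^sup>+z. ennreal (norm z powr - s) * ?B z \<partial>lborel)"
  have I0: "I0 < \<infinity>" unfolding I0_def by (rule riesz_locally_integrable[OF s])
  \<comment> \<open>The added 1 bounds \<open>r powr (- s)\<close> for
    \<open>r \<ge> 1\<close>.\<close>
  define C where "C = D * enn2real I0 + 1"
  \<comment> \<open>At \<open>r = 0\<close> the difference equals \<open>- trunc s T 0\<close>,
    because \<open>0 powr (- s) = 0\<close>; the absolute value makes \<open>\<phi>\<close>
    nonnegative there as well.\<close>
  define \<phi> where "\<phi> T r = \<bar>r powr - s - trunc s T r\<bar>" for T r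
  have \<phi>m [measurable]: "\<phi> T \<in> borel_measurable borel" for T unfolding \<phi>_def[abs_def] by measurable
  have \<phi>le: "\<phi> T r \<le> r powr - s" if "0 < r" for T r
    using trunc_remainder(2)[OF s(1) that] trunc_nonneg[OF s(1), of T r] by (auto simp: \<phi>_def)
  define I where "I T = (\<integral>\<^sup>+z. ennreal (\<phi> T (norm z)) * ?B z \<partial>lborel)" for T
  have AE0: "AE z in (lborel :: 'a measure). z \<noteq> 0" by (rule AE_lborel_singleton)
  have II0: "I T \<le> I0" for T
    unfolding I_def I0_def
    by (rule nn_integral_mono_AE) (use AE0 \<phi>le in \<open>auto elim!: eventually_mono intro!: mult_right_mono ennreal_leI\<close>)
  have Ilim: "I \<longlonglongrightarrow> 0"
  proof -
    have "(\<lambda>T. I T) \<longlonglongrightarrow> (\<integral>\<^sup>+z. 0 \<partial>(lborel :: 'a measure))"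
      unfolding I_def
    proof (rule nn_integral_dominated_convergence[where w="\<lambda>z. ennreal (norm z powr - s) * ?B z"])
      show "AE z in lborel. ennreal (\<phi> T (norm z)) * ?B z \<le> ennreal (norm z powr - s) * ?B z" for T
        using AE0 by (rule eventually_mono) (use \<phi>le in \<open>auto intro!: mult_right_mono ennreal_leI\<close>)
      show "(\<integral>\<^sup>+z. ennreal (norm z powr - s) * ?B z \<partial>lborel) < \<infinity>" using I0 by (simp add: I0_def)
      show "AE z in (lborel :: 'a measure). (\<lambda>T. ennreal (\<phi> T (norm z)) * ?B z) \<longlonglongrightarrow> 0"
        using AE0
      proof (rule eventually_mono)
        fix z :: 'a assume "z \<noteq> 0"
        then have "(\<lambda>T. norm z powr - s - trunc s T (norm z)) \<longlonglongrightarrow> norm z powr - s - norm z powr - s"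
          by (intro tendsto_intros trunc_tendsto s) auto
        then have "(\<lambda>T. \<phi> T (norm z)) \<longlonglongrightarrow> 0"
          unfolding \<phi>_def by (intro tendsto_rabs_zero) simp
        then have "(\<lambda>T. ennreal (\<phi> T (norm z))) \<longlonglongrightarrow> ennreal 0" by (rule tendsto_ennrealI)
        then have "(\<lambda>T. ennreal (\<phi> T (norm z)) * ?B z) \<longlonglongrightarrow> ennreal 0 * ?B z"
          by (intro tendsto_mult_ennreal tendsto_const) (auto simp: indicator_def)
        then show "(\<lambda>T. ennreal (\<phi> T (norm z)) * ?B z) \<longlonglongrightarrow> 0" by simp
      qed
    qed simp_all
    then show ?thesis by simp
  qed
  \<comment> \<open>The error at distance below 1, which vanishes by dominated convergence, plus the
    error at distance exactly 1, which bounds the rest.\<close>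
  define e where "e T = D * enn2real (I T) + (1 - trunc s T 1)" for T
  have Ifin: "I T < \<infinity>" for T using II0 I0 by (rule le_less_trans)
  have t1: "trunc s T 1 \<le> 1" for T using trunc_remainder(2)[OF s(1), of 1 T] by simp
  have "approx_kernel M (riesz s) (riesz_trunc s) C (\<lambda>T. trunc s T 0) e"
  proof unfold_locales
    show "sets M = sets borel" by (simp add: M(1))
    show "(\<lambda>(x, y). riesz s x y :: real) \<in> borel_measurable (borel \<Otimes>\<^sub>M (borel :: 'a measure))"
      unfolding riesz_def by measurable
    show "(\<lambda>(x, y). riesz_trunc s T x y) \<in> borel_measurable (borel \<Otimes>\<^sub>M (borel :: 'a measure))" for T
      unfolding riesz_trunc_def by measurable
    show "0 \<le> riesz s x y" "riesz s x y = riesz s y x" "riesz s x x = 0" for x y :: 'a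
      by (simp_all add: riesz_def norm_minus_commute)
    show "0 \<le> riesz_trunc s T x y" "riesz_trunc s T x y = riesz_trunc s T y x" "riesz_trunc s T x y \<le> trunc s T 0" for T and x y :: 'a
      by (simp_all add: riesz_trunc_def norm_minus_commute trunc_nonneg trunc_antimono s)
    show "riesz_trunc s T x y \<le> riesz s x y" if "x \<noteq> y" for T and x y :: 'a
      using that unfolding riesz_trunc_def riesz_def by (intro trunc_remainder(2) s) auto
    show "AE y in M. y \<noteq> x" for x
      unfolding M(1) by (subst AE_density) (auto intro: eventually_mono[OF AE_lborel_singleton])
    show "0 \<le> C" using D0 by (simp add: C_def)
    show "(\<integral>\<^sup>+y. riesz s x y \<partial>M) \<le> ennreal C" for x
    proof -
      have "(\<integral>\<^sup>+y. riesz s x y \<partial>M) \<le> ennreal D * I0 + ennreal 1"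
        unfolding riesz_def I0_def
        using s powr_mono2'[of 1 "s" ] by (intro radial_integral_le[OF M]) (auto intro!: d powr_le_one_le simp: powr_minus divide_simps ge_one_powr_ge_zero)
      also have "\<dots> = ennreal C" using I0 D0 by (simp add: C_def ennreal_mult' less_top)
      finally show ?thesis .
    qed
    show "0 \<le> e T" for T using D0 t1[of T] by (simp add: e_def)
    show "(\<integral>\<^sup>+y. \<bar>riesz s x y - riesz_trunc s T x y\<bar> \<partial>M) \<le> ennreal (e T)" for T x
    proof -
      have "(\<integral>\<^sup>+y. \<bar>riesz s x y - riesz_trunc s T x y\<bar> \<partial>M) = (\<integral>\<^sup>+y. ennreal (\<phi> T (norm (x - y))) \<partial>M)"
        by (simp add: riesz_def riesz_trunc_def \<phi>_def)
      also have "\<dots> \<le> ennreal D * I T + ennreal (1 - trunc s T 1)"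
        unfolding I_def
      proof (rule radial_integral_le[OF M])
        show "\<phi> T r \<le> 1 - trunc s T 1" if "1 \<le> r" for r
          using remainder_antimono[OF s(1), of 1 r T] trunc_remainder(2)[OF s(1), of r T] that by (simp add: \<phi>_def)
      qed (auto intro: d simp: \<phi>_def)
      also have "\<dots> = ennreal (e T)" using Ifin[of T] D0 t1[of T] by (simp add: e_def ennreal_mult' less_top)
      finally show ?thesis .
    qed
    have "(\<lambda>T. enn2real (I T)) \<longlonglongrightarrow> 0" by (rule tendsto_enn2real) (use Ilim in simp_all)
    then have "(\<lambda>T. D * enn2real (I T) + (1 - trunc s T 1)) \<longlonglongrightarrow> D * 0 + (1 - 1 powr - s)"
      by (intro tendsto_add tendsto_mult tendsto_diff tendsto_const trunc_tendsto s) auto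
    then show "e \<longlonglongrightarrow> 0" unfolding e_def[abs_def] by simp
  qed (rule psd_riesz_trunc[OF s(1)])
  then show thesis by (rule that)
qed

section \<open>Poisson processes\<close>

lemma space_config_algebra: "space config_algebra = point_configs"
  unfolding config_algebra_def space_Sup_eq_UN by (auto intro!: bexI[of _ "{}"])

lemma sets_config_algebra:
  "sets config_algebra =
    sigma_sets point_configs (\<Union>B\<in>sets borel. sets (vimage_algebra point_configs (\<lambda>\<mu>. emeasure \<mu> B) borel))"
  unfolding config_algebra_def by (subst sets_Sup_eq[where X=point_configs]) auto

lemma measurable_config_algebraI:
  fixes f :: "'w \<Rightarrow> 'a::euclidean_space measure"
  assumes f: "\<And>w. w \<in> space M \<Longrightarrow> f w \<in> point_configs"
    and m: "\<And>B. B \<in> sets borel \<Longrightarrow> (\<lambda>w. emeasure (f w) B) \<in> borel_measurable M"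
  shows "f \<in> measurable M config_algebra"
proof (rule measurable_sigma_sets[OF sets_config_algebra])
  show "(\<Union>B\<in>sets borel. sets (vimage_algebra point_configs (\<lambda>\<mu>. emeasure \<mu> B) borel)) \<subseteq> Pow (point_configs :: 'a measure set)"
    by (auto simp: sets_vimage_algebra2)
  fix y :: "'a measure set" assume "y \<in> (\<Union>B\<in>sets borel. sets (vimage_algebra point_configs (\<lambda>\<mu>. emeasure \<mu> B) borel))"
  then obtain B A where B: "B \<in> sets borel" and A: "A \<in> sets borel" and y: "y = (\<lambda>\<mu>. emeasure \<mu> B) -` A \<inter> point_configs"
    by (auto simp: sets_vimage_algebra2)
  have "f -` y \<inter> space M = (\<lambda>w. emeasure (f w) B) -` A \<inter> space M"
    using f by (auto simp: y)
  then show "f -` y \<inter> space M \<in> sets M" using measurable_sets[OF m[OF B] A] by simp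
qed (use f in auto)

lemma emeasure_config_measurable:
  assumes B: "B \<in> sets borel"
  shows "(\<lambda>\<mu>. emeasure \<mu> B) \<in> borel_measurable (config_algebra :: 'a::euclidean_space measure measure)"
proof (rule measurableI)
  fix A :: "ennreal set" assume A: "A \<in> sets borel"
  have "(\<lambda>\<mu>. emeasure \<mu> B) -` A \<inter> point_configs \<in> sets (vimage_algebra (point_configs :: 'a measure set) (\<lambda>\<mu>. emeasure \<mu> B) borel)"
    using A by (auto simp: sets_vimage_algebra2)
  then show "(\<lambda>\<mu>. emeasure \<mu> B) -` A \<inter> space config_algebra \<in> sets config_algebra"
    unfolding space_config_algebra sets_config_algebra using B by (intro sigma_sets.Basic) blast
qed auto

lemma nn_integral_config_measurable:
  fixes f :: "'a::euclidean_space \<Rightarrow> ennreal"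
  assumes "f \<in> borel_measurable borel"
  shows "(\<lambda>\<mu>. \<integral>\<^sup>+x. f x \<partial>\<mu>) \<in> borel_measurable (config_algebra :: 'a measure measure)"
proof -
  let ?C = "config_algebra :: 'a measure measure"
  have s: "sets \<mu> = sets borel" if "\<mu> \<in> space ?C" for \<mu>
    using that by (simp add: space_config_algebra point_configs_def)
  have m: "f \<in> borel_measurable \<mu>" if "\<mu> \<in> space ?C" "f \<in> borel_measurable borel"
    for f :: "'a \<Rightarrow> ennreal" and \<mu>
    using that(2) by (simp add: measurable_cong_sets[OF s[OF that(1)] refl])
  show ?thesis
    using assms
  proof induct
    case (cong f g)
    have "f = g" by (rule ext) (rule cong(3), simp)
    with cong(4) show ?case by (simp only:)
  next
    case (set B)
    have "(\<integral>\<^sup>+x. indicator B x \<partial>\<mu>) = emeasure \<mu> B" if "\<mu> \<in> space ?C" for \<mu>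
      using set s[OF that] by (intro nn_integral_indicator) simp
    then show ?case
      by (subst measurable_cong[where g="\<lambda>\<mu>. emeasure \<mu> B"]) (auto intro: emeasure_config_measurable[OF set])
  next
    case (mult f c)
    have "(\<integral>\<^sup>+x. c * f x \<partial>\<mu>) = c * (\<integral>\<^sup>+x. f x \<partial>\<mu>)" if "\<mu> \<in> space ?C" for \<mu>
      by (rule nn_integral_cmult) (rule m[OF that mult(2)])
    then show ?case
      by (subst measurable_cong[where g="\<lambda>\<mu>. c * (\<integral>\<^sup>+x. f x \<partial>\<mu>)"])
        (auto intro: borel_measurable_times_ennreal mult(4))
  next
    case (add f g)
    have "(\<integral>\<^sup>+x. g x + f x \<partial>\<mu>) = (\<integral>\<^sup>+x. g x \<partial>\<mu>) + (\<integral>\<^sup>+x. f x \<partial>\<mu>)" if "\<mu> \<in> space ?C" for \<mu>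
      by (rule nn_integral_add) (rule m[OF that add(4)], rule m[OF that add(1)])
    then show ?case
      by (subst measurable_cong[where g="\<lambda>\<mu>. (\<integral>\<^sup>+x. g x \<partial>\<mu>) + (\<integral>\<^sup>+x. f x \<partial>\<mu>)"])
        (auto intro: borel_measurable_add add(3,7))
  next
    case (seq F)
    have eq: "(\<integral>\<^sup>+x. (SUP i. F i) x \<partial>\<mu>) = (SUP i. \<integral>\<^sup>+x. F i x \<partial>\<mu>)" if "\<mu> \<in> space ?C" for \<mu>
      unfolding SUP_apply by (rule nn_integral_monotone_convergence_SUP[OF seq(4)]) (rule m[OF that seq(1)])
    have "(\<lambda>\<mu>. SUP i. \<integral>\<^sup>+x. F i x \<partial>\<mu>) \<in> borel_measurable ?C"
      by (rule borel_measurable_SUP) (auto intro: seq(3))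
    then show ?case
      by (rule measurable_cong[THEN iffD2, rotated]) (rule eq)
  qed
qed

lemma laplace_integrand_eq:
  fixes f :: "'a::euclidean_space \<Rightarrow> real"
  assumes "f \<in> borel_measurable borel" "\<And>x. 0 \<le> f x" "sets \<mu> = sets borel"
  shows "(\<integral>x. f x \<partial>\<mu>) = enn2real (\<integral>\<^sup>+x. f x \<partial>\<mu>)"
  using assms by (intro integral_eq_nn_integral) (auto simp: measurable_cong_sets[OF assms(3) refl])

text \<open>Replaces a process on an auxiliary space by the identity under its law. The theorem asks
  for a process defined on a space of measures, which is not where the construction below
  lives.\<close>

lemma laplace_functional_distr:
  fixes X :: "'w \<Rightarrow> 'a::euclidean_space measure"
  assumes X: "X \<in> measurable M config_algebra" and f: "f \<in> borel_measurable borel" "\<And>x. 0 \<le> f x"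
  shows "laplace_functional (distr M config_algebra X) (\<lambda>\<mu>. \<mu>) f = laplace_functional M X f"
  unfolding laplace_functional_def
proof (rule integral_distr[OF X])
  have "(\<lambda>\<mu>. exp (- enn2real (\<integral>\<^sup>+x. f x \<partial>\<mu>))) \<in> borel_measurable (config_algebra :: 'a measure measure)"
    using nn_integral_config_measurable[of "\<lambda>x. ennreal (f x)"] f by measurable
  moreover have "exp (- (\<integral>x. f x \<partial>\<mu>)) = exp (- enn2real (\<integral>\<^sup>+x. f x \<partial>\<mu>))" if "\<mu> \<in> space config_algebra" for \<mu>
    using that laplace_integrand_eq[OF f, of \<mu>] by (simp add: space_config_algebra point_configs_def)
  ultimately show "(\<lambda>\<mu>. exp (- (\<integral>x. f x \<partial>\<mu>))) \<in> borel_measurable (config_algebra :: 'a measure measure)"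
    using measurable_cong[of config_algebra "\<lambda>\<mu>. exp (- (\<integral>x. f x \<partial>\<mu>))" "\<lambda>\<mu>. exp (- enn2real (\<integral>\<^sup>+x. f x \<partial>\<mu>))" borel]
    by blast
qed

lemma test_function_bounded_support:
  assumes "f \<in> test_functions" obtains R where "0 < R" "\<And>x. R \<le> norm x \<Longrightarrow> f x = 0"
proof -
  have "bounded {x. f x \<noteq> 0}"
    using assms compact_imp_bounded bounded_subset[OF _ closure_subset] by (auto simp: test_functions_def)
  then obtain R where R: "0 < R" "\<And>x. f x \<noteq> 0 \<Longrightarrow> norm x < R" by (auto simp: bounded_pos_less)
  show thesis
  proof (rule that[OF R(1)])
    show "f x = 0" if "R \<le> norm x" for x using R(2)[of x] that by (cases "f x = 0") simp_all
  qed
qed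

lemma test_function_measurable: "f \<in> test_functions \<Longrightarrow> f \<in> borel_measurable borel"
  by (auto simp: test_functions_def intro: borel_measurable_continuous_onI)

lemma test_function_nonneg: "f \<in> test_functions \<Longrightarrow> 0 \<le> f x"
  by (auto simp: test_functions_def)

section \<open>Construction of a Poisson process, shell by shell\<close>

lemma (in product_prob_space) nn_integral_PiM_prod_finite:
  assumes J: "finite J" "J \<subseteq> I" and f: "\<And>i. i \<in> J \<Longrightarrow> f i \<in> borel_measurable (M i)"
  shows "(\<integral>\<^sup>+\<omega>. (\<Prod>i\<in>J. f i (\<omega> i)) \<partial>PiM I M) = (\<Prod>i\<in>J. integral\<^sup>N (M i) (f i))"
proof -
  have "(\<integral>\<^sup>+\<omega>. (\<Prod>i\<in>J. f i (\<omega> i)) \<partial>PiM I M) = (\<integral>\<^sup>+\<omega>. (\<Prod>i\<in>J. f i (restrict \<omega> J i)) \<partial>PiM I M)"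
    by (intro nn_integral_cong prod.cong) auto
  also have "\<dots> = (\<integral>\<^sup>+\<omega>. (\<Prod>i\<in>J. f i (\<omega> i)) \<partial>distr (PiM I M) (PiM J M) (\<lambda>x. restrict x J))"
    using J f by (intro nn_integral_distr[symmetric] measurable_restrict_subset borel_measurable_prod_ennreal) auto
  also have "\<dots> = (\<Prod>i\<in>J. integral\<^sup>N (M i) (f i))"
    unfolding distr_PiM_restrict_finite[OF J] using J f by (intro product_nn_integral_prod) auto
  finally show ?thesis .
qed

definition shell :: "nat \<Rightarrow> 'a::euclidean_space set" where
  "shell k = {x. real k \<le> norm x \<and> norm x < real k + 1}"

lemma shell_borel [measurable]: "shell k \<in> sets borel"
  unfolding shell_def by measurable

lemma shell_finite: "emeasure lborel (shell k :: 'a::euclidean_space set) < \<infinity>"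
proof -
  have "emeasure lborel (shell k :: 'a set) \<le> emeasure lborel (ball (0::'a) (real k + 1))"
    by (rule emeasure_mono) (auto simp: shell_def)
  also have "\<dots> < \<infinity>" using emeasure_lborel_ball_finite[of "0::'a" "real k + 1"] by simp
  finally show ?thesis .
qed

lemma shell_pos: "emeasure lborel (shell k :: 'a::euclidean_space set) \<noteq> 0"
proof
  assume 0: "emeasure lborel (shell k :: 'a set) = 0"
  obtain b :: 'a where b: "b \<in> Basis" using nonempty_Basis by blast
  define c where "c = (real k + 1 / 2) *\<^sub>R b"
  have nc: "norm c = real k + 1 / 2" using b by (simp add: c_def)
  have "ball c (1 / 4) \<subseteq> shell k"
  proof
    fix x assume "x \<in> ball c (1 / 4)"
    then have "norm (x - c) < 1 / 4" by (simp add: dist_norm norm_minus_commute)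
    then have "\<bar>norm x - norm c\<bar> < 1 / 4" using norm_triangle_ineq3[of x c] by linarith
    then show "x \<in> shell k" unfolding shell_def nc mem_Collect_eq by linarith
  qed
  then have "emeasure lborel (ball c (1 / 4)) = 0"
    using emeasure_mono[of "ball c (1 / 4)" "shell k" lborel] 0 by simp
  then have "negligible (ball c (1 / 4))"
    by (intro negligible_iff_null_sets[THEN iffD2]) (auto simp: null_sets_def intro: null_sets_completionI)
  then show False using open_not_negligible[of "ball c (1 / 4)"] by simp
qed

lemma mem_shell_iff: "x \<in> shell k \<longleftrightarrow> k = nat \<lfloor>norm x\<rfloor>"
proof -
  have "(real k \<le> norm x \<and> norm x < real k + 1) \<longleftrightarrow> \<lfloor>norm x\<rfloor> = int k"
    by (simp add: floor_eq_iff)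
  also have "\<dots> \<longleftrightarrow> k = nat \<lfloor>norm x\<rfloor>" by auto
  finally show ?thesis by (simp add: shell_def)
qed

lemma nn_integral_poisson_pgf:
  assumes r: "0 < r" and a: "0 \<le> a"
  shows "(\<integral>\<^sup>+n. ennreal (a ^ n) \<partial>measure_pmf (poisson_pmf r)) = ennreal (exp (r * (a - 1)))"
proof -
  have s: "(\<lambda>n. exp (- r) * ((r * a) ^ n / fact n)) sums (exp (- r) * exp (r * a))"
    using exp_converges[of "r * a"] by (intro sums_mult) (simp add: divide_inverse mult.commute)
  have "(\<integral>\<^sup>+n. ennreal (a ^ n) \<partial>measure_pmf (poisson_pmf r)) = (\<Sum>n. ennreal (exp (- r) * ((r * a) ^ n / fact n)))"
    unfolding nn_integral_measure_pmf nn_integral_count_space_nat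
    using r a by (intro suminf_cong) (simp add: ennreal_mult[symmetric] power_mult_distrib mult_ac)
  also have "\<dots> = ennreal (\<Sum>n. exp (- r) * ((r * a) ^ n / fact n))"
    using r a s by (intro suminf_ennreal2) (auto simp: sums_iff)
  also have "(\<Sum>n. exp (- r) * ((r * a) ^ n / fact n)) = exp (r * (a - 1))"
    using s by (simp add: sums_iff exp_add[symmetric] algebra_simps)
  finally show ?thesis .
qed

text \<open>In each shell \<open>k\<close>, \<open>fst (\<omega> k)\<close> is the number of points and \<open>snd (\<omega> k)\<close> lists candidates for
  them. Candidates outside the shell, almost surely absent, are discarded so that the configuration
  is locally finite for every \<open>\<omega>\<close>.\<close>

definition poisson_config :: "(nat \<Rightarrow> nat \<times> (nat \<Rightarrow> 'a::euclidean_space)) \<Rightarrow> 'a measure" where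
  "poisson_config \<omega> =
    distr (count_space {(k, j). j < fst (\<omega> k) \<and> snd (\<omega> k) j \<in> shell k}) borel (\<lambda>(k, j). snd (\<omega> k) j)"

definition shell_sum :: "('a::euclidean_space \<Rightarrow> ennreal) \<Rightarrow> nat \<Rightarrow> nat \<times> (nat \<Rightarrow> 'a) \<Rightarrow> ennreal" where
  "shell_sum f k p = (\<Sum>j<fst p. f (snd p j) * indicator (shell k) (snd p j))"

lemma nn_integral_poisson_config:
  fixes f :: "'a::euclidean_space \<Rightarrow> ennreal"
  assumes [measurable]: "f \<in> borel_measurable borel"
  shows "(\<integral>\<^sup>+x. f x \<partial>poisson_config \<omega>) = (\<Sum>k. shell_sum f k (\<omega> k))"
proof -
  let ?S = "{(k, j). j < fst (\<omega> k) \<and> snd (\<omega> k) j \<in> shell k}"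
  let ?h = "\<lambda>(k, j). f (snd (\<omega> k) j) * indicator ?S (k, j)"
  have "(\<integral>\<^sup>+x. f x \<partial>poisson_config \<omega>) = (\<integral>\<^sup>+(k, j). f (snd (\<omega> k) j) \<partial>count_space ?S)"
    unfolding poisson_config_def by (subst nn_integral_distr) (auto simp: split_beta')
  also have "\<dots> = (\<integral>\<^sup>+p. ?h p \<partial>count_space UNIV)"
    by (subst nn_integral_count_space_indicator) (auto intro!: nn_integral_cong simp: split_beta')
  also have "\<dots> = (\<integral>\<^sup>+k. \<integral>\<^sup>+j. ?h (k, j) \<partial>count_space UNIV \<partial>count_space UNIV)"
    by (rule nn_integral_fst_count_space[symmetric])
  also have "\<dots> = (\<Sum>k. \<Sum>j. ?h (k, j))"
    by (simp only: nn_integral_count_space_nat)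
  also have "\<dots> = (\<Sum>k. shell_sum f k (\<omega> k))"
  proof (rule suminf_cong)
    fix k
    have "(\<Sum>j. ?h (k, j)) = (\<Sum>j<fst (\<omega> k). ?h (k, j))"
      by (rule suminf_finite) auto
    also have "\<dots> = shell_sum f k (\<omega> k)"
      unfolding shell_sum_def by (intro sum.cong refl) (auto simp: indicator_def)
    finally show "(\<Sum>j. ?h (k, j)) = shell_sum f k (\<omega> k)" .
  qed
  finally show ?thesis .
qed

lemma poisson_config_bounded_support:
  fixes f :: "'a::euclidean_space \<Rightarrow> ennreal"
  assumes f: "f \<in> borel_measurable borel" and R: "\<And>x. real n \<le> norm x \<Longrightarrow> f x = 0"
  shows "(\<integral>\<^sup>+x. f x \<partial>poisson_config \<omega>) = (\<Sum>k<n. shell_sum f k (\<omega> k))"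
  unfolding nn_integral_poisson_config[OF f]
proof (rule suminf_finite)
  fix k assume "k \<notin> {..<n}"
  then have "f x * indicator (shell k) x = 0" for x
    using R[of x] by (cases "x \<in> shell k") (auto simp: shell_def)
  then show "shell_sum f k (\<omega> k) = 0" unfolding shell_sum_def by (simp only: sum.neutral_const)
qed auto

lemma poisson_config_in_point_configs: "poisson_config \<omega> \<in> (point_configs :: 'a::euclidean_space measure set)"
  unfolding point_configs_def
proof (intro CollectI conjI ballI impI)
  show sb: "sets (poisson_config \<omega>) = sets borel" by (simp add: poisson_config_def)
  fix B :: "'a set" assume B: "B \<in> sets borel" and "bounded B"
  then obtain R where R: "\<And>x. x \<in> B \<Longrightarrow> norm x < R" by (auto simp: bounded_pos_less)
  obtain n :: nat where n: "R \<le> real n" using real_arch_simple by blast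
  have "emeasure (poisson_config \<omega>) B = (\<integral>\<^sup>+x. indicator B x \<partial>poisson_config \<omega>)"
    using B sb by (intro nn_integral_indicator[symmetric]) simp
  also have "\<dots> = (\<Sum>k<n. shell_sum (indicator B) k (\<omega> k))"
  proof (rule poisson_config_bounded_support)
    show "indicator B x = (0::ennreal)" if "real n \<le> norm x" for x
      using R[of x] n that by (cases "x \<in> B") auto
  qed (use B in simp)
  also have "\<dots> = of_nat (\<Sum>k<n. \<Sum>j<fst (\<omega> k). if snd (\<omega> k) j \<in> B \<inter> shell k then 1 else 0)"
    unfolding shell_sum_def of_nat_sum by (intro sum.cong refl) (auto simp: indicator_def)
  finally show "\<exists>m::nat. emeasure (poisson_config \<omega>) B = of_nat m" by blast
qed

text \<open>The \<open>itself\<close> argument ties the locale to the type of points, which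
  \<open>\<theta>\<close> alone does not mention.\<close>

locale poisson_space =
  fixes \<theta> :: real and dummy :: "'a::euclidean_space itself"
  assumes theta_pos: "0 < \<theta>"
begin

definition unif :: "nat \<Rightarrow> 'a measure" where
  "unif k = uniform_measure lborel (shell k)"

definition rate :: "nat \<Rightarrow> real" where
  "rate k = \<theta> * measure lborel (shell k :: 'a set)"

text \<open>An infinite list of candidates, drawn independently of the count, makes a random number
  of points out of a plain product measure.\<close>

definition comp :: "nat \<Rightarrow> (nat \<times> (nat \<Rightarrow> 'a)) measure" where
  "comp k = measure_pmf (poisson_pmf (rate k)) \<Otimes>\<^sub>M PiM UNIV (\<lambda>_. unif k)"

definition Om :: "(nat \<Rightarrow> nat \<times> (nat \<Rightarrow> 'a)) measure" where
  "Om = PiM UNIV comp"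

lemma vol_pos: "0 < measure lborel (shell k :: 'a set)"
  using shell_pos[of k, where 'a='a] shell_finite[of k, where 'a='a]
  by (simp add: measure_def enn2real_positive_iff less_top zero_less_iff_neq_zero)

lemma vol_eq: "emeasure lborel (shell k :: 'a set) = ennreal (measure lborel (shell k :: 'a set))"
  using shell_finite[of k, where 'a='a] by (intro emeasure_eq_ennreal_measure) (simp add: less_top)

lemma rate_pos: "0 < rate k"
  using theta_pos vol_pos by (simp add: rate_def)

lemma prob_unif: "prob_space (unif k)"
  unfolding unif_def using shell_pos[of k, where 'a='a] shell_finite[of k, where 'a='a]
  by (intro prob_space_uniform_measure) auto

lemma sets_unif [measurable_cong]: "sets (unif k) = sets borel"
  by (simp add: unif_def)

lemma prob_comp: "prob_space (comp k)"
proof -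
  interpret U: prob_space "PiM UNIV (\<lambda>_::nat. unif k)" by (intro prob_space_PiM prob_unif)
  interpret P: pair_prob_space "measure_pmf (poisson_pmf (rate k))" "PiM UNIV (\<lambda>_::nat. unif k)" ..
  show ?thesis unfolding comp_def by (rule P.prob_space_axioms)
qed

lemma prob_Om: "prob_space Om"
  unfolding Om_def by (intro prob_space_PiM prob_comp)

lemma point_measurable [measurable]: "(\<lambda>p. snd p j) \<in> borel_measurable (comp k)"
proof -
  have "(\<lambda>x. x j) \<in> measurable (PiM UNIV (\<lambda>_::nat. unif k)) (unif k)"
    by (rule measurable_component_singleton) simp
  then have "(\<lambda>x. x j) \<in> borel_measurable (PiM UNIV (\<lambda>_::nat. unif k))"
    by (simp add: measurable_cong_sets[OF refl sets_unif])
  then show ?thesis unfolding comp_def by (rule measurable_compose[OF measurable_snd])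
qed

lemma count_measurable [measurable]: "fst \<in> measurable (comp k) (count_space UNIV)"
proof -
  have "fst \<in> measurable (comp k) (measure_pmf (poisson_pmf (rate k)))" unfolding comp_def by (rule measurable_fst)
  then show ?thesis by (simp add: measurable_cong_sets[OF refl sets_measure_pmf_count_space])
qed

lemma shell_sum_measurable [measurable]:
  assumes [measurable]: "f \<in> borel_measurable borel"
  shows "shell_sum f k \<in> borel_measurable (comp k)"
proof -
  \<comment> \<open>Moving the random upper limit of the sum into the summands exposes
    measurability.\<close>
  have "shell_sum f k = (\<lambda>p. \<Sum>j. if j < fst p then f (snd p j) * indicator (shell k) (snd p j) else 0)"
  proof
    fix p
    have "(\<Sum>j. if j < fst p then f (snd p j) * indicator (shell k) (snd p j) else 0) =
        (\<Sum>j<fst p. if j < fst p then f (snd p j) * indicator (shell k) (snd p j) else 0)"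
      by (rule suminf_finite) auto
    then show "shell_sum f k p = (\<Sum>j. if j < fst p then f (snd p j) * indicator (shell k) (snd p j) else 0)"
      by (simp add: shell_sum_def)
  qed
  then show ?thesis by simp
qed

lemma poisson_config_measurable: "poisson_config \<in> measurable Om config_algebra"
proof (rule measurable_config_algebraI)
  fix B :: "'a set" assume B [measurable]: "B \<in> sets borel"
  have "emeasure (poisson_config \<omega>) B = (\<Sum>k. shell_sum (indicator B) k (\<omega> k))" for \<omega>
    using B nn_integral_poisson_config[of "indicator B" \<omega>]
    by (simp add: poisson_config_def)
  moreover have "(\<lambda>\<omega>. shell_sum (indicator B) k (\<omega> k)) \<in> borel_measurable Om" for k
    unfolding Om_def by (rule measurable_compose[OF measurable_component_singleton[of k UNIV comp] shell_sum_measurable]) auto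
  ultimately show "(\<lambda>\<omega>. emeasure (poisson_config \<omega>) B) \<in> borel_measurable Om" by simp
qed (rule poisson_config_in_point_configs)

text \<open>Given the count \<open>n\<close>, the integral is \<open>a ^ n\<close>, where
  \<open>a\<close> is the mean of \<open>exp (- f)\<close> over the shell. The Poisson generating
  function gives \<open>exp (rate k * (a - 1))\<close>, and since the rate is
  \<open>\<theta>\<close> times the volume, the mean becomes an integral over the shell.\<close>

lemma nn_integral_comp:
  assumes f [measurable]: "f \<in> borel_measurable borel" and f0: "\<And>x. 0 \<le> f x"
  shows "(\<integral>\<^sup>+p. (\<Prod>j<fst p. ennreal (exp (- (f (snd p j) * indicator (shell k) (snd p j))))) \<partial>comp k)
    = ennreal (exp (\<theta> * (\<integral>x. (exp (- f x) - 1) * indicator (shell k) x \<partial>lborel)))"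
proof -
  let ?U = "PiM UNIV (\<lambda>_::nat. unif k)"
  let ?V = "measure lborel (shell k :: 'a set)"
  interpret U: product_prob_space "\<lambda>_::nat. unif k" UNIV
    by (intro product_prob_spaceI prob_unif)
  have sf: "sigma_finite_measure ?U" by (intro prob_space_imp_sigma_finite prob_space_PiM prob_unif)
  define \<phi> where "\<phi> x = exp (- (f x * indicator (shell k) x))" for x
  have [measurable]: "\<phi> \<in> borel_measurable borel" unfolding \<phi>_def by measurable
  define a where "a = (\<integral>x. exp (- f x) * indicator (shell k) x \<partial>lborel) / ?V"
  have i1: "integrable lborel (indicator (shell k) :: 'a \<Rightarrow> real)"
    using shell_finite[of k, where 'a='a] by (intro integrable_real_indicator) auto
  have i2: "integrable lborel (\<lambda>x. exp (- f x) * indicator (shell k) x)"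
    by (rule Bochner_Integration.integrable_bound[OF i1]) (use f0 in \<open>auto simp: indicator_def\<close>)
  have nn: "(\<integral>\<^sup>+x. ennreal (exp (- f x) * indicator (shell k) x) \<partial>lborel) = ennreal (a * ?V)"
    using vol_pos[of k] by (subst nn_integral_eq_integral[OF i2]) (auto simp: a_def)
  have a0: "0 \<le> a" by (auto simp: a_def intro!: divide_nonneg_nonneg Bochner_Integration.integral_nonneg)
  have "(\<integral>\<^sup>+x. ennreal (\<phi> x) \<partial>unif k) = (\<integral>\<^sup>+x. ennreal (\<phi> x) * indicator (shell k) x \<partial>lborel) / emeasure lborel (shell k :: 'a set)"
    unfolding unif_def by (rule nn_integral_uniform_measure) (use shell_pos shell_finite in auto)
  also have "(\<integral>\<^sup>+x. ennreal (\<phi> x) * indicator (shell k) x \<partial>lborel) = (\<integral>\<^sup>+x. ennreal (exp (- f x) * indicator (shell k) x) \<partial>lborel)"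
    by (intro nn_integral_cong) (auto simp: indicator_def \<phi>_def)
  also have "\<dots> / emeasure lborel (shell k :: 'a set) = ennreal a"
    unfolding nn vol_eq using vol_pos[of k] a0 by (simp add: divide_ennreal)
  finally have U1: "(\<integral>\<^sup>+x. ennreal (\<phi> x) \<partial>unif k) = ennreal a" .
  have m: "(\<lambda>p. \<Prod>j<fst p. ennreal (\<phi> (snd p j))) \<in> borel_measurable (comp k)"
  proof (rule measurable_compose_countable[where f="\<lambda>n p. \<Prod>j<n. ennreal (\<phi> (snd p j))", OF _ count_measurable])
    show "(\<lambda>p. \<Prod>j<n. ennreal (\<phi> (snd p j))) \<in> borel_measurable (comp k)" for n by measurable
  qed
  have "(\<integral>\<^sup>+p. (\<Prod>j<fst p. ennreal (\<phi> (snd p j))) \<partial>comp k) =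
    (\<integral>\<^sup>+n. \<integral>\<^sup>+x. (\<Prod>j<n. ennreal (\<phi> (x j))) \<partial>?U \<partial>measure_pmf (poisson_pmf (rate k)))"
    using sigma_finite_measure.nn_integral_fst[OF sf m[unfolded comp_def]] by (simp add: comp_def)
  also have "\<dots> = (\<integral>\<^sup>+n. ennreal (a ^ n) \<partial>measure_pmf (poisson_pmf (rate k)))"
  proof (rule nn_integral_cong)
    fix n
    have "(\<integral>\<^sup>+x. (\<Prod>j<n. ennreal (\<phi> (x j))) \<partial>?U) = (\<Prod>j<n. \<integral>\<^sup>+x. ennreal (\<phi> x) \<partial>unif k)"
      by (rule U.nn_integral_PiM_prod_finite) auto
    then show "(\<integral>\<^sup>+x. (\<Prod>j<n. ennreal (\<phi> (x j))) \<partial>?U) = ennreal (a ^ n)"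
      using a0 by (simp add: U1 ennreal_power)
  qed
  also have "\<dots> = ennreal (exp (rate k * (a - 1)))"
    by (rule nn_integral_poisson_pgf[OF rate_pos a0])
  also have "rate k * (a - 1) = \<theta> * (\<integral>x. (exp (- f x) - 1) * indicator (shell k) x \<partial>lborel)"
  proof -
    have "(\<integral>x. (exp (- f x) - 1) * indicator (shell k) x \<partial>lborel) =
        (\<integral>x. exp (- f x) * indicator (shell k) x \<partial>lborel) - ?V"
      using i1 i2 by (simp add: left_diff_distrib)
    also have "\<dots> = ?V * (a - 1)" using vol_pos[of k] by (simp add: a_def field_simps)
    finally show ?thesis by (simp add: rate_def)
  qed
  finally show ?thesis unfolding \<phi>_def .
qed

text \<open>Only the shells that meet the support of \<open>f\<close> matter, and they are finitely
  many. Independence multiplies their contributions, and the exponents add up because the shells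
  partition the space.\<close>

lemma laplace_poisson_config:
  assumes f: "f \<in> test_functions"
  shows "laplace_functional Om poisson_config f = exp (\<theta> * (\<integral>x. exp (- f x) - 1 \<partial>lborel))"
proof -
  interpret P: product_prob_space comp UNIV by (intro product_prob_spaceI prob_comp)
  have fm [measurable]: "f \<in> borel_measurable borel" and f0: "\<And>x. 0 \<le> f x"
    using f test_function_measurable test_function_nonneg by auto
  obtain R where R: "\<And>x. R \<le> norm x \<Longrightarrow> f x = 0" using test_function_bounded_support[OF f] by metis
  obtain n :: nat where n: "R \<le> real n" using real_arch_simple by blast
  have fn: "f x = 0" if "real n \<le> norm x" for x using R n that by (intro R) linarith
  let ?g = "\<lambda>k p. \<Prod>j<fst p. ennreal (exp (- (f (snd p j) * indicator (shell k) (snd p j))))"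
  have e: "ennreal (exp (- (\<integral>x. f x \<partial>poisson_config \<omega>))) = (\<Prod>k<n. ?g k (\<omega> k))" for \<omega>
  proof -
    define S where "S = (\<Sum>k<n. \<Sum>j<fst (\<omega> k). f (snd (\<omega> k) j) * indicator (shell k) (snd (\<omega> k) j))"
    have S0: "0 \<le> S" unfolding S_def using f0 by (intro sum_nonneg) auto
    have "(\<integral>\<^sup>+x. ennreal (f x) \<partial>poisson_config \<omega>) = (\<Sum>k<n. shell_sum (\<lambda>x. ennreal (f x)) k (\<omega> k))"
      by (rule poisson_config_bounded_support) (use fn in auto)
    also have "\<dots> = ennreal S"
      unfolding shell_sum_def S_def using f0
      by (simp add: sum_nonneg sum_ennreal[symmetric] ennreal_mult ennreal_indicator del: sum_ennreal)
    finally have "(\<integral>x. f x \<partial>poisson_config \<omega>) = S"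
      using laplace_integrand_eq[OF fm f0, of "poisson_config \<omega>"] S0 by (simp add: poisson_config_def)
    then have "ennreal (exp (- (\<integral>x. f x \<partial>poisson_config \<omega>))) = ennreal (exp (- S))" by simp
    also have "\<dots> = (\<Prod>k<n. ?g k (\<omega> k))"
      unfolding S_def by (simp only: sum_negf[symmetric] exp_sum finite_lessThan prod_ennreal exp_ge_zero prod_nonneg)
    finally show ?thesis .
  qed
  have gm: "?g k \<in> borel_measurable (comp k)" for k
  proof (rule measurable_compose_countable[where f="\<lambda>n p. \<Prod>j<n. ennreal (exp (- (f (snd p j) * indicator (shell k) (snd p j))))", OF _ count_measurable])
    show "(\<lambda>p. \<Prod>j<n. ennreal (exp (- (f (snd p j) * indicator (shell k) (snd p j))))) \<in> borel_measurable (comp k)" for n by measurable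
  qed
  have "(\<integral>\<^sup>+\<omega>. ennreal (exp (- (\<integral>x. f x \<partial>poisson_config \<omega>))) \<partial>Om) = (\<Prod>k<n. \<integral>\<^sup>+p. ?g k p \<partial>comp k)"
    unfolding e Om_def by (rule P.nn_integral_PiM_prod_finite) (use gm in auto)
  also have "\<dots> = (\<Prod>k<n. ennreal (exp (\<theta> * (\<integral>x. (exp (- f x) - 1) * indicator (shell k) x \<partial>lborel))))"
    by (simp only: nn_integral_comp[OF fm f0])
  also have "\<dots> = ennreal (exp (\<theta> * (\<Sum>k<n. \<integral>x. (exp (- f x) - 1) * indicator (shell k) x \<partial>lborel)))"
    by (simp only: sum_distrib_left exp_sum finite_lessThan prod_ennreal exp_ge_zero)
  also have "(\<Sum>k<n. \<integral>x. (exp (- f x) - 1) * indicator (shell k) x \<partial>lborel) = (\<integral>x. exp (- f x) - 1 \<partial>lborel)"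
  proof -
    have i: "integrable lborel (\<lambda>x. (exp (- f x) - 1) * indicator (shell k) x)" for k
    proof (rule Bochner_Integration.integrable_bound)
      show "integrable lborel (indicator (shell k) :: 'a \<Rightarrow> real)"
        using shell_finite[of k, where 'a='a] by (intro integrable_real_indicator) auto
    qed (use f0 in \<open>auto simp: indicator_def\<close>)
    have "(\<Sum>k<n. \<integral>x. (exp (- f x) - 1) * indicator (shell k) x \<partial>lborel) =
        (\<integral>x. (\<Sum>k<n. (exp (- f x) - 1) * indicator (shell k) x) \<partial>lborel)"
      using i by (intro Bochner_Integration.integral_sum[symmetric])
    also have "\<dots> = (\<integral>x. exp (- f x) - 1 \<partial>lborel)"
    proof (rule Bochner_Integration.integral_cong[OF refl])
      fix x :: 'a
      show "(\<Sum>k<n. (exp (- f x) - 1) * indicator (shell k) x) = exp (- f x) - 1"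
      proof (cases "f x = 0")
        case False
        then have "norm x < real n" using fn[of x] by linarith
        then have "nat \<lfloor>norm x\<rfloor> < n" by (simp add: nat_less_iff floor_less_iff)
        moreover have "(\<Sum>k<n. (exp (- f x) - 1) * indicator (shell k) x) = (\<Sum>k<n. if k = nat \<lfloor>norm x\<rfloor> then exp (- f x) - 1 else 0)"
          by (intro sum.cong refl) (simp add: indicator_def mem_shell_iff)
        ultimately show ?thesis by simp
      qed simp
    qed
    finally show ?thesis .
  qed
  finally have *: "(\<integral>\<^sup>+\<omega>. ennreal (exp (- (\<integral>x. f x \<partial>poisson_config \<omega>))) \<partial>Om) =
      ennreal (exp (\<theta> * (\<integral>x. exp (- f x) - 1 \<partial>lborel)))" .
  have "(\<lambda>\<omega>. \<Prod>k<n. ?g k (\<omega> k)) \<in> borel_measurable Om"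
  proof (rule borel_measurable_prod_ennreal)
    show "(\<lambda>\<omega>. ?g k (\<omega> k)) \<in> borel_measurable Om" for k
      unfolding Om_def by (rule measurable_compose[OF measurable_component_singleton[of k UNIV comp] gm]) simp
  qed
  then have "(\<lambda>\<omega>. enn2real (ennreal (exp (- (\<integral>x. f x \<partial>poisson_config \<omega>))))) \<in> borel_measurable Om"
    unfolding e by measurable
  then have "(\<lambda>\<omega>. exp (- (\<integral>x. f x \<partial>poisson_config \<omega>))) \<in> borel_measurable Om" by simp
  then show ?thesis
    unfolding laplace_functional_def using * by (subst integral_eq_nn_integral) auto
qed

end

lemma poisson_process_exists:
  assumes "0 < \<theta>"
  obtains M :: "'a::euclidean_space measure measure" where "point_process M (\<lambda>\<mu>. \<mu>)"
    "\<And>f. f \<in> test_functions \<Longrightarrow> laplace_functional M (\<lambda>\<mu>. \<mu>) f = exp (\<theta> * (\<integral>x. exp (- f x) - 1 \<partial>lborel))"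
proof -
  interpret poisson_space \<theta> "TYPE('a)" by standard fact
  show thesis
  proof (rule that)
    show "point_process (distr Om config_algebra poisson_config) (\<lambda>\<mu>. \<mu>)"
      unfolding point_process_def
      using prob_space.prob_space_distr[OF prob_Om poisson_config_measurable] by simp
    show "laplace_functional (distr Om config_algebra poisson_config) (\<lambda>\<mu>. \<mu>) f = exp (\<theta> * (\<integral>x. exp (- f x) - 1 \<partial>lborel))"
      if f: "f \<in> test_functions" for f :: "'a \<Rightarrow> real"
      unfolding laplace_functional_distr[OF poisson_config_measurable test_function_measurable[OF f] test_function_nonneg[OF f]]
      by (rule laplace_poisson_config[OF f])
  qed
qed

section \<open>The local limit of Riesz gases\<close>

lemma exp_neg_nonneg: "0 \<le> exp_neg t"
  by (simp add: exp_neg_def)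

lemma exp_neg_le_1: "exp_neg t \<le> 1"
  by (simp add: exp_neg_def)

lemma exp_neg_0 [simp]: "exp_neg 0 = 1"
  by (simp add: exp_neg_def)

lemma exp_neg_top [simp]: "exp_neg \<top> = 0"
  by (simp add: exp_neg_def)

lemma exp_neg_ennreal: "0 \<le> r \<Longrightarrow> exp_neg (ennreal r) = exp (- r)"
  by (simp add: exp_neg_def)

lemma exp_neg_add: "exp_neg (s + t) = exp_neg s * exp_neg t"
proof (cases "s = \<top> \<or> t = \<top>")
  case False
  then show ?thesis by (simp add: exp_neg_def enn2real_plus less_top exp_add[symmetric])
qed auto

lemma exp_neg_sum: "finite A \<Longrightarrow> exp_neg (\<Sum>i\<in>A. f i) = (\<Prod>i\<in>A. exp_neg (f i))"
  by (induction A rule: finite_induct) (simp_all add: exp_neg_add)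

text \<open>Coinciding points have infinite energy, hence weight 0, whereas \<open>riesz\<close>
  takes the junk value 0 there and would give weight 1.\<close>

definition pair_weight :: "real \<Rightarrow> real \<Rightarrow> 'a::euclidean_space \<Rightarrow> 'a \<Rightarrow> real" where
  "pair_weight s b x y = (if x = y then 0 else exp (- b * riesz s x y))"

text \<open>Positivity of \<open>b\<close> matters on the diagonal: in \<open>ennreal\<close>, 0
  times infinity is 0.\<close>

lemma exp_neg_riesz_kernel:
  assumes "0 < b" shows "exp_neg (ennreal b * riesz_kernel s x y) = pair_weight s b x y"
  using assms
  by (simp add: pair_weight_def riesz_kernel_def riesz_def ennreal_mult[symmetric] exp_neg_ennreal
      ennreal_mult_top norm_minus_commute)

lemma exp_neg_riesz_energy:
  assumes "0 < b"
  shows "exp_neg (riesz_energy s V b N x) =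
    (\<Prod>i\<in>{1..N}. \<Prod>j\<in>{i<..N}. pair_weight s b (x i) (x j)) * (\<Prod>j\<in>{1..N}. exp_neg (V (x j)))"
  unfolding riesz_energy_def sum_distrib_left exp_neg_add
  by (simp add: exp_neg_sum exp_neg_riesz_kernel[OF assms])

lemma pair_weight_measurable [measurable (raw)]:
  assumes [measurable]: "f \<in> borel_measurable N" "g \<in> borel_measurable N"
  shows "(\<lambda>w. pair_weight s b (f w) (g w)) \<in> borel_measurable N"
  unfolding pair_weight_def riesz_def by measurable

lemma sum_ordered_pairs:
  fixes K :: "nat \<Rightarrow> nat \<Rightarrow> real"
  assumes "\<And>i j. K i j = K j i" "\<And>i. K i i = 0"
  shows "(\<Sum>i\<in>{1..N}. \<Sum>j\<in>{i<..N}. K i j) = 1 / 2 * (\<Sum>i\<in>{1..N}. \<Sum>j\<in>{1..N}. K i j)"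
proof (induction N)
  case (Suc N)
  have "(\<Sum>i\<in>{1..Suc N}. \<Sum>j\<in>{i<..Suc N}. K i j) = (\<Sum>i\<in>{1..N}. (\<Sum>j\<in>{i<..N}. K i j) + K i (Suc N))"
  proof -
    have "(\<Sum>j\<in>{i<..Suc N}. K i j) = (\<Sum>j\<in>{i<..N}. K i j) + K i (Suc N)" if "i \<in> {1..N}" for i
    proof -
      have "{i<..Suc N} = insert (Suc N) {i<..N}" using that by auto
      then show ?thesis by simp
    qed
    then show ?thesis by simp
  qed
  also have "\<dots> = 1 / 2 * (\<Sum>i\<in>{1..N}. \<Sum>j\<in>{1..N}. K i j) + (\<Sum>i\<in>{1..N}. K i (Suc N))"
    by (simp only: sum.distrib Suc)
  also have "\<dots> = 1 / 2 * (\<Sum>i\<in>{1..Suc N}. \<Sum>j\<in>{1..Suc N}. K i j)"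
    by (simp add: sum.distrib assms(1)[of "Suc N"] assms(2))
  finally show ?case .
qed simp

lemma prod_pair_weight:
  fixes x :: "nat \<Rightarrow> 'a::euclidean_space"
  assumes "inj_on x {1..N}"
  shows "(\<Prod>i\<in>{1..N}. \<Prod>j\<in>{i<..N}. pair_weight s b (x i) (x j)) =
    exp (- (b / 2 * (\<Sum>i\<in>{1..N}. \<Sum>j\<in>{1..N}. riesz s (x i) (x j))))"
proof -
  have "(\<Prod>i\<in>{1..N}. \<Prod>j\<in>{i<..N}. pair_weight s b (x i) (x j)) =
      (\<Prod>i\<in>{1..N}. \<Prod>j\<in>{i<..N}. exp (- b * riesz s (x i) (x j)))"
  proof (intro prod.cong refl)
    fix i j :: nat assume "i \<in> {1..N}" "j \<in> {i<..N}"
    then have "i \<in> {1..N}" "j \<in> {1..N}" "i \<noteq> j" by auto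
    then have "x i \<noteq> x j" using inj_on_eq_iff[OF assms] by blast
    then show "pair_weight s b (x i) (x j) = exp (- b * riesz s (x i) (x j))" by (simp add: pair_weight_def)
  qed
  also have "\<dots> = exp (\<Sum>i\<in>{1..N}. \<Sum>j\<in>{i<..N}. - b * riesz s (x i) (x j))"
    by (simp add: exp_sum)
  also have "(\<Sum>i\<in>{1..N}. \<Sum>j\<in>{i<..N}. - b * riesz s (x i) (x j)) =
     - b * (\<Sum>i\<in>{1..N}. \<Sum>j\<in>{i<..N}. riesz s (x i) (x j))"
    by (simp only: sum_distrib_left)
  also have "(\<Sum>i\<in>{1..N}. \<Sum>j\<in>{i<..N}. riesz s (x i) (x j)) = 1 / 2 * (\<Sum>i\<in>{1..N}. \<Sum>j\<in>{1..N}. riesz s (x i) (x j))"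
    by (rule sum_ordered_pairs) (simp_all add: riesz_def norm_minus_commute)
  finally show ?thesis by simp
qed

lemma PiM_density_lborel:
  fixes d :: "'a::euclidean_space \<Rightarrow> real"
  assumes I: "finite I" and [measurable]: "d \<in> borel_measurable borel" and P: "prob_space (density lborel (\<lambda>x. ennreal (d x)))"
  shows "PiM I (\<lambda>_. density lborel (\<lambda>x. ennreal (d x))) = density (PiM I (\<lambda>_. lborel)) (\<lambda>x. \<Prod>i\<in>I. ennreal (d (x i)))"
proof -
  let ?M = "density lborel (\<lambda>x. ennreal (d x))"
  interpret L: product_sigma_finite "\<lambda>_. lborel :: 'a measure" by unfold_locales
  interpret P: product_sigma_finite "\<lambda>_. ?M"
    by (intro product_sigma_finite.intro prob_space_imp_sigma_finite P)
  have m [measurable]: "(\<lambda>x. \<Prod>i\<in>I. ennreal (d (x i))) \<in> borel_measurable (PiM I (\<lambda>_. lborel))"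
    using I by (intro borel_measurable_prod_ennreal) auto
  show ?thesis
  proof (rule P.PiM_eqI[symmetric, OF I])
    show "sets (density (PiM I (\<lambda>_. lborel)) (\<lambda>x. \<Prod>i\<in>I. ennreal (d (x i)))) = sets (PiM I (\<lambda>_. ?M))"
      by (simp cong: sets_PiM_cong)
    fix A :: "_ \<Rightarrow> 'a set" assume A: "\<And>i. i \<in> I \<Longrightarrow> A i \<in> sets ?M"
    then have A': "\<And>i. i \<in> I \<Longrightarrow> A i \<in> sets borel" by simp
    have "emeasure (density (PiM I (\<lambda>_. lborel)) (\<lambda>x. \<Prod>i\<in>I. ennreal (d (x i)))) (PiE I A) =
      (\<integral>\<^sup>+x. (\<Prod>i\<in>I. ennreal (d (x i))) * indicator (PiE I A) x \<partial>PiM I (\<lambda>_. lborel))"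
      using A' I by (intro emeasure_density m sets_PiM_I_finite) auto
    also have "\<dots> = (\<integral>\<^sup>+x. (\<Prod>i\<in>I. ennreal (d (x i)) * indicator (A i) (x i)) \<partial>PiM I (\<lambda>_. lborel))"
    proof (rule nn_integral_cong)
      fix x assume x: "x \<in> space (PiM I (\<lambda>_. lborel :: 'a measure))"
      have "indicator (PiE I A) x = (\<Prod>i\<in>I. indicator (A i) (x i) :: ennreal)"
      proof (cases "x \<in> PiE I A")
        case True
        then have "(\<Prod>i\<in>I. indicator (A i) (x i) :: ennreal) = 1"
          by (intro prod.neutral) (auto simp: PiE_mem)
        then show ?thesis using True by simp
      next
        case False
        then obtain i where "i \<in> I" "x i \<notin> A i" using x by (auto simp: space_PiM PiE_def Pi_def)
        then have "(\<Prod>i\<in>I. indicator (A i) (x i) :: ennreal) = 0" using I by (intro prod_zero bexI[of _ i]) auto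
        then show ?thesis using False by simp
      qed
      then show "(\<Prod>i\<in>I. ennreal (d (x i))) * indicator (PiE I A) x = (\<Prod>i\<in>I. ennreal (d (x i)) * indicator (A i) (x i))"
        by (simp only: prod.distrib)
    qed
    also have "\<dots> = (\<Prod>i\<in>I. \<integral>\<^sup>+y. ennreal (d y) * indicator (A i) y \<partial>lborel)"
      using A' I by (intro L.product_nn_integral_prod) auto
    also have "\<dots> = (\<Prod>i\<in>I. emeasure ?M (A i))"
      using A' by (intro prod.cong refl emeasure_density[symmetric]) auto
    finally show "emeasure (density (PiM I (\<lambda>_. lborel)) (\<lambda>x. \<Prod>i\<in>I. ennreal (d (x i)))) (PiE I A) = (\<Prod>i\<in>I. emeasure ?M (A i))" .
  qed
qed

section \<open>The rescaled point process\<close>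

lemma local_process_integral:
  fixes f :: "'a::euclidean_space \<Rightarrow> real" and E :: 'a
  assumes [measurable]: "f \<in> borel_measurable borel"
  shows "(\<integral>z. f z \<partial>local_process E N x) = (\<Sum>j\<in>{1..N}. f ((real N powr (1 / real DIM('a))) *\<^sub>R (x j - E)))"
  unfolding local_process_def by (subst integral_distr) (auto simp: lebesgue_integral_count_space_finite)

lemma emeasure_local_process:
  fixes E :: "'a::euclidean_space"
  assumes B: "B \<in> sets borel"
  shows "emeasure (local_process E N x) B = (\<Sum>j\<in>{1..N}. indicator B ((real N powr (1 / real DIM('a))) *\<^sub>R (x j - E)))"
proof -
  have "emeasure (local_process E N x) B = (\<integral>\<^sup>+z. indicator B z \<partial>local_process E N x)"
    using B by (intro nn_integral_indicator[symmetric]) (simp add: local_process_def)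
  also have "\<dots> = (\<Sum>j\<in>{1..N}. indicator B ((real N powr (1 / real DIM('a))) *\<^sub>R (x j - E)))"
    unfolding local_process_def using B by (subst nn_integral_distr) (auto simp: nn_integral_count_space_finite)
  finally show ?thesis .
qed

lemma local_process_measurable:
  fixes E :: "'a::euclidean_space"
  shows "local_process E N \<in> measurable (PiM {1..N} (\<lambda>_. borel)) config_algebra"
proof (rule measurable_config_algebraI)
  fix x :: "nat \<Rightarrow> 'a"
  show "local_process E N x \<in> point_configs"
    unfolding point_configs_def
  proof (intro CollectI conjI ballI impI)
    fix B :: "'a set" assume B: "B \<in> sets borel"
    have "emeasure (local_process E N x) B = of_nat (\<Sum>j\<in>{1..N}. if (real N powr (1 / real DIM('a))) *\<^sub>R (x j - E) \<in> B then 1 else 0)"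
      unfolding emeasure_local_process[OF B] of_nat_sum by (intro sum.cong) (auto simp: indicator_def)
    then show "\<exists>k::nat. emeasure (local_process E N x) B = of_nat k" by blast
  qed (simp add: local_process_def)
next
  fix B :: "'a set" assume [measurable]: "B \<in> sets borel"
  show "(\<lambda>x. emeasure (local_process E N x) B) \<in> borel_measurable (PiM {1..N} (\<lambda>_. borel))"
    unfolding emeasure_local_process[OF \<open>B \<in> sets borel\<close>]
  proof (rule borel_measurable_sum)
    fix j assume j: "j \<in> {1..N}"
    have [measurable]: "(\<lambda>x. x j) \<in> borel_measurable (PiM {1..N} (\<lambda>_. borel :: 'a measure))"
      by (rule measurable_component_singleton[OF j])
    show "(\<lambda>x. indicator B ((real N powr (1 / real DIM('a))) *\<^sub>R (x j - E)) :: ennreal) \<in> borel_measurable (PiM {1..N} (\<lambda>_. borel))"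
      by measurable
  qed
qed

section \<open>Continuity of the potential\<close>

lemma trunc_sequentially_continuous:
  assumes s: "0 < s" and r: "r \<longlonglongrightarrow> l"
  shows "(\<lambda>k. trunc s T (r k)) \<longlonglongrightarrow> trunc s T l"
proof -
  let ?F = "\<lambda>r t. ennreal (gsup s r t) * indicator {..real T} t"
  have "(\<lambda>k. \<integral>\<^sup>+t. ?F (r k) t \<partial>lborel) \<longlonglongrightarrow> (\<integral>\<^sup>+t. ?F l t \<partial>lborel)"
  proof (rule nn_integral_dominated_convergence[where w="?F 0"])
    show "AE t in lborel. ?F (r k) t \<le> ?F 0 t" for k
    proof (intro AE_I2 mult_right_mono ennreal_leI)
      fix t
      have "gsup s (r k) t = gsup s \<bar>r k\<bar> t" by (simp add: gsup_def)
      also have "\<dots> \<le> gsup s 0 t" by (rule gsup_antimono) auto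
      finally show "gsup s (r k) t \<le> gsup s 0 t" .
    qed simp
    show "(\<integral>\<^sup>+t. ?F 0 t \<partial>lborel) < \<infinity>" by (rule trunc_finite[OF s])
    show "AE t in lborel. (\<lambda>k. ?F (r k) t) \<longlonglongrightarrow> ?F l t"
    proof (rule AE_I2)
      fix t :: real
      have "(\<lambda>k. gsup s (r k) t) \<longlonglongrightarrow> gsup s l t"
        unfolding gsup_def by (intro tendsto_intros r) auto
      then have "(\<lambda>k. ennreal (gsup s (r k) t)) \<longlonglongrightarrow> ennreal (gsup s l t)" by (rule tendsto_ennrealI)
      then show "(\<lambda>k. ?F (r k) t) \<longlonglongrightarrow> ?F l t"
        by (cases "t \<le> real T") simp_all
    qed
  qed simp_all
  then have "(\<lambda>k. enn2real (\<integral>\<^sup>+t. ?F (r k) t \<partial>lborel)) \<longlonglongrightarrow> enn2real (\<integral>\<^sup>+t. ?F l t \<partial>lborel)"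
    using trunc_finite[OF s, of l T] by (intro tendsto_enn2real) (auto simp: less_top)
  then show ?thesis
    unfolding trunc_def using gconst_pos[OF s] by (intro tendsto_divide tendsto_const) auto
qed

text \<open>The potential is a uniform limit of truncated potentials, uniform because
  \<open>e T\<close> does not depend on the base point. The latter are continuous by dominated
  convergence, their kernels being continuous and bounded.\<close>

lemma riesz_pot_continuous:
  fixes M :: "'a::euclidean_space measure"
  assumes s: "0 < s" and A: "approx_kernel M (riesz s) (riesz_trunc s) C (\<lambda>T. trunc s T 0) e"
  shows "continuous_on UNIV (approx_kernel.pot M (riesz s))"
proof -
  interpret approx_kernel M "riesz s" "riesz_trunc s" C "\<lambda>T. trunc s T 0" e by (rule A)
  show ?thesis
  proof (rule uniform_limit_theorem[where f=pott and F=sequentially])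
    show "\<forall>\<^sub>F T in sequentially. continuous_on UNIV (pott T)"
    proof (intro always_eventually allI)
      fix T
      show "continuous_on UNIV (pott T)"
      proof (rule continuous_at_imp_continuous_on, intro ballI)
        fix x
        show "isCont (pott T) x"
          unfolding continuous_at_sequentially comp_def
        proof (intro allI impI)
          fix X :: "nat \<Rightarrow> 'a" assume X: "X \<longlonglongrightarrow> x"
          show "(\<lambda>k. pott T (X k)) \<longlonglongrightarrow> pott T x"
            unfolding pott_def
          proof (rule integral_dominated_convergence[where w="\<lambda>_. trunc s T 0"])
            show "AE y in M. (\<lambda>k. riesz_trunc s T (X k) y) \<longlonglongrightarrow> riesz_trunc s T x y"
              unfolding riesz_trunc_def
              by (intro AE_I2 trunc_sequentially_continuous[OF s] tendsto_intros X)
          qed (auto simp: Kt_nonneg Kt_le)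
        qed
      qed
    qed
    show "uniform_limit UNIV pott pot sequentially"
    proof (rule uniform_limitI)
      fix \<epsilon> :: real assume "0 < \<epsilon>"
      then have "\<forall>\<^sub>F T in sequentially. e T < \<epsilon>" using order_tendstoD(2)[OF e_tendsto] by simp
      then show "\<forall>\<^sub>F T in sequentially. \<forall>x\<in>UNIV. dist (pott T x) (pot x) < \<epsilon>"
      proof eventually_elim
        case (elim T)
        show ?case
        proof
          fix x show "dist (pott T x) (pot x) < \<epsilon>"
            using pott_le_pot[of T x] pot_le_pott[of x T] elim by (simp add: dist_real_def)
        qed
      qed
    qed
  qed simp
qed

text \<open>The assumption \<open>v\<close> is the mean-field equation solved for
  \<open>exp (- V)\<close>. Multiplied over the points, it gives the density of the product of
  \<open>M\<close> times \<open>exp (g * (\<Sum>i\<in>{1..N}. pot (x i)))\<close>, and the constant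
  \<open>c ^ N\<close> cancels in the normalization.\<close>

lemma riesz_gibbs_eq:
  fixes V :: "'a::euclidean_space \<Rightarrow> ennreal" and d :: "'a \<Rightarrow> real"
  assumes A: "approx_kernel M (riesz s) (riesz_trunc s) C (\<lambda>T. trunc s T 0) e"
    and M: "M = density lborel (\<lambda>x. ennreal (d x))"
    and d [measurable]: "d \<in> borel_measurable borel" and d0: "\<And>x. 0 \<le> d x"
    and v: "\<And>x. exp_neg (V x) = c * (d x * exp (g * approx_kernel.pot M (riesz s) x))"
    and c: "0 < c" and g: "0 \<le> g" and b: "0 < b"
  shows "riesz_gibbs s V b N = approx_kernel.gibbs M (riesz s) g b {1..N}"
proof -
  interpret approx_kernel M "riesz s" "riesz_trunc s" C "\<lambda>T. trunc s T 0" e by (rule A)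
  let ?L = "PiM {1..N} (\<lambda>_. lborel :: 'a measure)"
  let ?D = "\<lambda>x. \<Prod>i\<in>{1..N}. ennreal (d (x i))"
  have P: "prob_space (density lborel (\<lambda>x. ennreal (d x)))" using prob_space_axioms by (simp only: M)
  have PM: "PiM {1..N} (\<lambda>_. M) = density ?L ?D"
    unfolding M by (rule PiM_density_lborel[OF _ d P]) simp
  have sL: "sets ?L = sets (PiM {1..N} (\<lambda>_. M))" by (rule sets_PiM_cong) (simp_all add: sets_M)
  have wm [measurable]: "wt g b {1..N} \<in> borel_measurable ?L"
    using wt_measurable[of "{1..N}" g b] by (simp only: measurable_cong_sets[OF sL refl] finite_atLeastAtMost)
  have Dm [measurable]: "?D \<in> borel_measurable ?L"
    by (intro borel_measurable_prod_ennreal) auto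
  have vm: "(\<lambda>x. exp_neg (V x)) \<in> borel_measurable borel"
    unfolding v by measurable
  have Em [measurable]: "(\<lambda>x. exp_neg (riesz_energy s V b N x)) \<in> borel_measurable ?L"
    unfolding exp_neg_riesz_energy[OF b]
  proof (intro borel_measurable_times borel_measurable_prod)
    fix i j :: nat assume "i \<in> {1..N}" "j \<in> {i<..N}"
    then have [measurable]: "(\<lambda>x. x i) \<in> borel_measurable ?L" "(\<lambda>x. x j) \<in> borel_measurable ?L"
      using measurable_component_singleton[of i "{1..N}" "\<lambda>_. lborel :: 'a measure"]
        measurable_component_singleton[of j "{1..N}" "\<lambda>_. lborel :: 'a measure"] by simp_all
    show "(\<lambda>x. pair_weight s b (x i) (x j)) \<in> borel_measurable ?L" by measurable
  next
    fix j assume "j \<in> {1..N}"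
    then have "(\<lambda>x. x j) \<in> borel_measurable ?L"
      using measurable_component_singleton[of j "{1..N}" "\<lambda>_. lborel :: 'a measure"] by simp
    then show "(\<lambda>x. exp_neg (V (x j))) \<in> borel_measurable ?L"
      using vm by (rule measurable_compose)
  qed
  \<comment> \<open>Distinctness holds almost surely under the product of \<open>M\<close>, hence
    Lebesgue almost everywhere only where the product of the densities is positive. Where that
    product vanishes, both sides are 0.\<close>
  have eq: "ennreal (exp_neg (riesz_energy s V b N x)) = ennreal (c ^ N) * (?D x * ennreal (wt g b {1..N} x))"
    if x: "inj_on x {1..N} \<or> ?D x = 0" for x
  proof -
    have Dr: "?D x = ennreal (\<Prod>i\<in>{1..N}. d (x i))" by (rule prod_ennreal) (rule d0)
    have vp: "(\<Prod>j\<in>{1..N}. exp_neg (V (x j))) = c ^ N * ((\<Prod>i\<in>{1..N}. d (x i)) * exp (g * (\<Sum>i\<in>{1..N}. pot (x i))))"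
      unfolding v by (simp add: prod.distrib exp_sum sum_distrib_left)
    show ?thesis
    proof (cases "?D x = 0")
      case True
      then have z: "(\<Prod>i\<in>{1..N}. d (x i)) = 0"
        unfolding Dr ennreal_eq_0_iff by (intro antisym prod_nonneg d0)
      show ?thesis unfolding exp_neg_riesz_energy[OF b] vp True z by simp
    next
      case False
      with x have "inj_on x {1..N}" by blast
      then have "exp_neg (riesz_energy s V b N x) = c ^ N * ((\<Prod>i\<in>{1..N}. d (x i)) * wt g b {1..N} x)"
        unfolding exp_neg_riesz_energy[OF b] prod_pair_weight[OF \<open>inj_on x {1..N}\<close>] vp wt_def
        unfolding diff_conv_add_uminus exp_add by (simp only: mult_ac)
      moreover have "0 \<le> c ^ N" "0 \<le> (\<Prod>i\<in>{1..N}. d (x i))" "0 \<le> wt g b {1..N} x"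
        using c wt_pos[of g b "{1..N}" x] by (simp_all add: prod_nonneg d0)
      ultimately show ?thesis
        unfolding Dr by (simp only: ennreal_mult mult_nonneg_nonneg)
    qed
  qed
  have AE: "AE x in ?L. ennreal (exp_neg (riesz_energy s V b N x)) = ennreal (c ^ N) * (?D x * ennreal (wt g b {1..N} x))"
  proof -
    have "AE x in density ?L ?D. inj_on x {1..N}"
      unfolding PM[symmetric] by (rule AE_distinct) simp
    then have "AE x in ?L. 0 < ?D x \<longrightarrow> inj_on x {1..N}"
      by (subst (asm) AE_density[OF Dm])
    then show ?thesis
    proof (rule eventually_mono)
      fix x assume "0 < ?D x \<longrightarrow> inj_on x {1..N}"
      then show "ennreal (exp_neg (riesz_energy s V b N x)) = ennreal (c ^ N) * (?D x * ennreal (wt g b {1..N} x))"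
        unfolding zero_less_iff_neq_zero by (intro eq) blast
    qed
  qed
  have p: "0 < part g b {1..N}" using g b by (intro part_pos) auto
  have cN: "0 < c ^ N" using c by simp
  have "riesz_partition s V b N = (\<integral>\<^sup>+x. ennreal (c ^ N) * (?D x * ennreal (wt g b {1..N} x)) \<partial>?L)"
    unfolding riesz_partition_def using AE by (rule nn_integral_cong_AE)
  also have "\<dots> = ennreal (c ^ N) * (\<integral>\<^sup>+x. ennreal (wt g b {1..N} x) \<partial>density ?L ?D)"
    by (subst nn_integral_cmult, measurable, subst nn_integral_density) simp_all
  also have "\<dots> = ennreal (c ^ N) * ennreal (part g b {1..N})"
    unfolding PM[symmetric] using g b by (subst nn_integral_wt) auto
  finally have Z: "riesz_partition s V b N = ennreal (c ^ N * part g b {1..N})"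
    using cN p by (simp add: ennreal_mult)
  have "riesz_gibbs s V b N = density ?L (\<lambda>x. ?D x * ennreal (wt g b {1..N} x / part g b {1..N}))"
    unfolding riesz_gibbs_def
  proof (rule density_cong)
    show "(\<lambda>x. ennreal (exp_neg (riesz_energy s V b N x)) / riesz_partition s V b N) \<in> borel_measurable ?L"
      by measurable
    show "(\<lambda>x. ?D x * ennreal (wt g b {1..N} x / part g b {1..N})) \<in> borel_measurable ?L" by measurable
    show "AE x in ?L. ennreal (exp_neg (riesz_energy s V b N x)) / riesz_partition s V b N =
        ?D x * ennreal (wt g b {1..N} x / part g b {1..N})"
      using AE
    proof (rule eventually_mono)
      fix x assume *: "ennreal (exp_neg (riesz_energy s V b N x)) = ennreal (c ^ N) * (?D x * ennreal (wt g b {1..N} x))"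
      have Dr: "?D x = ennreal (\<Prod>i\<in>{1..N}. d (x i))" by (rule prod_ennreal) (rule d0)
      show "ennreal (exp_neg (riesz_energy s V b N x)) / riesz_partition s V b N =
        ?D x * ennreal (wt g b {1..N} x / part g b {1..N})"
        unfolding * Z Dr using c cN p d0
        by (simp add: ennreal_mult[symmetric] divide_ennreal prod_nonneg wt_pos less_imp_le)
    qed
  qed
  also have "\<dots> = density (density ?L ?D) (\<lambda>x. ennreal (wt g b {1..N} x / part g b {1..N}))"
    by (rule density_density_eq[symmetric]) measurable
  also have "\<dots> = gibbs g b {1..N}" unfolding gibbs_def PM ..
  finally show ?thesis .
qed

text \<open>The substitution \<open>y = E + N^(- 1 / n) * z\<close> absorbs the factor
  \<open>N\<close>. The integrand then lives on the fixed support of \<open>f\<close>, where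
  \<open>d\<close> is bounded and its argument tends to \<open>E\<close>.\<close>

lemma scaling_limit:
  fixes d f :: "'a::euclidean_space \<Rightarrow> real"
  assumes [measurable]: "d \<in> borel_measurable borel" and d: "\<And>x. 0 \<le> d x" "\<And>x. d x \<le> D"
    and cont: "isCont d E" and f: "f \<in> test_functions"
  shows "(\<lambda>N. real N * (\<integral>y. d y * (1 - exp (- f ((real N powr (1 / real DIM('a))) *\<^sub>R (y - E)))) \<partial>lborel))
    \<longlonglongrightarrow> d E * (\<integral>z. 1 - exp (- f z) \<partial>lborel)"
proof -
  have fm [measurable]: "f \<in> borel_measurable borel" and f0: "\<And>x. 0 \<le> f x"
    using f test_function_measurable test_function_nonneg by auto
  obtain R where R: "\<And>x. R \<le> norm x \<Longrightarrow> f x = 0" using test_function_bounded_support[OF f] by metis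
  define c where "c N = real N powr (- (1 / real DIM('a)))" for N :: nat
  have c0: "c \<longlonglongrightarrow> 0"
    unfolding c_def by (intro tendsto_neg_powr filterlim_real_sequentially) (simp add: DIM_positive)
  have D0: "0 \<le> D" using d order_trans by blast
  have h: "0 \<le> 1 - exp (- f z)" "1 - exp (- f z) \<le> 1" for z using f0[of z] by auto
  have "(\<lambda>N. \<integral>z. d (E + c N *\<^sub>R z) * (1 - exp (- f z)) \<partial>lborel) \<longlonglongrightarrow> (\<integral>z. d E * (1 - exp (- f z)) \<partial>lborel)"
  proof (rule integral_dominated_convergence[where w="\<lambda>z. D * indicator (ball (0::'a) R) z"])
    show "integrable lborel (\<lambda>z. D * indicator (ball (0::'a) R) z :: real)"
      using emeasure_lborel_ball_finite[of "0::'a" R] by (intro integrable_mult_right integrable_real_indicator) auto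
    show "AE z in lborel. (\<lambda>N. d (E + c N *\<^sub>R z) * (1 - exp (- f z))) \<longlonglongrightarrow> d E * (1 - exp (- f z))"
    proof (intro AE_I2 tendsto_mult tendsto_const isCont_tendsto_compose[OF cont])
      fix z
      have "(\<lambda>N. E + c N *\<^sub>R z) \<longlonglongrightarrow> E + 0 *\<^sub>R z" by (intro tendsto_intros c0)
      then show "(\<lambda>N. E + c N *\<^sub>R z) \<longlonglongrightarrow> E" by simp
    qed
    show "AE z in lborel. norm (d (E + c N *\<^sub>R z) * (1 - exp (- f z))) \<le> D * indicator (ball (0::'a) R) z" for N
    proof (rule AE_I2)
      fix z
      show "norm (d (E + c N *\<^sub>R z) * (1 - exp (- f z))) \<le> D * indicator (ball (0::'a) R) z"
      proof (cases "norm z < R")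
        case True
        have "norm (d (E + c N *\<^sub>R z) * (1 - exp (- f z))) = d (E + c N *\<^sub>R z) * (1 - exp (- f z))"
          using d h by simp
        also have "\<dots> \<le> D * 1" using d h D0 by (intro mult_mono) auto
        finally show ?thesis using True by simp
      next
        case False
        then show ?thesis using R[of z] by simp
      qed
    qed
  qed measurable
  moreover have "\<forall>\<^sub>F N in sequentially. (\<integral>z. d (E + c N *\<^sub>R z) * (1 - exp (- f z)) \<partial>lborel) =
      real N * (\<integral>y. d y * (1 - exp (- f ((real N powr (1 / real DIM('a))) *\<^sub>R (y - E)))) \<partial>lborel)"
    using eventually_gt_at_top[of 0]
  proof eventually_elim
    case (elim N)
    let ?a = "real N powr (1 / real DIM('a))"
    have ca: "?a * c N = 1" and cp: "0 < c N" using elim by (simp_all add: c_def powr_add[symmetric])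
    have cn: "c N ^ DIM('a) = 1 / real N"
    proof -
      have "c N ^ DIM('a) = c N powr real DIM('a)" using cp by (simp add: powr_realpow)
      also have "\<dots> = real N powr - 1" by (simp add: c_def powr_powr)
      finally show ?thesis using elim by (simp add: powr_minus divide_inverse)
    qed
    define F where "F y = d y * (1 - exp (- f (?a *\<^sub>R (y - E))))" for y
    have [measurable]: "F \<in> borel_measurable borel" unfolding F_def by measurable
    have F0: "0 \<le> F y" for y using d h by (simp add: F_def)
    have Fs: "F (E + c N *\<^sub>R z) = d (E + c N *\<^sub>R z) * (1 - exp (- f z))" for z
      using ca by (simp add: F_def)
    have 1: "(\<integral>y. F y \<partial>lborel) = enn2real (\<integral>\<^sup>+y. ennreal (F y) \<partial>lborel)"
      by (rule integral_eq_nn_integral) (auto simp: F0)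
    have 2: "(\<integral>\<^sup>+y. ennreal (F y) \<partial>lborel) = ennreal (\<bar>c N\<bar> ^ DIM('a)) * (\<integral>\<^sup>+z. ennreal (F (E + c N *\<^sub>R z)) \<partial>lborel)"
      using cp by (intro nn_integral_lborel_affine) auto
    have 3: "(\<integral>z. F (E + c N *\<^sub>R z) \<partial>lborel) = enn2real (\<integral>\<^sup>+z. ennreal (F (E + c N *\<^sub>R z)) \<partial>lborel)"
      by (rule integral_eq_nn_integral) (auto simp: F0)
    have "(\<integral>y. F y \<partial>lborel) = (1 / real N) * (\<integral>z. F (E + c N *\<^sub>R z) \<partial>lborel)"
      unfolding 1 2 3 enn2real_mult using cp cn by simp
    then have "real N * (\<integral>y. F y \<partial>lborel) = (\<integral>z. F (E + c N *\<^sub>R z) \<partial>lborel)"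
      using elim by simp
    then show ?case unfolding Fs unfolding F_def by (rule sym)
  qed
  ultimately have "(\<lambda>N. real N * (\<integral>y. d y * (1 - exp (- f ((real N powr (1 / real DIM('a))) *\<^sub>R (y - E)))) \<partial>lborel))
    \<longlonglongrightarrow> (\<integral>z. d E * (1 - exp (- f z)) \<partial>lborel)"
    by (rule Lim_transform_eventually)
  then show ?thesis by simp
qed

lemma isCont_exp_neg:
  fixes V :: "'a::euclidean_space \<Rightarrow> ennreal"
  assumes S: "open {x. V x < \<infinity>}" and cont: "continuous_on {x. V x < \<infinity>} V" and E: "V E < \<infinity>"
  shows "isCont (\<lambda>x. exp_neg (V x)) E"
proof -
  let ?S = "{x. V x < \<infinity>}"
  have "isCont V E" using cont S E continuous_on_eq_continuous_at by blast
  then have "(V \<longlongrightarrow> ennreal (enn2real (V E))) (at E)" using E by (simp add: isCont_def)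
  then have "((\<lambda>x. enn2real (V x)) \<longlongrightarrow> enn2real (V E)) (at E)" by (rule tendsto_enn2real) simp
  then have "((\<lambda>x. exp (- enn2real (V x))) \<longlongrightarrow> exp (- enn2real (V E))) (at E)"
    by (intro tendsto_exp tendsto_minus)
  moreover have "\<forall>\<^sub>F x in at E. exp (- enn2real (V x)) = exp_neg (V x)"
    \<comment> \<open>Openness keeps the value infinity away from a neighbourhood of
      \<open>E\<close>.\<close>
    using eventually_at_in_open'[OF S, of E] E by (auto elim!: eventually_mono simp: exp_neg_def)
  ultimately have "((\<lambda>x. exp_neg (V x)) \<longlongrightarrow> exp (- enn2real (V E))) (at E)" by (rule Lim_transform_eventually)
  moreover have "exp_neg (V E) = exp (- enn2real (V E))" using E by (auto simp: exp_neg_def)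
  ultimately show ?thesis by (simp only: isCont_def)
qed

lemma exp_neg_integral_pos:
  fixes V :: "'a::euclidean_space \<Rightarrow> ennreal"
  assumes int: "integrable lborel (\<lambda>x. exp_neg (V x))"
    and S: "open {x. V x < \<infinity>}" "{x. V x < \<infinity>} \<noteq> {}"
  shows "0 < (\<integral>x. exp_neg (V x) \<partial>lborel)"
proof -
  have "(\<integral>x. exp_neg (V x) \<partial>lborel) \<noteq> 0"
  proof
    assume "(\<integral>x. exp_neg (V x) \<partial>lborel) = 0"
    then have "AE x in lborel. exp_neg (V x) = 0"
      using integral_nonneg_eq_0_iff_AE[OF int] by (simp add: exp_neg_nonneg)
    then have "AE x in lborel. x \<notin> {x. V x < \<infinity>}"
      by (rule eventually_mono) (auto simp: exp_neg_def split: if_splits)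
    then have "{x. V x < \<infinity>} \<in> null_sets lborel"
      using S(1) by (subst (asm) AE_iff_null_sets[symmetric]) auto
    then have "negligible {x. V x < \<infinity>}"
      by (simp add: negligible_iff_null_sets null_sets_completionI)
    then show False using open_not_negligible[OF S] by simp
  qed
  moreover have "0 \<le> (\<integral>x. exp_neg (V x) \<partial>lborel)"
    by (rule Bochner_Integration.integral_nonneg) (rule exp_neg_nonneg)
  ultimately show ?thesis by simp
qed

lemma prob_space_density_lborel:
  assumes "integrable lborel d" "\<And>x. 0 \<le> d x" "(\<integral>x. d x \<partial>lborel) = 1"
  shows "prob_space (density lborel (\<lambda>x. ennreal (d x)))"
proof
  have "emeasure (density lborel (\<lambda>x. ennreal (d x))) UNIV = (\<integral>\<^sup>+x. ennreal (d x) \<partial>lborel)"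
    using assms(1) by (subst emeasure_density) auto
  also have "\<dots> = ennreal 1" using assms by (subst nn_integral_eq_integral) auto
  finally show "emeasure (density lborel (\<lambda>x. ennreal (d x))) (space (density lborel (\<lambda>x. ennreal (d x)))) = 1" by simp
qed

text \<open>The kernel axioms are instantiated twice: first for the normalized
  \<open>exp (- V)\<close>, relative to which the fixed point \<open>u\<close> is found, and then
  for the measure with density \<open>u\<close> relative to it. The potential of the second is
  \<open>iop (riesz s) u\<close> of the first, which closes the equation.\<close>

lemma riesz_mean_field_density:
  fixes V :: "'a::euclidean_space \<Rightarrow> ennreal"
  assumes s: "0 < s" "s < real DIM('a)" and g: "0 \<le> g"
    and int: "integrable lborel (\<lambda>x. exp_neg (V x))"
    and S: "open {x. V x < \<infinity>}" "{x. V x < \<infinity>} \<noteq> {}"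
  obtains d :: "'a \<Rightarrow> real" and D C e c where
    "d \<in> borel_measurable borel" "\<And>x. 0 \<le> d x" "\<And>x. d x \<le> D" "0 < c"
    "approx_kernel (density lborel (\<lambda>x. ennreal (d x))) (riesz s) (riesz_trunc s) C (\<lambda>T. trunc s T 0) e"
    "\<And>x. exp_neg (V x) = c * (d x * exp (g * approx_kernel.pot (density lborel (\<lambda>x. ennreal (d x))) (riesz s) x))"
proof -
  define v where "v x = exp_neg (V x)" for x
  have vm [measurable]: "v \<in> borel_measurable borel" using int unfolding v_def[abs_def] by simp
  have v01: "0 \<le> v x" "v x \<le> 1" for x by (simp_all add: v_def exp_neg_nonneg exp_neg_le_1)
  have vi: "integrable lborel v" using int by (simp add: v_def[abs_def])
  define Z where "Z = (\<integral>x. v x \<partial>lborel)"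
  have Z: "0 < Z" unfolding Z_def v_def by (rule exp_neg_integral_pos[OF int S])
  define d0 where "d0 x = v x / Z" for x
  have d0m [measurable]: "d0 \<in> borel_measurable borel" unfolding d0_def[abs_def] by measurable
  have d00: "0 \<le> d0 x" and d0D: "d0 x \<le> 1 / Z" for x using v01 Z by (auto simp: d0_def divide_right_mono)
  have d0i: "integrable lborel d0" "(\<integral>x. d0 x \<partial>lborel) = 1" using vi Z by (simp_all add: d0_def[abs_def] Z_def)
  let ?nu = "density lborel (\<lambda>x. ennreal (d0 x))"
  have P0: "prob_space ?nu" by (rule prob_space_density_lborel[OF d0i(1) d00 d0i(2)])
  obtain C0 e0 where "approx_kernel ?nu (riesz s) (riesz_trunc s) C0 (\<lambda>T. trunc s T 0) e0"
    using riesz_approx_kernel[OF s refl P0 d0m d00 d0D] by blast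
  then interpret nu: approx_kernel ?nu "riesz s" "riesz_trunc s" C0 "\<lambda>T. trunc s T 0" e0 .
  obtain u where u: "nu.pdens g u" "\<And>x. nu.mf g u x = u x" using nu.mean_field_exists[OF g] by blast
  have um [measurable]: "u \<in> borel_measurable borel" and u0: "\<And>x. 0 \<le> u x" and uB: "\<And>x. u x \<le> exp (g * C0)"
    and u1: "(\<integral>x. u x \<partial>?nu) = 1"
    using u(1) by (auto simp: nu.pdens_def)
  have Zu: "0 < nu.mfZ g u" by (rule nu.mfZ_bounds(3)[OF u(1) g])
  define d where "d x = d0 x * u x" for x
  have dm [measurable]: "d \<in> borel_measurable borel" unfolding d_def[abs_def] by measurable
  have dn: "0 \<le> d x" for x using d00 u0 by (simp add: d_def)
  have dD: "d x \<le> (1 / Z) * exp (g * C0)" for x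
    unfolding d_def using d00 d0D u0 uB Z by (intro mult_mono) auto
  have "integrable ?nu u" using nu.bd_integrable[OF nu.pdens_bd[OF u(1)]] .
  then have di: "integrable lborel d"
    using d00 by (subst (asm) integrable_density) (auto simp: d_def[abs_def])
  have d1: "(\<integral>x. d x \<partial>lborel) = 1"
    using u1 d00 by (subst (asm) integral_density) (auto simp: d_def)
  let ?mu = "density lborel (\<lambda>x. ennreal (d x))"
  have P: "prob_space ?mu" by (rule prob_space_density_lborel[OF di dn d1])
  obtain C e where A: "approx_kernel ?mu (riesz s) (riesz_trunc s) C (\<lambda>T. trunc s T 0) e"
    using riesz_approx_kernel[OF s refl P dm dn dD] by blast
  have rm: "(\<lambda>y. riesz s x y) \<in> borel_measurable borel" for x :: 'a
    unfolding riesz_def by measurable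
  have pot: "approx_kernel.pot ?mu (riesz s) x = nu.iop (riesz s) u x" for x
  proof -
    have "approx_kernel.pot ?mu (riesz s) x = (\<integral>y. d y * riesz s x y \<partial>lborel)"
      unfolding approx_kernel.pot_def[OF A] using dn rm by (subst integral_density) auto
    also have "\<dots> = (\<integral>y. d0 y * (riesz s x y * u y) \<partial>lborel)"
      by (intro Bochner_Integration.integral_cong) (auto simp: d_def)
    also have "\<dots> = nu.iop (riesz s) u x"
      unfolding nu.iop_def using d00 rm by (subst integral_density) auto
    finally show ?thesis .
  qed
  have "exp_neg (V x) = (Z * nu.mfZ g u) * (d x * exp (g * approx_kernel.pot ?mu (riesz s) x))" for x
  proof -
    have "u x = exp (- g * nu.iop (riesz s) u x) / nu.mfZ g u"
      using u(2)[of x] by (simp add: nu.mf_def)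
    then have "u x * exp (g * nu.iop (riesz s) u x) = 1 / nu.mfZ g u"
      by (simp add: exp_minus)
    then have "(Z * nu.mfZ g u) * (d0 x * (u x * exp (g * nu.iop (riesz s) u x))) = v x"
      using Z Zu by (simp add: d0_def)
    then have "v x = (Z * nu.mfZ g u) * (d x * exp (g * nu.iop (riesz s) u x))"
      unfolding d_def by (simp only: mult.assoc)
    then show ?thesis unfolding pot by (simp only: v_def)
  qed
  moreover have "0 < Z * nu.mfZ g u" using Z Zu by simp
  ultimately show thesis using that[OF dm dn dD _ A] by blast
qed

theorem riesz_gas_local_poisson:
  fixes V :: "'a::euclidean_space \<Rightarrow> ennreal" and \<beta> :: "nat \<Rightarrow> real"
  assumes s: "0 < s" "s < real DIM('a)" and g: "0 \<le> \<gamma>"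
    and int: "integrable lborel (\<lambda>x. exp_neg (V x))"
    and S: "open {x. V x < \<infinity>}" "continuous_on {x. V x < \<infinity>} V" and E: "V E < \<infinity>"
    and \<beta>: "\<And>N. 0 < \<beta> N" and lim: "(\<lambda>N. real N * \<beta> N) \<longlonglongrightarrow> \<gamma>"
  shows "\<exists>(M :: 'a measure measure) \<Xi>. homogeneous_poisson_process M \<Xi> \<and>
    pp_converges_in_distribution (\<lambda>N. riesz_gibbs s V (\<beta> N) N) (\<lambda>N. local_process E N) M \<Xi>"
proof -
  have ne: "{x. V x < \<infinity>} \<noteq> {}" using E by auto
  obtain d :: "'a \<Rightarrow> real" and D C e c where
    dm [measurable]: "d \<in> borel_measurable borel" and d: "\<And>x. 0 \<le> d x" "\<And>x. d x \<le> D" and c: "0 < c" and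
    A: "approx_kernel (density lborel (\<lambda>x. ennreal (d x))) (riesz s) (riesz_trunc s) C (\<lambda>T. trunc s T 0) e" and
    v: "\<And>x. exp_neg (V x) = c * (d x * exp (\<gamma> * approx_kernel.pot (density lborel (\<lambda>x. ennreal (d x))) (riesz s) x))"
    by (rule riesz_mean_field_density[OF s g int S(1) ne]) (rule that; assumption)
  let ?mu = "density lborel (\<lambda>x. ennreal (d x))"
  interpret mu: approx_kernel ?mu "riesz s" "riesz_trunc s" C "\<lambda>T. trunc s T 0" e by (rule A)
  \<comment> \<open>The equation determines \<open>d\<close> at every point from \<open>V\<close>
    and the potential. So \<open>d\<close>, obtained merely as a bounded measurable function, is
    continuous and positive at \<open>E\<close>.\<close>
  have deq: "d x = exp_neg (V x) * exp (- \<gamma> * mu.pot x) / c" for x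
  proof -
    have "exp (\<gamma> * mu.pot x) * exp (- \<gamma> * mu.pot x) = 1" by (simp flip: exp_add)
    then have "exp_neg (V x) * exp (- \<gamma> * mu.pot x) = c * d x"
      unfolding v by (simp only: mult.assoc mult_1_right)
    then show ?thesis using c by simp
  qed
  have "isCont mu.pot E"
    using riesz_pot_continuous[OF s(1) A] by (simp add: continuous_on_eq_continuous_at)
  then have "isCont (\<lambda>x. exp_neg (V x) * exp (- \<gamma> * mu.pot x) / c) E"
    using c by (intro continuous_intros isCont_exp_neg[OF S E]) auto
  then have cont: "isCont d E" unfolding deq[abs_def, symmetric] .
  define \<theta> where "\<theta> = d E"
  have "0 < exp_neg (V E) * exp (- \<gamma> * mu.pot E) / c" using E c by (auto simp: exp_neg_def)
  with deq[of E] have "0 < \<theta>" unfolding \<theta>_def by linarith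
  then obtain M :: "'a measure measure" where M: "point_process M (\<lambda>\<mu>. \<mu>)"
    "\<And>f. f \<in> test_functions \<Longrightarrow> laplace_functional M (\<lambda>\<mu>. \<mu>) f = exp (\<theta> * (\<integral>x. exp (- f x) - 1 \<partial>lborel))"
    by (rule poisson_process_exists) (rule that; assumption)
  have gibbs: "riesz_gibbs s V (\<beta> N) N = mu.gibbs \<gamma> (\<beta> N) {1..N}" for N
    by (rule riesz_gibbs_eq[OF A refl dm d(1) v c g \<beta>])
  have \<beta>0: "0 \<le> \<beta> N" for N using \<beta>[of N] by simp
  have "point_process (riesz_gibbs s V (\<beta> N) N) (local_process E N)" for N
    unfolding point_process_def gibbs
  proof
    show "prob_space (mu.gibbs \<gamma> (\<beta> N) {1..N})" by (rule mu.prob_space_gibbs) (use g \<beta>0 in auto)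
    have s: "sets (mu.gibbs \<gamma> (\<beta> N) {1..N}) = sets (PiM {1..N} (\<lambda>_. borel))"
      unfolding mu.sets_gibbs by (rule mu.sets_PiM_borel)
    show "local_process E N \<in> measurable (mu.gibbs \<gamma> (\<beta> N) {1..N}) config_algebra"
    proof -
      have "measurable (mu.gibbs \<gamma> (\<beta> N) {1..N}) config_algebra = measurable (PiM {1..N} (\<lambda>_. borel :: 'a measure)) (config_algebra :: 'a measure measure)"
        by (rule measurable_cong_sets[OF s refl])
      then show ?thesis using local_process_measurable[of E N] by blast
    qed
  qed
  moreover have "(\<lambda>N. laplace_functional (riesz_gibbs s V (\<beta> N) N) (local_process E N) f) \<longlonglongrightarrow> laplace_functional M (\<lambda>\<mu>. \<mu>) f"
    if f: "f \<in> test_functions" for f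
  proof -
    have fm [measurable]: "f \<in> borel_measurable borel" and f0: "\<And>x. 0 \<le> f x"
      using f test_function_measurable test_function_nonneg by auto
    define p where "p N y = exp (- f ((real N powr (1 / real DIM('a))) *\<^sub>R (y - E)))" for N y
    have pm: "p N \<in> borel_measurable borel" for N unfolding p_def[abs_def] by measurable
    have lap: "laplace_functional (riesz_gibbs s V (\<beta> N) N) (local_process E N) f =
        (\<integral>x. (\<Prod>i\<in>{1..N}. p N (x i)) \<partial>mu.gibbs \<gamma> (\<beta> N) {1..N})" for N
      unfolding laplace_functional_def gibbs local_process_integral[OF fm] p_def
      by (simp only: sum_negf[symmetric] exp_sum finite_atLeastAtMost)
    have "(\<lambda>N. real N * (\<integral>y. 1 - p N y \<partial>?mu)) \<longlonglongrightarrow> \<theta> * (\<integral>z. 1 - exp (- f z) \<partial>lborel)"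
    proof -
      have "(\<integral>y. 1 - p N y \<partial>?mu) = (\<integral>y. d y * (1 - exp (- f ((real N powr (1 / real DIM('a))) *\<^sub>R (y - E)))) \<partial>lborel)" for N
        unfolding p_def using d by (subst integral_density) auto
      then show ?thesis
        using scaling_limit[OF dm d cont f] by (simp only: \<theta>_def)
    qed
    then have l: "(\<lambda>N. \<integral>x. (\<Prod>i\<in>{1..N}. p N (x i)) \<partial>mu.gibbs \<gamma> (\<beta> N) {1..N}) \<longlonglongrightarrow>
        exp (- (\<theta> * (\<integral>z. 1 - exp (- f z) \<partial>lborel)))"
      by (rule mu.gibbs_product_limit[OF g \<beta>0 lim pm, rotated 2]) (simp_all add: p_def f0)
    have e: "- (\<theta> * (\<integral>z. 1 - exp (- f z) \<partial>lborel)) = \<theta> * (\<integral>z. exp (- f z) - 1 \<partial>lborel)"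
    proof -
      have "(\<integral>z. exp (- f z) - 1 \<partial>lborel) = (\<integral>z. - (1 - exp (- f z)) \<partial>lborel)" by simp
      also have "\<dots> = - (\<integral>z. 1 - exp (- f z) \<partial>lborel)" by (rule Bochner_Integration.integral_minus)
      finally show ?thesis by simp
    qed
    show ?thesis using l unfolding lap M(2)[OF f] e .
  qed
  ultimately have "pp_converges_in_distribution (\<lambda>N. riesz_gibbs s V (\<beta> N) N) (\<lambda>N. local_process E N) M (\<lambda>\<mu>. \<mu>)"
    using M(1) unfolding pp_converges_in_distribution_def by blast
  moreover have "homogeneous_poisson_process M (\<lambda>\<mu>. \<mu>)"
    using M \<open>0 < \<theta>\<close> unfolding homogeneous_poisson_process_def by blast
  ultimately show ?thesis by blast
qed

theorem corollary1p5:
  fixes s \<gamma> :: real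
    and V :: "real ^ 'n \<Rightarrow> ennreal"
    and \<beta> :: "nat \<Rightarrow> real"
    and E :: "real ^ 'n"
  assumes "0 < s" and "s < real CARD('n)"
    and "integrable lborel (\<lambda>x. exp_neg (V x))"
    and "open {x. V x < \<infinity>}" and "{x. V x < \<infinity>} \<noteq> {}"
    and "continuous_on {x. V x < \<infinity>} V"
    and "E \<in> {x. V x < \<infinity>}"
    and "\<And>N. 0 < \<beta> N"
    and "0 \<le> \<gamma>" and "(\<lambda>N. real N * \<beta> N) \<longlonglongrightarrow> \<gamma>"
  shows "\<exists>(M :: (real ^ 'n) measure measure) \<Xi>.
           homogeneous_poisson_process M \<Xi> \<and>
           pp_converges_in_distribution
             (\<lambda>N. riesz_gibbs s V (\<beta> N) N) (\<lambda>N. local_process E N) M \<Xi>"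
proof (rule riesz_gas_local_poisson)
  show "s < real DIM(real ^ 'n)" using assms(2) by simp
  show "V E < \<infinity>" using assms(7) by simp
qed (rule assms)+

end
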